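(* Let $n,k,N\geq 1$ be integers and let $F\colon\mathbb{R}^n\times\odot^k(\mathbb{R}^n,\mathbb{R}^N)\to\mathbb{R}$ be a Carathéodory integrand satisfying $$F(x,t\xi)=|t|F(x,\xi)\qquad\text{and}\qquad|F(x,\xi)|\leq a(x)|\xi|$$ for almost all $x\in\mathbb{R}^n$, all $t\in\mathbb{R}$ and all $\xi\in\odot^k(\mathbb{R}^n,\mathbb{R}^N)$, where $a\in L^1_{\rm loc}(\mathbb{R}^n)$ is a given function. Then $$\int_{\mathbb{R}^n}F(x,D^k\phi(x))\,dx\geq 0$$ holds for all $\phi\in C^\infty_c(\mathbb{R}^n,\mathbb{R}^N)$ if and only if $F(x,\xi)\geq 0$ for almost all $x\in\mathbb{R}^n$ and all $\xi\in\odot^k(\mathbb{R}^n,\mathbb{R}^N)$.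
   Context: $\odot^k(\mathbb{R}^n,\mathbb{R}^N)$ is the (normed) finite dimensional space of symmetric $k$-linear maps $(\mathbb{R}^n)^k\to\mathbb{R}^N$; for a smooth map $\phi\colon\mathbb{R}^n\to\mathbb{R}^N$ the $k$-th derivative $D^k\phi(x)$ belongs to this space. A Carathéodory integrand $F(x,\xi)$ is measurable in $x$ and continuous in $\xi$. $C^\infty_c(\mathbb{R}^n,\mathbb{R}^N)$ is the space of smooth compactly supported maps. *)

theory Defs
  imports "HOL-Analysis.Analysis" "HOL-Library.Multiset"
begin

section \<open>Symmetric multilinear maps\<close>

text \<open>
  The order \<open>k\<close> is a natural number, so a \<open>k\<close>-linear map takes its arguments as a list of
  length \<open>k\<close>. Such a map is represented by its extension by zero to lists of other lengths,
  which makes equality of maps coincide with equality of the representing functions.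
\<close>

definition multilinear_maps ::
    "nat \<Rightarrow> ('a::real_normed_vector list \<Rightarrow> 'b::real_normed_vector) set" where
  "multilinear_maps k =
     {\<xi>. (\<forall>us ws. length us + length ws + 1 = k \<longrightarrow> linear (\<lambda>v. \<xi> (us @ v # ws))) \<and>
         (\<forall>vs. length vs \<noteq> k \<longrightarrow> \<xi> vs = 0)}"

definition sym_maps ::
    "nat \<Rightarrow> ('a::real_normed_vector list \<Rightarrow> 'b::real_normed_vector) set" where
  "sym_maps k = {\<xi> \<in> multilinear_maps k. \<forall>vs ws. mset vs = mset ws \<longrightarrow> \<xi> vs = \<xi> ws}"

definition mnorm :: "nat \<Rightarrow> ('a::real_normed_vector list \<Rightarrow> 'b::real_normed_vector) \<Rightarrow> real" where
  "mnorm k \<xi> = (SUP vs \<in> {vs. length vs = k \<and> (\<forall>v \<in> set vs. norm v \<le> 1)}. norm (\<xi> vs))"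

text \<open>
  The value \<open>0\<close> outside the carrier is only there because \<^locale>\<open>Metric_space\<close> asks for
  a nonnegative distance on the whole type.
\<close>

definition sym_dist :: "nat \<Rightarrow> ('a::real_normed_vector list \<Rightarrow> 'b::real_normed_vector) \<Rightarrow>
    ('a list \<Rightarrow> 'b) \<Rightarrow> real" where
  "sym_dist k \<xi> \<eta> =
     (if \<xi> \<in> sym_maps k \<and> \<eta> \<in> sym_maps k then mnorm k (\<lambda>vs. \<xi> vs - \<eta> vs) else 0)"

definition sym_topology ::
    "nat \<Rightarrow> ('a::real_normed_vector list \<Rightarrow> 'b::real_normed_vector) topology" where
  "sym_topology k = Metric_space.mtopology (sym_maps k) (sym_dist k)"

lemma multilinear_maps_Cons:
  assumes "\<xi> \<in> multilinear_maps (Suc k)"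
  shows "(\<lambda>vs. \<xi> (v # vs)) \<in> multilinear_maps k"
proof -
  have "linear (\<lambda>w. \<xi> (v # us @ w # ws))" if "length us + length ws + 1 = k" for us ws
  proof -
    have "\<forall>us ws. length us + length ws + 1 = Suc k \<longrightarrow> linear (\<lambda>w. \<xi> (us @ w # ws))"
      using assms by (simp add: multilinear_maps_def)
    from this[rule_format, of "v # us" ws] that show ?thesis by simp
  qed
  then show ?thesis
    using assms unfolding multilinear_maps_def by auto
qed

lemma multilinear_maps_linear_hd:
  assumes "\<xi> \<in> multilinear_maps (Suc k)" "length vs = k"
  shows "linear (\<lambda>v. \<xi> (v # vs))"
proof -
  have "\<forall>us ws. length us + length ws + 1 = Suc k \<longrightarrow> linear (\<lambda>w. \<xi> (us @ w # ws))"
    using assms(1) by (simp add: multilinear_maps_def)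
  from this[rule_format, of "[]" vs] assms(2) show ?thesis by simp
qed

lemma multilinear_maps_bounded:
  fixes \<xi> :: "'a::euclidean_space list \<Rightarrow> 'b::real_normed_vector"
  assumes "\<xi> \<in> multilinear_maps k"
  shows "\<exists>B. \<forall>vs. length vs = k \<and> (\<forall>v \<in> set vs. norm v \<le> 1) \<longrightarrow> norm (\<xi> vs) \<le> B"
  using assms
proof (induction k arbitrary: \<xi>)
  case 0
  show ?case by (rule exI[of _ "norm (\<xi> [])"]) auto
next
  case (Suc k)
  have "\<forall>b. \<exists>B. \<forall>vs. length vs = k \<and> (\<forall>v \<in> set vs. norm v \<le> 1) \<longrightarrow> norm (\<xi> (b # vs)) \<le> B"
    using Suc.IH[OF multilinear_maps_Cons[OF Suc.prems]] by blast
  then obtain B where B: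
    "\<And>b vs. length vs = k \<and> (\<forall>v \<in> set vs. norm v \<le> 1) \<Longrightarrow> norm (\<xi> (b # vs)) \<le> B b"
    by metis
  have "norm (\<xi> ws) \<le> (\<Sum>b\<in>Basis. B b)"
    if ws: "length ws = Suc k" "\<forall>v \<in> set ws. norm v \<le> 1" for ws
  proof -
    obtain v vs where eq: "ws = v # vs" and len: "length vs = k"
      using ws(1) by (cases ws) auto
    have vs: "length vs = k \<and> (\<forall>v \<in> set vs. norm v \<le> 1)" using ws(2) eq len by auto
    have lin: "linear (\<lambda>v. \<xi> (v # vs))"
      using multilinear_maps_linear_hd[OF Suc.prems len] .
    have "\<xi> ws = \<xi> ((\<Sum>b\<in>Basis. (v \<bullet> b) *\<^sub>R b) # vs)"
      by (simp add: eq euclidean_representation)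
    also have "\<dots> = (\<Sum>b\<in>Basis. (v \<bullet> b) *\<^sub>R \<xi> (b # vs))"
      by (simp add: linear_sum[OF lin] linear_cmul[OF lin])
    also have "norm \<dots> \<le> (\<Sum>b\<in>Basis. B b)"
    proof (rule order_trans[OF norm_sum sum_mono])
      fix b :: 'a assume "b \<in> Basis"
      then have "\<bar>v \<bullet> b\<bar> \<le> 1"
        using Basis_le_norm[of b v] ws(2) eq by auto
      then have "\<bar>v \<bullet> b\<bar> * norm (\<xi> (b # vs)) \<le> 1 * norm (\<xi> (b # vs))"
        by (intro mult_right_mono) auto
      then show "norm ((v \<bullet> b) *\<^sub>R \<xi> (b # vs)) \<le> B b"
        using B[OF vs, of b] by simp
    qed
    finally show ?thesis .
  qed
  then show ?case by blast
qed

lemma multilinear_maps_zero: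
  fixes \<xi> :: "'a::real_normed_vector list \<Rightarrow> 'b::real_normed_vector"
  assumes "\<xi> \<in> multilinear_maps k"
    and "\<And>vs. length vs = k \<Longrightarrow> (\<forall>v \<in> set vs. norm v \<le> 1) \<Longrightarrow> \<xi> vs = 0"
  shows "length vs = k \<Longrightarrow> \<xi> vs = 0"
  using assms
proof (induction k arbitrary: \<xi> vs)
  case 0
  then show ?case by auto
next
  case (Suc k)
  obtain v ws where eq: "vs = v # ws" and len: "length ws = k"
    using Suc.prems(1) by (cases vs) auto
  have "\<xi> (v # us) = 0" if us: "length us = k" "\<forall>v \<in> set us. norm v \<le> 1" for us
  proof (cases "v = 0")
    case True
    then show ?thesis
      using linear_0[OF multilinear_maps_linear_hd[OF Suc.prems(2) us(1)]] by simp
  next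
    case False
    have lin: "linear (\<lambda>v. \<xi> (v # us))"
      using multilinear_maps_linear_hd[OF Suc.prems(2) us(1)] .
    have "\<xi> (v # us) = \<xi> ((norm v *\<^sub>R (inverse (norm v) *\<^sub>R v)) # us)"
      using False by simp
    also have "\<dots> = norm v *\<^sub>R \<xi> ((inverse (norm v) *\<^sub>R v) # us)"
      using linear_cmul[OF lin, of "norm v" "inverse (norm v) *\<^sub>R v"] .
    also have "\<xi> ((inverse (norm v) *\<^sub>R v) # us) = 0"
      using us False by (intro Suc.prems(3)) auto
    finally show ?thesis by simp
  qed
  then have "\<xi> (v # ws) = 0"
    using Suc.IH[OF len multilinear_maps_Cons[OF Suc.prems(2)]] by blast
  then show ?case using eq by simp
qed

lemma multilinear_maps_diff:
  "\<xi> \<in> multilinear_maps k \<Longrightarrow> \<eta> \<in> multilinear_maps k \<Longrightarrow>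
     (\<lambda>vs. \<xi> vs - \<eta> vs) \<in> multilinear_maps k"
  unfolding multilinear_maps_def by (auto intro!: linear_compose_sub)

lemma norm_le_mnorm:
  fixes \<xi> :: "'a::euclidean_space list \<Rightarrow> 'b::real_normed_vector"
  assumes "\<xi> \<in> multilinear_maps k" "length vs = k" "\<forall>v \<in> set vs. norm v \<le> 1"
  shows "norm (\<xi> vs) \<le> mnorm k \<xi>"
proof -
  have "bdd_above ((\<lambda>vs. norm (\<xi> vs)) ` {vs. length vs = k \<and> (\<forall>v \<in> set vs. norm v \<le> 1)})"
    using multilinear_maps_bounded[OF assms(1)] by (auto simp: bdd_above_def)
  then show ?thesis
    unfolding mnorm_def using assms(2,3) by (intro cSUP_upper) auto
qed

lemma mnorm_le:
  assumes "\<And>vs. length vs = k \<Longrightarrow> (\<forall>v \<in> set vs. norm v \<le> 1) \<Longrightarrow> norm (\<xi> vs) \<le> B"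
  shows "mnorm k \<xi> \<le> B"
  unfolding mnorm_def
proof (rule cSUP_least)
  have "replicate k 0 \<in> {vs. length vs = k \<and> (\<forall>v \<in> set vs. norm (v::'a) \<le> 1)}"
    by simp
  then show "{vs. length vs = k \<and> (\<forall>v \<in> set vs. norm (v::'a) \<le> 1)} \<noteq> {}"
    by blast
qed (use assms in auto)

lemma mnorm_nonneg:
  fixes \<xi> :: "'a::euclidean_space list \<Rightarrow> 'b::real_normed_vector"
  assumes "\<xi> \<in> multilinear_maps k"
  shows "0 \<le> mnorm k \<xi>"
  by (rule order_trans[OF norm_ge_zero norm_le_mnorm[OF assms, of "replicate k 0"]]) auto

lemma Metric_space_sym_maps:
  "Metric_space (sym_maps k :: ('a::euclidean_space list \<Rightarrow> 'b::real_normed_vector) set)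
     (sym_dist k)"
proof
  fix \<xi> \<eta> \<zeta> :: "'a list \<Rightarrow> 'b"
  have sub: "f \<in> multilinear_maps k" if "f \<in> sym_maps k" for f :: "'a list \<Rightarrow> 'b"
    using that by (simp add: sym_maps_def)
  show "0 \<le> sym_dist k \<xi> \<eta>"
    by (simp add: sym_dist_def mnorm_nonneg multilinear_maps_diff sub)
  show "sym_dist k \<xi> \<eta> = sym_dist k \<eta> \<xi>"
    by (simp add: sym_dist_def mnorm_def norm_minus_commute conj_commute)
  show "sym_dist k \<xi> \<eta> = 0 \<longleftrightarrow> \<xi> = \<eta>" if mem: "\<xi> \<in> sym_maps k" "\<eta> \<in> sym_maps k"
  proof
    assume "sym_dist k \<xi> \<eta> = 0"
    then have 0: "mnorm k (\<lambda>vs. \<xi> vs - \<eta> vs) = 0" using mem by (simp add: sym_dist_def)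
    have D: "(\<lambda>vs. \<xi> vs - \<eta> vs) \<in> multilinear_maps k"
      using mem by (intro multilinear_maps_diff sub)
    have "\<xi> vs - \<eta> vs = 0" if "length vs = k" for vs
      using multilinear_maps_zero[OF D _ that] norm_le_mnorm[OF D] 0 by auto
    moreover have "\<xi> vs = \<eta> vs" if "length vs \<noteq> k" for vs
      using that mem[THEN sub] by (simp add: multilinear_maps_def)
    ultimately show "\<xi> = \<eta>" by (metis eq_iff_diff_eq_0 ext)
  next
    assume "\<xi> = \<eta>"
    moreover have "mnorm k (\<lambda>vs. 0 :: 'b) \<le> 0" for k
      by (rule mnorm_le) simp
    ultimately show "sym_dist k \<xi> \<eta> = 0"
      using mem mnorm_le[of k "\<lambda>vs::'a list. 0 :: 'b" 0]
        mnorm_nonneg[OF multilinear_maps_diff[OF sub[OF mem(1)] sub[OF mem(1)]]]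
      by (simp add: sym_dist_def)
  qed
  show "sym_dist k \<xi> \<zeta> \<le> sym_dist k \<xi> \<eta> + sym_dist k \<eta> \<zeta>"
    if mem: "\<xi> \<in> sym_maps k" "\<eta> \<in> sym_maps k" "\<zeta> \<in> sym_maps k"
  proof -
    have "mnorm k (\<lambda>vs. \<xi> vs - \<zeta> vs)
        \<le> mnorm k (\<lambda>vs. \<xi> vs - \<eta> vs) + mnorm k (\<lambda>vs. \<eta> vs - \<zeta> vs)"
    proof (rule mnorm_le)
      fix vs :: "'a list" assume vs: "length vs = k" "\<forall>v \<in> set vs. norm v \<le> 1"
      have "norm (\<xi> vs - \<zeta> vs) \<le> norm (\<xi> vs - \<eta> vs) + norm (\<eta> vs - \<zeta> vs)"
        using norm_triangle_ineq[of "\<xi> vs - \<eta> vs" "\<eta> vs - \<zeta> vs"] by simp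
      also have "\<dots> \<le> mnorm k (\<lambda>vs. \<xi> vs - \<eta> vs) + mnorm k (\<lambda>vs. \<eta> vs - \<zeta> vs)"
        by (intro add_mono norm_le_mnorm[OF multilinear_maps_diff[OF sub sub] vs] mem)
      finally show "norm (\<xi> vs - \<zeta> vs)
        \<le> mnorm k (\<lambda>vs. \<xi> vs - \<eta> vs) + mnorm k (\<lambda>vs. \<eta> vs - \<zeta> vs)" .
    qed
    then show ?thesis using mem by (simp add: sym_dist_def)
  qed
qed


section \<open>Higher derivatives and test maps\<close>

text \<open>
  \<open>iter_deriv \<phi> [v\<^sub>1, \<dots>, v\<^sub>k] x = D\<^sup>k\<phi>(x)(v\<^sub>1, \<dots>, v\<^sub>k)\<close>, where the \<open>k\<close>-th derivative is the
  derivative of the \<open>(k - 1)\<close>-st one, the new direction being inserted in front.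
\<close>

primrec iter_deriv ::
    "('a::real_normed_vector \<Rightarrow> 'b::real_normed_vector) \<Rightarrow> 'a list \<Rightarrow> 'a \<Rightarrow> 'b" where
  "iter_deriv \<phi> [] = \<phi>"
| "iter_deriv \<phi> (v # vs) = (\<lambda>x. frechet_derivative (iter_deriv \<phi> vs) (at x) v)"

definition Dk :: "nat \<Rightarrow> ('a::real_normed_vector \<Rightarrow> 'b::real_normed_vector) \<Rightarrow> 'a \<Rightarrow> 'a list \<Rightarrow> 'b" where
  "Dk k \<phi> x = (\<lambda>vs. if length vs = k then iter_deriv \<phi> vs x else 0)"

text \<open>
  Differentiability of the iterated derivatives of all orders already entails that all of them
  are continuous, so this is \<open>C\<^sup>\<infinity>\<close> on a finite-dimensional space.
\<close>

definition smooth :: "('a::euclidean_space \<Rightarrow> 'b::real_normed_vector) \<Rightarrow> bool" where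
  "smooth \<phi> \<longleftrightarrow> (\<forall>vs. iter_deriv \<phi> vs differentiable_on UNIV)"

definition test_maps :: "('a::euclidean_space \<Rightarrow> 'b::real_normed_vector) set" where
  "test_maps = {\<phi>. smooth \<phi> \<and> compact (closure {x. \<phi> x \<noteq> 0})}"


section \<open>Integrands\<close>

definition locally_integrable :: "('a::euclidean_space \<Rightarrow> real) \<Rightarrow> bool" where
  "locally_integrable a \<longleftrightarrow> (\<forall>K. compact K \<longrightarrow> a absolutely_integrable_on K)"

definition caratheodory ::
    "nat \<Rightarrow> ('a::euclidean_space \<Rightarrow> ('a list \<Rightarrow> 'b::euclidean_space) \<Rightarrow> real) \<Rightarrow> bool" where
  "caratheodory k F \<longleftrightarrow>
     (\<forall>\<xi> \<in> sym_maps k. (\<lambda>x. F x \<xi>) \<in> borel_measurable lebesgue) \<and>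
     (AE x in lebesgue. continuous_map (sym_topology k) euclidean (F x))"

end

theory Submission
  imports Defs
begin

text \<open>
  Nonnegative integrands have nonnegative integrals, so only the passage from integrals to pointwise
  values needs an argument. It combines oscillating test maps, which replace the integrand by
  smaller ones, with a convexity property of functions that are homogeneous of degree one.

  Oscillations. Let \<open>e = v\<^sup>k \<otimes> w\<close>. Adding \<open>\<rho>(x) M\<^sup>-\<^sup>k h(M v \<bullet> x) w\<close> to a test map \<open>\<phi>\<close>, with \<open>M\<close>
  large, changes \<open>D\<^sup>k\<phi>(x)\<close> by \<open>\<rho>(x) h\<^sup>(\<^sup>k\<^sup>)(M v \<bullet> x) e\<close> up to a small error. If \<open>h\<^sup>(\<^sup>k\<^sup>)\<close> is close
  to a square wave, averaging over the phase shows that the two-point average of \<open>F(x, D\<^sup>k\<phi> + \<rho> e)\<close>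
  and \<open>F(x, D\<^sup>k\<phi> - \<rho> e)\<close> has a nonnegative integral (\<open>two_point_average_nonneg\<close>). With \<open>\<rho>\<close> close to
  the indicator of the set where this average is smaller than \<open>F(x, D\<^sup>k\<phi>)\<close>, the same follows for the
  minimum of \<open>F\<close> and its two-point average (\<open>nonneg_on_tests_lam_step\<close>). Iterating over the rational
  multiples of finitely many maps \<open>e\<close> that span all symmetric maps (\<open>sym_maps_sum_rank1\<close>, by Ryser's
  formula for permanents) gives a decreasing sequence of integrands \<open>G\<^sub>j\<close> with nonnegative
  integrals, starting from \<open>F\<close>. For \<open>\<phi> = 0\<close> the integrand \<open>G\<^sub>j(x, 0)\<close> is nonpositive, because
  \<open>F(x, 0) = 0\<close>, and its integral over each ball is nonnegative. So \<open>G\<^sub>j(x, 0) = 0\<close> for almost every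
  \<open>x\<close> and all \<open>j\<close> (\<open>zero_if_nonneg_on_tests\<close>).

  Convexity. Fix such an \<open>x\<close> and put \<open>f = F(x, _)\<close>. On rational combinations of the chosen
  directions, the limit \<open>g\<close> of \<open>G\<^sub>j(x, _)\<close> is the largest function below \<open>f\<close> that is convex in these
  directions. It is finite since it vanishes at \<open>0\<close>, homogeneous since \<open>f\<close> is, and Lipschitz since
  it grows linearly. For a direction \<open>e\<close> the limit of \<open>g(\<xi> + t e) - t g(e)\<close> as \<open>t\<close> tends to infinity
  lies below \<open>g\<close>, has the same properties and is affine along \<open>e\<close> (\<open>peel_direction\<close>). Treating all
  directions in turn leaves a function \<open>l \<le> f\<close> that is additive on integer combinations, where
  evenness of \<open>f\<close> gives \<open>f \<ge> \<bar>l\<bar> \<ge> 0\<close> (\<open>even_homogeneous_nonneg\<close>). Homogeneity and continuity of \<open>f\<close>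
  do the rest.
\<close>

section \<open>Symmetric maps and powers of linear forms\<close>

text \<open>
  The map \<open>v\<^sup>k \<otimes> w\<close>, extended by zero to lists of other lengths. A plane wave with wave vector \<open>v\<close>
  and values in the line through \<open>w\<close> has its \<open>k\<close>-th derivative on the line through this map.
\<close>

definition rank1 :: "nat \<Rightarrow> 'a::euclidean_space \<Rightarrow> 'b::real_normed_vector \<Rightarrow> 'a list \<Rightarrow> 'b" where
  "rank1 k v w = (\<lambda>us. if length us = k then prod_list (map (\<lambda>u. v \<bullet> u) us) *\<^sub>R w else 0)"

lemma sym_maps_multilinear: "\<xi> \<in> sym_maps k \<Longrightarrow> \<xi> \<in> multilinear_maps k"
  by (simp add: sym_maps_def)

lemma sym_maps_zero: "(\<lambda>vs. 0) \<in> sym_maps k"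
  by (auto simp: sym_maps_def multilinear_maps_def intro: module_hom_zero)

lemma sym_maps_cong_mset: "\<xi> \<in> sym_maps k \<Longrightarrow> mset vs = mset ws \<Longrightarrow> \<xi> vs = \<xi> ws"
  unfolding sym_maps_def by blast

lemma sym_mapsI:
  assumes "\<And>us ws. length us + length ws + 1 = k \<Longrightarrow> linear (\<lambda>v. \<xi> (us @ v # ws))"
    and "\<And>vs. length vs \<noteq> k \<Longrightarrow> \<xi> vs = 0"
    and "\<And>vs ws. mset vs = mset ws \<Longrightarrow> \<xi> vs = \<xi> ws"
  shows "\<xi> \<in> sym_maps k"
  using assms unfolding sym_maps_def multilinear_maps_def by blast

lemma sym_maps_linear:
  "\<xi> \<in> sym_maps k \<Longrightarrow> length us + length ws + 1 = k \<Longrightarrow> linear (\<lambda>v. \<xi> (us @ v # ws))"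
  unfolding sym_maps_def multilinear_maps_def by blast

lemma sym_maps_wrong_length: "\<xi> \<in> sym_maps k \<Longrightarrow> length vs \<noteq> k \<Longrightarrow> \<xi> vs = 0"
  unfolding sym_maps_def multilinear_maps_def by blast

lemma sym_maps_add:
  assumes "\<xi> \<in> sym_maps k" "\<eta> \<in> sym_maps k"
  shows "(\<lambda>vs. \<xi> vs + \<eta> vs) \<in> sym_maps k"
proof (rule sym_mapsI)
  show "linear (\<lambda>v. \<xi> (us @ v # ws) + \<eta> (us @ v # ws))"
    if "length us + length ws + 1 = k" for us ws
    by (intro linear_compose_add sym_maps_linear[OF _ that] assms)
  show "\<xi> vs + \<eta> vs = 0" if "length vs \<noteq> k" for vs
    using assms[THEN sym_maps_wrong_length, OF that] by simp
  show "\<xi> vs + \<eta> vs = \<xi> ws + \<eta> ws" if "mset vs = mset ws" for vs ws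
    by (intro arg_cong2[where f = "(+)"] sym_maps_cong_mset[OF assms(1) that]
        sym_maps_cong_mset[OF assms(2) that])
qed

lemma sym_maps_scale:
  assumes "\<xi> \<in> sym_maps k"
  shows "(\<lambda>vs. c *\<^sub>R \<xi> vs) \<in> sym_maps k"
proof (rule sym_mapsI)
  show "linear (\<lambda>v. c *\<^sub>R \<xi> (us @ v # ws))" if "length us + length ws + 1 = k" for us ws
    by (intro linear_compose_scale_right sym_maps_linear[OF _ that] assms)
  show "c *\<^sub>R \<xi> vs = 0" if "length vs \<noteq> k" for vs
    using sym_maps_wrong_length[OF assms that] by simp
  show "c *\<^sub>R \<xi> vs = c *\<^sub>R \<xi> ws" if "mset vs = mset ws" for vs ws
    using sym_maps_cong_mset[OF assms that] by simp
qed

lemma sym_maps_diff: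
  assumes "\<xi> \<in> sym_maps k" "\<eta> \<in> sym_maps k"
  shows "(\<lambda>vs. \<xi> vs - \<eta> vs) \<in> sym_maps k"
  using sym_maps_add[OF assms(1) sym_maps_scale[OF assms(2), of "-1"]] by simp

lemma sym_maps_sum:
  assumes "\<And>i. i \<in> I \<Longrightarrow> \<xi> i \<in> sym_maps k"
  shows "(\<lambda>vs. \<Sum>i\<in>I. c i *\<^sub>R \<xi> i vs) \<in> sym_maps k"
  using assms
proof (induction I rule: infinite_finite_induct)
  case (insert i I)
  then have "(\<lambda>vs. c i *\<^sub>R \<xi> i vs + (\<Sum>i\<in>I. c i *\<^sub>R \<xi> i vs)) \<in> sym_maps k"
    by (intro sym_maps_add sym_maps_scale) auto
  then show ?case using insert by simp
qed (simp_all add: sym_maps_zero)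

lemma rank1_sym_maps: "rank1 k v w \<in> sym_maps k"
proof (rule sym_mapsI)
  fix us ws :: "'a list" assume len: "length us + length ws + 1 = k"
  have "rank1 k v w (us @ x # ws)
      = (prod_list (map ((\<bullet>) v) us) * prod_list (map ((\<bullet>) v) ws) * (v \<bullet> x)) *\<^sub>R w" for x
    using len by (simp add: rank1_def mult_ac)
  then show "linear (\<lambda>x. rank1 k v w (us @ x # ws))"
    by (intro linearI) (simp_all add: inner_add_right distrib_left scaleR_add_left)
next
  fix us ws :: "'a list" assume ms: "mset us = mset ws"
  have "length us = length ws" using ms by (rule mset_eq_length)
  moreover have "prod_mset (image_mset ((\<bullet>) v) (mset us)) = prod_mset (image_mset ((\<bullet>) v) (mset ws))"
    using ms by simp
  then have "prod_list (map ((\<bullet>) v) us) = prod_list (map ((\<bullet>) v) ws)"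
    by (simp add: prod_mset_prod_list flip: mset_map)
  ultimately show "rank1 k v w us = rank1 k v w ws" by (simp add: rank1_def)
qed (simp add: rank1_def)

lemma rank1_scale: "rank1 k v (c *\<^sub>R w) = (\<lambda>vs. c *\<^sub>R rank1 k v w vs)"
  by (auto simp: rank1_def)

lemma mnorm_add:
  fixes \<xi> \<eta> :: "'a::euclidean_space list \<Rightarrow> 'b::real_normed_vector"
  assumes "\<xi> \<in> sym_maps k" "\<eta> \<in> sym_maps k"
  shows "mnorm k (\<lambda>vs. \<xi> vs + \<eta> vs) \<le> mnorm k \<xi> + mnorm k \<eta>"
proof (rule mnorm_le)
  fix vs :: "'a list" assume vs: "length vs = k" "\<forall>v\<in>set vs. norm v \<le> 1"
  show "norm (\<xi> vs + \<eta> vs) \<le> mnorm k \<xi> + mnorm k \<eta>"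
    using norm_triangle_ineq[of "\<xi> vs" "\<eta> vs"]
      norm_le_mnorm[OF sym_maps_multilinear[OF assms(1)] vs]
      norm_le_mnorm[OF sym_maps_multilinear[OF assms(2)] vs] by linarith
qed

lemma mnorm_scale_le:
  fixes \<xi> :: "'a::euclidean_space list \<Rightarrow> 'b::real_normed_vector"
  assumes "\<xi> \<in> sym_maps k"
  shows "mnorm k (\<lambda>vs. c *\<^sub>R \<xi> vs) \<le> \<bar>c\<bar> * mnorm k \<xi>"
proof (rule mnorm_le)
  fix vs :: "'a list" assume vs: "length vs = k" "\<forall>v\<in>set vs. norm v \<le> 1"
  show "norm (c *\<^sub>R \<xi> vs) \<le> \<bar>c\<bar> * mnorm k \<xi>"
    using norm_le_mnorm[OF sym_maps_multilinear[OF assms] vs] by (simp add: mult_left_mono)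
qed

lemma mnorm_zero:
  "mnorm k (\<lambda>vs :: 'a::euclidean_space list. 0 :: 'b::real_normed_vector) = 0"
proof (rule antisym)
  show "mnorm k (\<lambda>vs :: 'a list. 0 :: 'b) \<le> 0" by (rule mnorm_le) simp
  show "0 \<le> mnorm k (\<lambda>vs :: 'a list. 0 :: 'b)"
    by (rule mnorm_nonneg[OF sym_maps_multilinear[OF sym_maps_zero]])
qed

lemma mnorm_sum:
  fixes \<xi> :: "'i \<Rightarrow> 'a::euclidean_space list \<Rightarrow> 'b::real_normed_vector"
  assumes "\<And>i. i \<in> I \<Longrightarrow> \<xi> i \<in> sym_maps k"
  shows "mnorm k (\<lambda>vs. \<Sum>i\<in>I. c i *\<^sub>R \<xi> i vs) \<le> (\<Sum>i\<in>I. \<bar>c i\<bar> * mnorm k (\<xi> i))"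
  using assms
proof (induction I rule: infinite_finite_induct)
  case (insert i I)
  have "mnorm k (\<lambda>vs. c i *\<^sub>R \<xi> i vs + (\<Sum>i\<in>I. c i *\<^sub>R \<xi> i vs))
      \<le> mnorm k (\<lambda>vs. c i *\<^sub>R \<xi> i vs) + mnorm k (\<lambda>vs. \<Sum>i\<in>I. c i *\<^sub>R \<xi> i vs)"
    using insert.prems by (intro mnorm_add sym_maps_scale sym_maps_sum) auto
  also have "\<dots> \<le> \<bar>c i\<bar> * mnorm k (\<xi> i) + (\<Sum>i\<in>I. \<bar>c i\<bar> * mnorm k (\<xi> i))"
    using insert by (intro add_mono mnorm_scale_le) auto
  finally show ?case using insert.hyps by simp
qed (simp_all add: mnorm_zero)

text \<open>
  Ryser's formula for the permanent. Expanding the products over all functions \<open>g\<close> and collecting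
  the signs of the sets \<open>S\<close> that contain the range of \<open>g\<close>, everything cancels unless \<open>g\<close> is onto.
\<close>

lemma sum_permutations_eq_alternating_sum:
  fixes A :: "nat \<Rightarrow> nat \<Rightarrow> real"
  shows "(\<Sum>g | g \<in> {..<k} \<rightarrow>\<^sub>E {..<k} \<and> g ` {..<k} = {..<k}. \<Prod>j<k. A j (g j))
    = (\<Sum>S\<in>Pow {..<k}. (-1) ^ card ({..<k} - S) * (\<Prod>j<k. \<Sum>l\<in>S. A j l))"
proof -
  let ?K = "{..<k}" and ?P = "{..<k} \<rightarrow>\<^sub>E {..<k}"
  have fin: "finite ?P" by (intro finite_PiE) auto
  have alt: "(\<Sum>S\<in>Pow ?K. if T \<subseteq> S then (-1) ^ card (?K - S) else 0) = (if T = ?K then 1 else (0::real))"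
    if T: "T \<subseteq> ?K" for T
  proof -
    have "(\<Prod>x\<in>?K - S. if x \<in> T then 0 else - 1) = (if T \<subseteq> S then (-1) ^ card (?K - S) else (0::real))"
      if "S \<subseteq> ?K" for S
    proof (cases "T \<subseteq> S")
      case True
      then have "(\<Prod>x\<in>?K - S. if x \<in> T then 0 else - 1) = (\<Prod>x\<in>?K - S. - 1 :: real)"
        by (intro prod.cong) auto
      then show ?thesis using True by simp
    next
      case False
      then show ?thesis using T by (auto intro!: prod_zero)
    qed
    then have "(\<Sum>S\<in>Pow ?K. if T \<subseteq> S then (-1) ^ card (?K - S) else (0::real))
        = (\<Prod>x\<in>?K. 1 + (if x \<in> T then 0 else - 1))"
      by (subst prod_add) auto
    also have "\<dots> = (if T = ?K then 1 else 0)"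
    proof (cases "T = ?K")
      case False
      then show ?thesis using T by (auto intro!: prod_zero)
    qed auto
    finally show ?thesis .
  qed
  have "(\<Prod>j<k. \<Sum>l\<in>S. A j l) = (\<Sum>g\<in>?P. if g ` ?K \<subseteq> S then \<Prod>j<k. A j (g j) else 0)"
    if S: "S \<subseteq> ?K" for S
  proof -
    have "(\<Prod>j<k. \<Sum>l\<in>S. A j l) = (\<Sum>g\<in>?K \<rightarrow>\<^sub>E S. \<Prod>j<k. A j (g j))"
      using S finite_subset by (intro prod_sum_PiE) auto
    also have "\<dots> = (\<Sum>g\<in>{g\<in>?P. g ` ?K \<subseteq> S}. \<Prod>j<k. A j (g j))"
    proof (rule sum.cong)
      have "g \<in> ?K \<rightarrow>\<^sub>E S \<longleftrightarrow> g \<in> ?P \<and> g ` ?K \<subseteq> S" for g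
        using S unfolding PiE_iff image_subset_iff by blast
      then show "?K \<rightarrow>\<^sub>E S = {g \<in> ?P. g ` ?K \<subseteq> S}" by blast
    qed simp
    also have "\<dots> = (\<Sum>g\<in>?P. if g ` ?K \<subseteq> S then \<Prod>j<k. A j (g j) else 0)"
      by (rule sum.inter_filter[OF fin])
    finally show ?thesis .
  qed
  then have "(\<Sum>S\<in>Pow ?K. (-1) ^ card (?K - S) * (\<Prod>j<k. \<Sum>l\<in>S. A j l))
      = (\<Sum>S\<in>Pow ?K. \<Sum>g\<in>?P. (if g ` ?K \<subseteq> S then (-1) ^ card (?K - S) else 0) * (\<Prod>j<k. A j (g j)))"
    by (intro sum.cong) (auto simp: sum_distrib_left intro!: sum.cong)
  also have "\<dots> = (\<Sum>g\<in>?P. (\<Sum>S\<in>Pow ?K. if g ` ?K \<subseteq> S then (-1) ^ card (?K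
      - S) else 0) * (\<Prod>j<k. A j (g j)))"
    by (subst sum.swap) (simp add: sum_distrib_right)
  also have "\<dots> = (\<Sum>g\<in>?P. if g ` ?K = ?K then \<Prod>j<k. A j (g j) else 0)"
  proof (rule sum.cong)
    fix g assume "g \<in> ?P"
    then have "g ` ?K \<subseteq> ?K" by auto
    from alt[OF this] show "(\<Sum>S\<in>Pow ?K. if g ` ?K \<subseteq> S then (-1) ^ card (?K
        - S) else 0) * (\<Prod>j<k. A j (g j))
        = (if g ` ?K = ?K then \<Prod>j<k. A j (g j) else 0)"
      by simp
  qed simp
  also have "\<dots> = (\<Sum>g\<in>{g\<in>?P. g ` ?K = ?K}. \<Prod>j<k. A j (g j))"
    by (rule sum.inter_filter[OF fin, symmetric])
  finally show ?thesis by simp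
qed

definition basis_lists :: "nat \<Rightarrow> 'a::euclidean_space list set" where
  "basis_lists k = {bs. length bs = k \<and> set bs \<subseteq> Basis}"

lemma finite_basis_lists: "finite (basis_lists k)"
  using finite_lists_length_eq[OF finite_Basis, of k] by (simp add: basis_lists_def conj_commute)

lemma multilinear_expansion:
  fixes \<xi> :: "'a::euclidean_space list \<Rightarrow> 'b::real_normed_vector"
  assumes "\<xi> \<in> multilinear_maps k" "length us = k"
  shows "\<xi> us = (\<Sum>bs\<in>basis_lists k. (\<Prod>j<k. us ! j \<bullet> bs ! j) *\<^sub>R \<xi> bs)"
  using assms
proof (induction k arbitrary: \<xi> us)
  case 0
  have "basis_lists 0 = {[] :: 'a list}" by (auto simp: basis_lists_def)
  then show ?case using 0 by simp
next
  case (Suc k)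
  obtain u vs where us: "us = u # vs" "length vs = k" using Suc.prems(2) by (cases us) auto
  have eq: "basis_lists (Suc k) = (\<lambda>(b, bs). b # bs) ` (Basis \<times> basis_lists k)" (is "_ = _ ` ?B")
    by (auto simp: basis_lists_def length_Suc_conv image_iff)
  have lin: "linear (\<lambda>v. \<xi> (v # vs))" using multilinear_maps_linear_hd[OF Suc.prems(1) us(2)] .
  have "\<xi> us = \<xi> ((\<Sum>b\<in>Basis. (u \<bullet> b) *\<^sub>R b) # vs)" by (simp add: us euclidean_representation)
  also have "\<dots> = (\<Sum>b\<in>Basis. (u \<bullet> b) *\<^sub>R \<xi> (b # vs))"
    by (simp add: linear_sum[OF lin] linear_cmul[OF lin])
  also have "\<dots> = (\<Sum>b\<in>Basis. (u \<bullet> b) *\<^sub>R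
      (\<Sum>bs\<in>basis_lists k. (\<Prod>j<k. vs ! j \<bullet> bs ! j) *\<^sub>R \<xi> (b # bs)))"
    using Suc.IH[OF multilinear_maps_Cons[OF Suc.prems(1)] us(2)] by simp
  also have "\<dots> = (\<Sum>(b, bs)\<in>?B. (\<Prod>j<Suc k. us ! j \<bullet> (b # bs) ! j) *\<^sub>R \<xi> (b # bs))"
    by (simp add: us(1) sum.cartesian_product scaleR_sum_right prod.lessThan_Suc_shift
        del: prod.lessThan_Suc)
  also have "\<dots> = (\<Sum>bs\<in>basis_lists (Suc k). (\<Prod>j<Suc k. us ! j \<bullet> bs ! j) *\<^sub>R \<xi> bs)"
    unfolding eq by (subst sum.reindex) (auto simp: inj_on_def case_prod_unfold)
  finally show ?case .
qed

text \<open>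
  Permuting the list of basis vectors permutes the terms of the expansion, and a symmetric map takes
  the same value on the permuted list. The sum of these expansions over all \<open>g\<close> has permanents as
  coefficients.
\<close>

lemma sym_expansion_permuted:
  fixes \<xi> :: "'a::euclidean_space list \<Rightarrow> 'b::real_normed_vector"
  assumes \<xi>: "\<xi> \<in> sym_maps k" and us: "length us = k" and g: "g ` {..<k} = {..<k}"
  shows "\<xi> us = (\<Sum>bs\<in>basis_lists k. (\<Prod>j<k. us ! j \<bullet> bs ! g j) *\<^sub>R \<xi> bs)"
proof -
  \<comment> \<open>\<open>p\<close> permutes the basis lists among themselves\<close>
  define p where "p bs = map (\<lambda>j. bs ! g j) [0..<k]" for bs :: "'a list"
  have inj_g: "inj_on g {..<k}" using g by (intro eq_card_imp_inj_on) auto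
  have len: "length (p bs) = k" for bs by (simp add: p_def)
  have g_less: "g j < k" if "j < k" for j using g that by auto
  have sub: "p ` basis_lists k \<subseteq> basis_lists k"
    using g_less by (force simp: p_def basis_lists_def subset_iff)
  moreover have inj: "inj_on p (basis_lists k)"
  proof (rule inj_onI)
    fix bs cs :: "'a list" assume bc: "bs \<in> basis_lists k" "cs \<in> basis_lists k" "p bs = p cs"
    show "bs = cs"
    proof (rule nth_equalityI)
      show "length bs = length cs" using bc by (simp add: basis_lists_def)
      fix l assume "l < length bs"
      then obtain j where "j < k" "l = g j" using g bc(1) by (auto simp: basis_lists_def)
      then show "bs ! l = cs ! l" using bc(3) by (auto simp: p_def)
    qed
  qed
  ultimately have bij: "bij_betw p (basis_lists k) (basis_lists k)"
    using endo_inj_surj[OF finite_basis_lists sub inj] unfolding bij_betw_def by blast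
  have "\<xi> (p bs) = \<xi> bs" if "bs \<in> basis_lists k" for bs
  proof -
    have "mset (p bs) = image_mset ((!) bs) (image_mset g (mset_set {..<k}))"
      by (simp add: p_def lessThan_atLeast0 o_def multiset.map_comp)
    also have "\<dots> = image_mset ((!) bs) (mset_set {..<k})"
      by (simp add: image_mset_mset_set[OF inj_g] g)
    also have "\<dots> = mset (map ((!) bs) [0..<length bs])"
      using that by (simp add: basis_lists_def lessThan_atLeast0)
    also have "\<dots> = mset bs" by (simp only: map_nth)
    finally show ?thesis by (rule sym_maps_cong_mset[OF \<xi>])
  qed
  moreover have "(\<Prod>j<k. us ! j \<bullet> p bs ! j) = (\<Prod>j<k. us ! j \<bullet> bs ! g j)" for bs
    by (intro prod.cong) (auto simp: p_def)
  moreover have "\<xi> us = (\<Sum>bs\<in>basis_lists k. (\<Prod>j<k. us ! j \<bullet> p bs ! j) *\<^sub>R \<xi> (p bs))"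
    unfolding multilinear_expansion[OF sym_maps_multilinear[OF \<xi>] us]
    using sum.reindex_bij_betw[OF bij, of "\<lambda>bs. (\<Prod>j<k. us ! j \<bullet> bs ! j) *\<^sub>R \<xi> bs"] by simp
  ultimately show ?thesis by (simp cong: sum.cong)
qed

text \<open>
  Averaging the permuted expansions makes the coefficients permanents of the matrices
  \<open>us ! j \<bullet> bs ! l\<close>, and Ryser's formula writes these as combinations of the products
  \<open>\<Prod>j<k. us ! j \<bullet> (\<Sum>l\<in>S. bs ! l)\<close>, that is, of \<open>k\<close>-th powers of linear forms. What matters later is
  that the coefficients are linear in finitely many values of the map, so that norms, limits and
  measurability can be read off from these values.
\<close>

lemma sym_maps_sum_rank1:
  "\<exists>(d::nat) (t::nat \<Rightarrow> real) (bs::nat \<Rightarrow> 'a::euclidean_space list) (v::nat \<Rightarrow> 'a)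
      (w::nat \<Rightarrow> 'b::euclidean_space).
    (\<forall>i<d. length (bs i) = k) \<and>
    (\<forall>\<xi>\<in>sym_maps k. \<forall>us. \<xi> us = (\<Sum>i<d. (t i * (\<xi> (bs i) \<bullet> w i)) *\<^sub>R rank1 k (v i) (w i) us))"
proof -
  let ?G = "{g. g \<in> {..<k} \<rightarrow>\<^sub>E {..<k} \<and> g ` {..<k} = {..<k}}"
  define N where "N = card ?G"
  have "?G \<subseteq> {..<k} \<rightarrow>\<^sub>E {..<k}" by auto
  then have finG: "finite ?G" by (rule finite_subset) (auto intro: finite_PiE)
  moreover have "restrict id {..<k} \<in> ?G" by auto
  ultimately have N: "N > 0" unfolding N_def using card_gt_0_iff by blast
  define J where "J = (basis_lists k :: 'a list set) \<times> Pow {..<k} \<times> (Basis :: 'b set)"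
  have finJ: "finite J" unfolding J_def by (intro finite_cartesian_product finite_basis_lists) auto
  define T where "T = (\<lambda>(bs :: 'a list, S, w :: 'b). (-1) ^ card ({..<k} - S) / real N)"
  define V where "V = (\<lambda>(bs :: 'a list, S :: nat set, w :: 'b). \<Sum>l\<in>S. bs ! l)"
  define W where "W = (\<lambda>(bs :: 'a list, S :: nat set, w :: 'b). w)"
  have rep: "\<xi> us = (\<Sum>i\<in>J. (T i * (\<xi> (fst i) \<bullet> W i)) *\<^sub>R rank1 k (V i) (W i) us)"
    if \<xi>: "\<xi> \<in> sym_maps k" for \<xi> :: "'a list \<Rightarrow> 'b" and us
  proof (cases "length us = k")
    case True
    have pl: "prod_list (map (\<lambda>u. v \<bullet> u) us) = (\<Prod>j<k. v \<bullet> us ! j)" for v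
      using True by (simp add: prod.list_conv_set_nth lessThan_atLeast0)
    have "real N *\<^sub>R \<xi> us = (\<Sum>g\<in>?G. \<xi> us)" by (simp add: N_def scaleR_conv_of_real sum_constant_scaleR)
    also have "\<dots> = (\<Sum>g\<in>?G. \<Sum>bs\<in>basis_lists k. (\<Prod>j<k. us ! j \<bullet> bs ! g j) *\<^sub>R \<xi> bs)"
      using sym_expansion_permuted[OF \<xi> True] by (intro sum.cong) auto
    also have "\<dots> = (\<Sum>bs\<in>basis_lists k. (\<Sum>g\<in>?G. \<Prod>j<k. us ! j \<bullet> bs ! g j) *\<^sub>R \<xi> bs)"
      by (subst sum.swap) (simp add: scaleR_sum_left)
    also have "\<dots> = (\<Sum>bs\<in>basis_lists k. (\<Sum>S\<in>Pow {..<k}. (-1) ^ card ({..<k} - S)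
        * (\<Prod>j<k. \<Sum>l\<in>S. us ! j \<bullet> bs ! l)) *\<^sub>R \<xi> bs)"
      by (simp only: sum_permutations_eq_alternating_sum[where A = "\<lambda>j l. us ! j \<bullet> bs ! l" for bs])
    also have "\<dots> = (\<Sum>bs\<in>basis_lists k. \<Sum>S\<in>Pow {..<k}. \<Sum>w\<in>Basis.
        ((-1) ^ card ({..<k} - S) * (\<xi> bs \<bullet> w)) *\<^sub>R rank1 k (\<Sum>l\<in>S. bs ! l) w us)"
    proof (intro sum.cong refl)
      fix bs :: "'a list"
      have "(\<Sum>S\<in>Pow {..<k}. (-1) ^ card ({..<k} - S) * (\<Prod>j<k. \<Sum>l\<in>S. us ! j \<bullet> bs ! l)) *\<^sub>R \<xi> bs
          = (\<Sum>S\<in>Pow {..<k}. ((-1) ^ card ({..<k} - S) * (\<Prod>j<k. (\<Sum>l\<in>S. bs ! l) \<bullet> us ! j)) *\<^sub>R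
              (\<Sum>w\<in>Basis. (\<xi> bs \<bullet> w) *\<^sub>R w))"
      proof -
        have "(\<Sum>l\<in>S. us ! j \<bullet> bs ! l) = (\<Sum>l\<in>S. bs ! l) \<bullet> us ! j" for S j
          unfolding inner_sum_left by (intro sum.cong refl inner_commute)
        then show ?thesis unfolding euclidean_representation scaleR_sum_left by simp
      qed
      also have "\<dots> = (\<Sum>S\<in>Pow {..<k}. \<Sum>w\<in>Basis.
          ((-1) ^ card ({..<k} - S) * (\<xi> bs \<bullet> w)) *\<^sub>R rank1 k (\<Sum>l\<in>S. bs ! l) w us)"
        using True by (simp add: rank1_def pl scaleR_sum_right mult_ac)
      finally show "(\<Sum>S\<in>Pow {..<k}. (-1) ^ card ({..<k} - S) * (\<Prod>j<k. \<Sum>l\<in>S. us ! j \<bullet> bs ! l)) *\<^sub>R \<xi> bs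
          = (\<Sum>S\<in>Pow {..<k}. \<Sum>w\<in>Basis.
          ((-1) ^ card ({..<k} - S) * (\<xi> bs \<bullet> w)) *\<^sub>R rank1 k (\<Sum>l\<in>S. bs ! l) w us)" .
    qed
    also have "\<dots> = (\<Sum>i\<in>J. (real N * (T i * (\<xi> (fst i) \<bullet> W i))) *\<^sub>R rank1 k (V i) (W i) us)"
      using N by (simp add: J_def T_def V_def W_def sum.cartesian_product case_prod_unfold)
    also have "\<dots> = real N *\<^sub>R (\<Sum>i\<in>J. (T i * (\<xi> (fst i) \<bullet> W i)) *\<^sub>R rank1 k (V i) (W i) us)"
      by (simp add: scaleR_sum_right)
    finally show ?thesis using N by simp
  next
    case False
    then show ?thesis
      using sym_maps_multilinear[OF \<xi>] by (simp add: rank1_def multilinear_maps_def)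
  qed
  obtain h where h: "bij_betw h {0..<card J} J" using ex_bij_betw_nat_finite[OF finJ] by blast
  show ?thesis
  proof (intro exI conjI allI ballI impI)
    fix i assume "i < card J"
    then have "h i \<in> J" using h by (auto simp: bij_betw_def)
    then show "length (fst (h i)) = k" by (auto simp: J_def basis_lists_def)
  next
    fix \<xi> :: "'a list \<Rightarrow> 'b" and us assume "\<xi> \<in> sym_maps k"
    then show "\<xi> us = (\<Sum>i<card J. (T (h i) * (\<xi> (fst (h i)) \<bullet> W (h i))) *\<^sub>R rank1 k (V (h i)) (W (h
        i)) us)"
      using rep[of \<xi> us] sum.reindex_bij_betw[OF h, of "\<lambda>i. (T i * (\<xi> (fst i) \<bullet> W i)) *\<^sub>R rank1 k (V
          i) (W i) us"]
      by (simp add: lessThan_atLeast0)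
  qed
qed

section \<open>Iterated derivatives and their symmetry\<close>

lemma smooth_differentiable: "smooth \<phi> \<Longrightarrow> iter_deriv \<phi> vs differentiable (at x)"
  by (simp add: smooth_def differentiable_on_def)

lemma smooth_has_derivative:
  "smooth \<phi> \<Longrightarrow> (iter_deriv \<phi> vs has_derivative (\<lambda>v. iter_deriv \<phi> (v # vs) x)) (at x)"
  using smooth_differentiable[of \<phi> vs x] by (simp add: frechet_derivative_works)

lemma smooth_iter_deriv_continuous: "smooth \<phi> \<Longrightarrow> continuous_on S (iter_deriv \<phi> vs)"
  unfolding smooth_def by (meson differentiable_imp_continuous_on continuous_on_subset subset_UNIV)

text \<open>
  A family of functions indexed by lists that reproduces itself under differentiation is the family
  of iterated derivatives; all computations of iterated derivatives go through this.
\<close>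

lemma smooth_iter_derivI:
  assumes "\<And>vs x. (g vs has_derivative (\<lambda>v. g (v # vs) x)) (at x)" "g [] = \<phi>"
  shows "smooth \<phi>" "iter_deriv \<phi> vs = g vs"
proof -
  have eq: "iter_deriv \<phi> vs = g vs" for vs
  proof (induction vs)
    case (Cons v vs)
    have "frechet_derivative (g vs) (at x) = (\<lambda>v. g (v # vs) x)" for x
      by (rule frechet_derivative_at[OF assms(1), symmetric])
    then show ?case by (simp add: Cons)
  qed (simp add: assms(2))
  then show "iter_deriv \<phi> vs = g vs" .
  show "smooth \<phi>"
    unfolding smooth_def eq differentiable_on_def using assms(1) differentiableI by fastforce
qed

lemma smooth_add:
  assumes "smooth \<phi>" "smooth \<psi>"
  shows "smooth (\<lambda>x. \<phi> x + \<psi> x)"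
    and "iter_deriv (\<lambda>x. \<phi> x + \<psi> x) vs = (\<lambda>x. iter_deriv \<phi> vs x + iter_deriv \<psi> vs x)"
  by (rule smooth_iter_derivI[where g = "\<lambda>vs x. iter_deriv \<phi> vs x + iter_deriv \<psi> vs x"];
      simp only: iter_deriv.simps(1) has_derivative_add[OF smooth_has_derivative
          smooth_has_derivative] assms)+

lemma smooth_scaleR_vector:
  assumes "smooth f"
  shows "smooth (\<lambda>x. f x *\<^sub>R w)"
    and "iter_deriv (\<lambda>x. f x *\<^sub>R w) vs = (\<lambda>x. iter_deriv f vs x *\<^sub>R w)"
  by (rule smooth_iter_derivI[where g = "\<lambda>vs x. iter_deriv f vs x *\<^sub>R w"];
      simp only: iter_deriv.simps(1) has_derivative_scaleR_left[OF smooth_has_derivative] assms)+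

lemma smooth_cmult:
  fixes f :: "'a::euclidean_space \<Rightarrow> real"
  assumes "smooth f"
  shows "smooth (\<lambda>x. c * f x)"
    and "iter_deriv (\<lambda>x. c * f x) vs = (\<lambda>x. c * iter_deriv f vs x)"
  by (rule smooth_iter_derivI[where g = "\<lambda>vs x. c * iter_deriv f vs x"];
      simp only: iter_deriv.simps(1) has_derivative_mult_right[OF smooth_has_derivative] assms)+

text \<open>
  Being supported in a closed ball is stable under differentiation, because the complement of the
  ball is open; this form of compact support also makes sums of test maps test maps for the same
  ball.
\<close>

definition vanishes_beyond :: "real \<Rightarrow> ('a::real_normed_vector \<Rightarrow> 'b::real_normed_vector) \<Rightarrow> bool" where
  "vanishes_beyond R \<phi> \<longleftrightarrow> (\<forall>x. R < norm x \<longrightarrow> \<phi> x = 0)"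

lemma vanishes_beyond_derivative:
  assumes "vanishes_beyond R f" "(f has_derivative f') (at x)" "R < norm x"
  shows "f' v = 0"
proof -
  have "open {x::'a. R < norm x}" by (intro open_Collect_less continuous_intros)
  then have "((\<lambda>_. 0) has_derivative f') (at x)"
    using assms by (intro has_derivative_transform_within_open[OF assms(2)])
        (auto simp: vanishes_beyond_def)
  then have "f' = (\<lambda>_. 0)" using has_derivative_unique has_derivative_const by blast
  then show ?thesis by simp
qed

lemma vanishes_beyond_iter_deriv:
  assumes "smooth \<phi>" "vanishes_beyond R \<phi>"
  shows "vanishes_beyond R (iter_deriv \<phi> vs)"
proof (induction vs)
  case (Cons v vs)
  then show ?case
    using vanishes_beyond_derivative[OF Cons smooth_has_derivative[OF assms(1)]]
    unfolding vanishes_beyond_def by blast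
qed (simp add: assms)

lemma vanishes_beyond_bounded:
  fixes f :: "'a::euclidean_space \<Rightarrow> 'b::real_normed_vector"
  assumes "vanishes_beyond R f" "continuous_on UNIV f"
  shows "\<exists>B. \<forall>x. norm (f x) \<le> B"
proof -
  have "compact (f ` cball 0 R)"
    using assms(2) by (intro compact_continuous_image continuous_on_subset[OF assms(2)]) auto
  then obtain B where B: "\<forall>x\<in>cball 0 R. norm (f x) \<le> B"
    using compact_imp_bounded bounded_iff by (metis imageI)
  have "norm (f x) \<le> max B 0" for x
    using B assms(1) unfolding vanishes_beyond_def
    by (cases "norm x \<le> R") (auto simp: le_max_iff_disj)
  then show ?thesis by blast
qed

lemma has_real_derivative_along_line:
  fixes f :: "'a::real_normed_vector \<Rightarrow> real"
  assumes "\<And>y. (f has_derivative f' y) (at y)"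
  shows "((\<lambda>s. f (p + s *\<^sub>R u)) has_real_derivative f' (p + s *\<^sub>R u) u) (at s)"
proof -
  have "((\<lambda>s. p + s *\<^sub>R u) has_derivative (\<lambda>h. h *\<^sub>R u)) (at s)"
    by (auto intro!: derivative_eq_intros)
  from has_derivative_compose[OF this assms]
  have "((\<lambda>s. f (p + s *\<^sub>R u)) has_derivative (\<lambda>h. f' (p + s *\<^sub>R u) (h *\<^sub>R u))) (at s)" .
  moreover have "f' y (h *\<^sub>R u) = f' y u * h" for y h
    using linear_cmul[OF has_derivative_linear[OF assms[of y]]] by simp
  ultimately show ?thesis by (simp add: has_field_derivative_def)
qed

text \<open>
  The mean value theorem, used first in the direction \<open>u\<close> and then in the direction \<open>v\<close>.
\<close>

lemma second_difference_mean_value: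
  fixes f :: "'a::real_normed_vector \<Rightarrow> real"
  assumes f: "\<And>y. (f has_derivative f' y) (at y)"
    and A: "\<And>y. ((\<lambda>x. f' x u) has_derivative A y) (at y)" and t: "0 < t"
  shows "\<exists>\<sigma> \<tau>. \<bar>\<sigma>\<bar> \<le> t \<and> \<bar>\<tau>\<bar> \<le> t \<and>
    f (x + t *\<^sub>R u + t *\<^sub>R v) - f (x + t *\<^sub>R u) - f (x + t *\<^sub>R v) + f x
      = t * (t * A (x + \<sigma> *\<^sub>R u + \<tau> *\<^sub>R v) v)"
proof -
  define g where "g s = f ((x + t *\<^sub>R v) + s *\<^sub>R u) - f (x + s *\<^sub>R u)" for s
  have "DERIV g s :> f' ((x + t *\<^sub>R v) + s *\<^sub>R u) u - f' (x + s *\<^sub>R u) u" for s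
    unfolding g_def by (intro DERIV_diff has_real_derivative_along_line f)
  then obtain \<sigma> where \<sigma>: "0 < \<sigma>" "\<sigma> < t"
    "g t - g 0 = (t - 0) * (f' ((x + t *\<^sub>R v) + \<sigma> *\<^sub>R u) u - f' (x + \<sigma> *\<^sub>R u) u)"
    using MVT2[OF t, of g "\<lambda>s. f' ((x + t *\<^sub>R v) + s *\<^sub>R u) u - f' (x + s *\<^sub>R u) u"] by blast
  have "DERIV (\<lambda>s. f' ((x + \<sigma> *\<^sub>R u) + s *\<^sub>R v) u) s :> A ((x + \<sigma> *\<^sub>R u) + s *\<^sub>R v) v" for s
    by (rule has_real_derivative_along_line[where f = "\<lambda>y. f' y u", OF A])
  then obtain \<tau> where \<tau>: "0 < \<tau>" "\<tau> < t"
    "f' ((x + \<sigma> *\<^sub>R u) + t *\<^sub>R v) u - f' ((x + \<sigma> *\<^sub>R u) + 0 *\<^sub>R v) u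
      = (t - 0) * A ((x + \<sigma> *\<^sub>R u) + \<tau> *\<^sub>R v) v"
    using MVT2[OF t, of "\<lambda>s. f' ((x + \<sigma> *\<^sub>R u) + s *\<^sub>R v) u"
        "\<lambda>s. A ((x + \<sigma> *\<^sub>R u) + s *\<^sub>R v) v"] by blast
  have "f (x + t *\<^sub>R u + t *\<^sub>R v) - f (x + t *\<^sub>R u) - f (x + t *\<^sub>R v) + f x = g t - g 0"
    by (simp add: g_def add_ac)
  also have "\<dots> = t * (t * A (x + \<sigma> *\<^sub>R u + \<tau> *\<^sub>R v) v)"
    using \<sigma>(3) \<tau>(3) by (simp add: add_ac)
  finally show ?thesis using \<sigma> \<tau> by (intro exI[of _ \<sigma>] exI[of _ \<tau>]) auto
qed

lemma tendsto_corner: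
  fixes x :: "'a::real_normed_vector"
  assumes "\<And>n. \<bar>\<sigma> n\<bar> \<le> inverse (real (Suc n))" "\<And>n. \<bar>\<tau> n\<bar> \<le> inverse (real (Suc n))"
  shows "(\<lambda>n. x + \<sigma> n *\<^sub>R u + \<tau> n *\<^sub>R v) \<longlonglongrightarrow> x"
proof -
  have "\<sigma> \<longlonglongrightarrow> 0" "\<tau> \<longlonglongrightarrow> 0"
    using assms by (auto intro!: Lim_null_comparison[OF _ LIMSEQ_inverse_real_of_nat])
  then have "(\<lambda>n. x + \<sigma> n *\<^sub>R u + \<tau> n *\<^sub>R v) \<longlonglongrightarrow> x + 0 *\<^sub>R u + 0 *\<^sub>R v"
    by (intro tendsto_intros)
  then show ?thesis by simp
qed

text \<open>
  Both mixed derivatives are limits of the same second difference divided by \<open>t\<^sup>2\<close>, since the second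
  difference is symmetric in \<open>u\<close> and \<open>v\<close>.
\<close>

lemma mixed_derivatives_commute:
  fixes f :: "'a::real_normed_vector \<Rightarrow> real"
  assumes f: "\<And>y. (f has_derivative f' y) (at y)"
    and A: "\<And>y. ((\<lambda>x. f' x u) has_derivative A y) (at y)"
    and B: "\<And>y. ((\<lambda>x. f' x v) has_derivative B y) (at y)"
    and cont: "isCont (\<lambda>y. A y v) x" "isCont (\<lambda>y. B y u) x"
  shows "A x v = B x u"
proof -
  define t where "t n = inverse (real (Suc n))" for n
  have t: "0 < t n" for n by (simp add: t_def)
  obtain \<sigma> \<tau> where 1: "\<And>n. \<bar>\<sigma> n\<bar> \<le> t n" "\<And>n. \<bar>\<tau> n\<bar> \<le> t n"
    "\<And>n. f (x + t n *\<^sub>R u + t n *\<^sub>R v) - f (x + t n *\<^sub>R u) - f (x + t n *\<^sub>R v) + f x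
      = t n * (t n * A (x + \<sigma> n *\<^sub>R u + \<tau> n *\<^sub>R v) v)"
    using second_difference_mean_value[OF f A t, where x = x and v = v] by metis
  obtain \<sigma>' \<tau>' where 2: "\<And>n. \<bar>\<sigma>' n\<bar> \<le> t n" "\<And>n. \<bar>\<tau>' n\<bar> \<le> t n"
    "\<And>n. f (x + t n *\<^sub>R v + t n *\<^sub>R u) - f (x + t n *\<^sub>R v) - f (x + t n *\<^sub>R u) + f x
      = t n * (t n * B (x + \<sigma>' n *\<^sub>R v + \<tau>' n *\<^sub>R u) u)"
    using second_difference_mean_value[OF f B t, where x = x and v = u] by metis
  have eq: "A (x + \<sigma> n *\<^sub>R u + \<tau> n *\<^sub>R v) v = B (x + \<sigma>' n *\<^sub>R v + \<tau>' n *\<^sub>R u) u" for n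
  proof -
    have "t n * (t n * A (x + \<sigma> n *\<^sub>R u + \<tau> n *\<^sub>R v) v)
        = t n * (t n * B (x + \<sigma>' n *\<^sub>R v + \<tau>' n *\<^sub>R u) u)"
      unfolding 1(3)[symmetric] 2(3)[symmetric] by (simp add: add_ac)
    then show ?thesis using t[of n] by simp
  qed
  have "(\<lambda>n. A (x + \<sigma> n *\<^sub>R u + \<tau> n *\<^sub>R v) v) \<longlonglongrightarrow> A x v"
    using 1 by (intro isCont_tendsto_compose[OF cont(1)] tendsto_corner) (auto simp: t_def)
  moreover have "(\<lambda>n. B (x + \<sigma>' n *\<^sub>R v + \<tau>' n *\<^sub>R u) u) \<longlonglongrightarrow> B x u"
    using 2 by (intro isCont_tendsto_compose[OF cont(2)] tendsto_corner) (auto simp: t_def)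
  ultimately show ?thesis unfolding eq by (rule LIMSEQ_unique)
qed

lemma iter_deriv_swap:
  fixes \<phi> :: "'a::euclidean_space \<Rightarrow> 'b::euclidean_space"
  assumes "smooth \<phi>"
  shows "iter_deriv \<phi> (u # v # vs) x = iter_deriv \<phi> (v # u # vs) x"
proof (rule euclidean_eqI)
  fix b :: 'b assume "b \<in> Basis"
  have der: "((\<lambda>y. iter_deriv \<phi> ws y \<bullet> b) has_derivative (\<lambda>w. iter_deriv \<phi> (w # ws) y \<bullet> b)) (at y)"
      for ws y
    by (rule has_derivative_inner_left[OF smooth_has_derivative[OF assms]])
  have cont: "isCont (\<lambda>y. iter_deriv \<phi> ws y \<bullet> b) y" for ws y
    by (rule has_derivative_continuous[OF der])
  show "iter_deriv \<phi> (u # v # vs) x \<bullet> b = iter_deriv \<phi> (v # u # vs) x \<bullet> b"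
    by (rule mixed_derivatives_commute[OF der der der cont cont])
qed

text \<open>
  Adjacent directions may be exchanged, so the first direction of one list can be brought to the
  front of the other.
\<close>

lemma iter_deriv_perm:
  fixes \<phi> :: "'a::euclidean_space \<Rightarrow> 'b::euclidean_space"
  assumes "smooth \<phi>" "mset us = mset ws"
  shows "iter_deriv \<phi> us = iter_deriv \<phi> ws"
  using assms(2)
proof (induction us arbitrary: ws)
  case (Cons a us)
  have to_front: "iter_deriv \<phi> (ys @ a # zs) = iter_deriv \<phi> (a # ys @ zs)" for ys zs
  proof (induction ys)
    case (Cons y ys)
    have "iter_deriv \<phi> ((y # ys) @ a # zs) = iter_deriv \<phi> (y # a # ys @ zs)"
      using Cons by simp
    also have "\<dots> = iter_deriv \<phi> (a # y # ys @ zs)"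
      using iter_deriv_swap[OF assms(1)] by blast
    finally show ?case by simp
  qed simp
  have "a \<in> set ws" using Cons.prems by (metis list.set_intros(1) mset_eq_setD)
  then obtain ys zs where ws: "ws = ys @ a # zs" by (meson split_list)
  then have "mset us = mset (ys @ zs)" using Cons.prems by simp
  from Cons.IH[OF this] have "iter_deriv \<phi> (a # us) = iter_deriv \<phi> (a # ys @ zs)" by simp
  then show ?case unfolding ws to_front .
qed simp

lemma iter_deriv_linear:
  fixes \<phi> :: "'a::euclidean_space \<Rightarrow> 'b::euclidean_space"
  assumes "smooth \<phi>"
  shows "linear (\<lambda>v. iter_deriv \<phi> (us @ v # ws) x)"
proof -
  have "iter_deriv \<phi> (us @ v # ws) = iter_deriv \<phi> (v # us @ ws)" for v
    by (rule iter_deriv_perm[OF assms]) simp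
  then show ?thesis
    using has_derivative_linear[OF smooth_has_derivative[OF assms, of "us @ ws" x]] by simp
qed

lemma Dk_sym_maps:
  fixes \<phi> :: "'a::euclidean_space \<Rightarrow> 'b::euclidean_space"
  assumes "smooth \<phi>"
  shows "Dk k \<phi> x \<in> sym_maps k"
proof (rule sym_mapsI)
  show "linear (\<lambda>v. Dk k \<phi> x (us @ v # ws))" if "length us + length ws + 1 = k" for us ws
  proof -
    have "Dk k \<phi> x (us @ v # ws) = iter_deriv \<phi> (us @ v # ws) x" for v
      using that by (auto simp: Dk_def)
    then show ?thesis using iter_deriv_linear[OF assms, of us ws x] by presburger
  qed
  show "Dk k \<phi> x vs = 0" if "length vs \<noteq> k" for vs using that by (simp add: Dk_def)
  show "Dk k \<phi> x vs = Dk k \<phi> x ws" if "mset vs = mset ws" for vs ws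
    using iter_deriv_perm[OF assms that] mset_eq_length[OF that] by (simp add: Dk_def)
qed

section \<open>Smooth functions with compact support\<close>

text \<open>
  The functions \<open>t\<^sup>-\<^sup>i e\<^sup>-\<^sup>1\<^sup>/\<^sup>t\<close> of \<open>t > 0\<close>, continued by zero. With all exponents \<open>i\<close> at hand, the
  family is closed under differentiation up to linear combinations.
\<close>

definition flat_exp :: "nat \<Rightarrow> real \<Rightarrow> real" where
  "flat_exp i t = (if 0 < t then exp (- 1 / t) / t ^ i else 0)"

lemma flat_exp_tendsto_0: "(flat_exp i \<longlongrightarrow> 0) (at 0)"
proof -
  have "((\<lambda>s::real. s ^ i / exp s) \<longlongrightarrow> 0) at_top" by (rule tendsto_power_div_exp_0)
  then have "((\<lambda>t::real. inverse t ^ i / exp (inverse t)) \<longlongrightarrow> 0) (at_right 0)"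
    using filterlim_compose filterlim_inverse_at_top_right by blast
  moreover have "\<forall>\<^sub>F t in at_right 0. inverse t ^ i / exp (inverse t) = flat_exp i t"
    unfolding eventually_at_right_field
    by (intro exI[of _ 1]) (auto simp: flat_exp_def exp_minus field_simps)
  ultimately have right: "(flat_exp i \<longlongrightarrow> 0) (at_right 0)"
    using Lim_transform_eventually by blast
  have "\<forall>\<^sub>F t in at_left 0. 0 = flat_exp i t"
    unfolding eventually_at_left_field by (intro exI[of _ "- 1"]) (auto simp: flat_exp_def)
  then have "(flat_exp i \<longlongrightarrow> 0) (at_left 0)"
    using Lim_transform_eventually tendsto_const by blast
  with right show ?thesis by (simp add: filterlim_split_at)
qed

lemma DERIV_flat_exp: "DERIV (flat_exp i) t :> flat_exp (i + 2) t - real i * flat_exp (i + 1) t"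
proof -
  consider "t < 0" | "t = 0" | "0 < t" by linarith
  then show ?thesis
  proof cases
    case 1
    have "DERIV (\<lambda>_. 0 :: real) t :> 0" by simp
    then have "DERIV (flat_exp i) t :> 0"
      by (rule has_field_derivative_transform_within_open[where S = "{..<0}"])
          (use 1 in \<open>auto simp: flat_exp_def\<close>)
    then show ?thesis using 1 by (simp add: flat_exp_def)
  next
    case 2
    have "flat_exp i h / h = flat_exp (i + 1) h" if "h \<noteq> 0" for h
      using that by (simp add: flat_exp_def)
    then have "((\<lambda>h. flat_exp i h / h) \<longlongrightarrow> 0) (at 0)"
      using flat_exp_tendsto_0[of "i + 1"] by (subst tendsto_cong[where g = "flat_exp (i + 1)"])
          (auto simp: eventually_at_filter)
    then have "DERIV (flat_exp i) 0 :> 0" by (simp add: DERIV_def flat_exp_def)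
    then show ?thesis using 2 by (simp add: flat_exp_def)
  next
    case 3
    have "DERIV (\<lambda>t. exp (- 1 / t) * inverse t ^ i) t :>
        exp (- 1 / t) * inverse t ^ (i + 2) - real i * (exp (- 1 / t) * inverse t ^ (i + 1))"
    proof -
      have "DERIV (\<lambda>t. exp (- 1 / t)) t :> exp (- 1 / t) * (inverse t)\<^sup>2"
        using 3 by (auto intro!: derivative_eq_intros simp: field_simps power2_eq_square)
      moreover have "DERIV (\<lambda>t. inverse t ^ i) t :> - (real i * inverse t ^ (i + 1))"
      proof (cases i)
        case (Suc n)
        then show ?thesis
          using DERIV_power_Suc[OF DERIV_inverse[of t UNIV], of n] 3 by (simp add: algebra_simps)
      qed simp
      ultimately have "DERIV (\<lambda>t. exp (- 1 / t) * inverse t ^ i) t :>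
          exp (- 1 / t) * (inverse t)\<^sup>2 * inverse t ^ i + - (real i * inverse t ^ (i
              + 1)) * exp (- 1 / t)"
        by (rule DERIV_mult)
      then show ?thesis by (simp add: power_add power2_eq_square algebra_simps)
    qed
    then have "DERIV (\<lambda>t. exp (- 1 / t) * inverse t ^ i) t
        :> flat_exp (i + 2) t - real i * flat_exp (i + 1) t"
      using 3 by (simp add: flat_exp_def divide_inverse power_inverse)
    then show ?thesis
      by (rule has_field_derivative_transform_within_open[where S = "{0<..}"])
         (use 3 in \<open>auto simp: flat_exp_def divide_inverse power_inverse\<close>)
  qed
qed

text \<open>
  An algebra of functions that contains the derivatives of its generators, so that smoothness of
  every member follows at once. It holds the polynomials, the oscillations, and a bump supported in
  the ball of radius \<open>R\<close>.
\<close>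

inductive smooth_alg :: "real \<Rightarrow> ('a::euclidean_space \<Rightarrow> real) \<Rightarrow> bool" for R where
  const: "smooth_alg R (\<lambda>x. c)"
| linear: "bounded_linear f \<Longrightarrow> smooth_alg R f"
| cos: "smooth_alg R (\<lambda>x. cos (v \<bullet> x + \<theta>))"
| bump: "smooth_alg R (\<lambda>x. flat_exp i (R\<^sup>2 - x \<bullet> x))"
| add: "smooth_alg R f \<Longrightarrow> smooth_alg R g \<Longrightarrow> smooth_alg R (\<lambda>x. f x + g x)"
| mult: "smooth_alg R f \<Longrightarrow> smooth_alg R g \<Longrightarrow> smooth_alg R (\<lambda>x. f x * g x)"

lemma smooth_alg_cmult: "smooth_alg R f \<Longrightarrow> smooth_alg R (\<lambda>x. c * f x)"
  by (intro smooth_alg.mult smooth_alg.const)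

lemma smooth_alg_diff: "smooth_alg R f \<Longrightarrow> smooth_alg R g \<Longrightarrow> smooth_alg R (\<lambda>x. f x - g x)"
  using smooth_alg.add[OF _ smooth_alg_cmult, of R f g "- 1"] by simp

lemma smooth_alg_power: "smooth_alg R f \<Longrightarrow> smooth_alg R (\<lambda>x. f x ^ n)"
  by (induction n) (auto intro: smooth_alg.intros)

lemma smooth_alg_if:
  "smooth_alg R f \<Longrightarrow> smooth_alg R g \<Longrightarrow> smooth_alg R (\<lambda>x. if b then f x else g x)"
  by (cases b) auto

lemma smooth_alg_polynomial: "real_polynomial_function p \<Longrightarrow> smooth_alg R p"
  by (induction rule: real_polynomial_function.induct) (auto intro: smooth_alg.intros)

lemma smooth_alg_has_derivative:
  "smooth_alg R f \<Longrightarrow> \<exists>f'. (\<forall>x. (f has_derivative f' x) (at x)) \<and> (\<forall>u. smooth_alg R (\<lambda>x. f' x u))"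
proof (induction rule: smooth_alg.induct)
  case (const c)
  show ?case by (intro exI[of _ "\<lambda>x u. 0"]) (auto intro: smooth_alg.const)
next
  case (linear f)
  then show ?case
    by (intro exI[of _ "\<lambda>x. f"]) (auto intro: smooth_alg.const bounded_linear_imp_has_derivative)
next
  case (cos v \<theta>)
  have "((\<lambda>x. cos (v \<bullet> x + \<theta>)) has_derivative (\<lambda>u. (v \<bullet> u) * cos (v \<bullet> x + (\<theta>
      + pi / 2)))) (at x)" for x :: 'a
    by (auto intro!: derivative_eq_intros simp: cos_add sin_add algebra_simps)
  then show ?case
    by (intro exI[of _ "\<lambda>x u. (v \<bullet> u) * cos (v \<bullet> x + (\<theta> + pi / 2))"])
       (auto intro: smooth_alg_cmult smooth_alg.cos)
next
  case (bump i)
  let ?b = "\<lambda>j x::'a. flat_exp j (R\<^sup>2 - x \<bullet> x)"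
  let ?f' = "\<lambda>x u. (?b (i + 2) x - real i * ?b (i + 1) x) * (- 2 * (u \<bullet> x))"
  have "(?b i has_derivative ?f' x) (at x)" for x
  proof -
    have 1: "((\<lambda>x. R\<^sup>2 - x \<bullet> x) has_derivative (\<lambda>u. - 2 * (u \<bullet> x))) (at x)"
      by (auto intro!: derivative_eq_intros simp: inner_commute)
    have 2: "(flat_exp i has_derivative (*) (?b (i + 2) x - real i * ?b (i + 1) x)) (at (R\<^sup>2 - x \<bullet> x))"
      using DERIV_flat_exp unfolding has_field_derivative_def .
    show ?thesis using has_derivative_compose[OF 1 2] by simp
  qed
  moreover have "smooth_alg R (\<lambda>x. ?f' x u)" for u
    by (intro smooth_alg.mult smooth_alg_diff smooth_alg.const smooth_alg.bump
        smooth_alg.linear bounded_linear_inner_right)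
  ultimately show ?case by (intro exI[of _ ?f']) auto
next
  case (add f g)
  then obtain f' g' where "\<forall>x. (f has_derivative f' x) (at x)" "\<forall>u. smooth_alg R (\<lambda>x. f' x u)"
    "\<forall>x. (g has_derivative g' x) (at x)" "\<forall>u. smooth_alg R (\<lambda>x. g' x u)" by blast
  then show ?case
    by (intro exI[of _ "\<lambda>x u. f' x u + g' x u"]) (auto intro: smooth_alg.add has_derivative_add)
next
  case (mult f g)
  then obtain f' g' where "\<forall>x. (f has_derivative f' x) (at x)" "\<forall>u. smooth_alg R (\<lambda>x. f' x u)"
    "\<forall>x. (g has_derivative g' x) (at x)" "\<forall>u. smooth_alg R (\<lambda>x. g' x u)" by blast
  then show ?case using mult.hyps
    by (intro exI[of _ "\<lambda>x u. f x * g' x u + f' x u * g x"])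
       (auto intro!: smooth_alg.add smooth_alg.mult has_derivative_mult)
qed

lemma smooth_alg_smooth:
  assumes "smooth_alg R f"
  shows "smooth f" "smooth_alg R (iter_deriv f vs)"
proof -
  have alg: "smooth_alg R (iter_deriv f vs)" for vs
  proof (induction vs)
    case (Cons v vs)
    obtain f' where f': "\<And>x. (iter_deriv f vs has_derivative f' x) (at x)"
      "\<And>u. smooth_alg R (\<lambda>x. f' x u)" using smooth_alg_has_derivative[OF Cons] by blast
    then have "iter_deriv f (v # vs) = (\<lambda>x. f' x v)"
      using frechet_derivative_at[OF f'(1)] by simp
    then show ?case using f'(2) by simp
  qed (simp add: assms)
  then show "smooth_alg R (iter_deriv f vs)" .
  show "smooth f"
    unfolding smooth_def differentiable_on_def
  proof (intro allI ballI)
    fix vs x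
    show "iter_deriv f vs differentiable at x"
      using smooth_alg_has_derivative[OF alg[of vs]] differentiableI by blast
  qed
qed

lemma smooth_alg_continuous: "smooth_alg R f \<Longrightarrow> continuous_on S f"
  using smooth_iter_deriv_continuous[OF smooth_alg_smooth(1), of R f S "[]"] by simp

text \<open>
  A derivative in direction \<open>u\<close> either falls on the slowly varying factor or produces the factor
  \<open>L * (v \<bullet> u)\<close> and advances the phase by a quarter period. Sorted by powers of \<open>L\<close>, the top
  coefficient collects the terms in which every derivative fell on the wave.
\<close>

lemma iter_deriv_modulated:
  assumes \<rho>: "smooth_alg R \<rho>" "vanishes_beyond R \<rho>"
  shows "\<exists>r. (\<forall>j. smooth_alg R (r j) \<and> vanishes_beyond R (r j)) \<and>
    r (length vs) = (\<lambda>x. prod_list (map ((\<bullet>) v) vs) * \<rho> x) \<and>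
    (\<forall>L \<theta> x. iter_deriv (\<lambda>x. \<rho> x * cos (L * (v \<bullet> x) + \<theta>)) vs x
      = (\<Sum>j\<le>length vs. L ^ j * (r j x * cos (L * (v \<bullet> x) + \<theta> + real j * (pi / 2)))))"
proof (induction vs)
  case Nil
  show ?case by (intro exI[of _ "\<lambda>j. \<rho>"]) (simp add: assms)
next
  case (Cons u vs)
  let ?n = "length vs"
  obtain r where r: "\<And>j. smooth_alg R (r j)" "\<And>j. vanishes_beyond R (r j)"
    and top: "r ?n = (\<lambda>x. prod_list (map ((\<bullet>) v) vs) * \<rho> x)"
    and eq: "\<And>L \<theta> x. iter_deriv (\<lambda>x. \<rho> x * cos (L * (v \<bullet> x) + \<theta>)) vs x
      = (\<Sum>j\<le>?n. L ^ j * (r j x * cos (L * (v \<bullet> x) + \<theta> + real j * (pi / 2))))"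
    using Cons by blast
  obtain r' where r': "\<And>j x. (r j has_derivative r' j x) (at x)" "\<And>j u. smooth_alg R (\<lambda>x. r' j x u)"
    using smooth_alg_has_derivative[OF r(1)] by metis
  \<comment> \<open>product rule, sorted by powers of \<open>L\<close>: the derivative of the amplitude keeps the power, that of
      the wave raises it\<close>
  define q where "q j = (\<lambda>x. (if j \<le> ?n then r' j x u else 0) + (if j
      = 0 then 0 else (v \<bullet> u) * r (j - 1) x))" for j
  have "smooth_alg R (q j)" for j
    unfolding q_def by (intro smooth_alg.add smooth_alg_if smooth_alg_cmult smooth_alg.const r r')
  moreover have "vanishes_beyond R (q j)" for j
    using vanishes_beyond_derivative[OF r(2) r'(1)] r(2) by (auto simp: q_def vanishes_beyond_def)
  moreover have "q (length (u # vs)) = (\<lambda>x. prod_list (map ((\<bullet>) v) (u # vs)) * \<rho> x)"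
    by (simp add: q_def top mult.assoc)
  moreover have "iter_deriv (\<lambda>x. \<rho> x * cos (L * (v \<bullet> x) + \<theta>)) (u # vs) x
      = (\<Sum>j\<le>length (u # vs). L ^ j * (q j x * cos (L * (v \<bullet> x) + \<theta> + real j * (pi / 2))))" for L \<theta> x
  proof -
    define C where "C j = cos (L * (v \<bullet> x) + \<theta> + real j * (pi / 2))" for j
    have C': "C (Suc j) = - sin (L * (v \<bullet> x) + \<theta> + real j * (pi / 2))" for j
    proof -
      have "L * (v \<bullet> x) + \<theta> + real (Suc j) * (pi / 2) = (L * (v \<bullet> x) + \<theta> + real j * (pi / 2)) + pi / 2"
        by (simp add: field_simps)
      then show ?thesis unfolding C_def by (simp only: cos_add) simp
    qed
    have D: "((\<lambda>x. L ^ j * (r j x * cos (L * (v \<bullet> x) + \<theta> + real j * (pi / 2)))) has_derivative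
        (\<lambda>u. L ^ j * (r j x * (- sin (L * (v \<bullet> x) + \<theta> + real j * (pi / 2)) * (L * (v \<bullet> u)))
            + r' j x u * C j))) (at x)" for j
      unfolding C_def by (auto intro!: derivative_eq_intros r'(1) simp: mult_ac)
    have "((\<lambda>x. \<Sum>j\<le>?n. L ^ j * (r j x * cos (L * (v \<bullet> x) + \<theta> + real j * (pi / 2)))) has_derivative
        (\<lambda>u. \<Sum>j\<le>?n. L ^ j * (r j x * (- sin (L * (v \<bullet> x) + \<theta> + real j * (pi / 2)) * (L * (v \<bullet> u)))
            + r' j x u * C j))) (at x)"
      by (intro has_derivative_sum D)
    from fun_cong[OF frechet_derivative_at[OF this, symmetric], of u]
    have "iter_deriv (\<lambda>x. \<rho> x * cos (L * (v \<bullet> x) + \<theta>)) (u # vs) x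
        = (\<Sum>j\<le>?n. L ^ j * (r j x * (C (Suc j) * (L * (v \<bullet> u))) + r' j x u * C j))"
      unfolding C' iter_deriv.simps by (subst eq[THEN ext])
    also have "\<dots> = (\<Sum>j\<le>?n. L ^ j * (r' j x u * C j))
        + (\<Sum>j\<le>?n. L ^ Suc j * ((v \<bullet> u) * r j x * C (Suc j)))"
      by (simp add: distrib_left sum.distrib mult_ac)
    also have "(\<Sum>j\<le>?n. L ^ j * (r' j x u * C j)) = (\<Sum>j\<le>Suc ?n. L ^ j * ((if j
        \<le> ?n then r' j x u else 0) * C j))"
      by simp
    also have "(\<Sum>j\<le>?n. L ^ Suc j * ((v \<bullet> u) * r j x * C (Suc j)))
        = (\<Sum>j\<le>Suc ?n. L ^ j * ((if j = 0 then 0 else (v \<bullet> u) * r (j - 1) x) * C j))"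
      by (subst sum.atMost_Suc_shift) simp
    finally show ?thesis
      by (simp only: q_def C_def[symmetric] sum.distrib[symmetric] distrib_left[symmetric]
          distrib_right[symmetric] length_Cons)
  qed
  ultimately show ?case by blast
qed

section \<open>Oscillating test maps\<close>

text \<open>
  Trigonometric polynomials with odd frequencies. Zero is not among the frequencies, so such a wave
  is a \<open>k\<close>-th derivative of a bounded wave of the same kind; and half a period reverses its sign.
\<close>

inductive odd_wave :: "(real \<Rightarrow> real) \<Rightarrow> bool" where
  cos: "odd \<omega> \<Longrightarrow> odd_wave (\<lambda>s. cos (real_of_int \<omega> * s + \<theta>))"
| add: "odd_wave f \<Longrightarrow> odd_wave g \<Longrightarrow> odd_wave (\<lambda>s. f s + g s)"
| scale: "odd_wave f \<Longrightarrow> odd_wave (\<lambda>s. c * f s)"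

lemma odd_wave_times_cos_squared: "odd_wave u \<Longrightarrow> odd_wave (\<lambda>s. (cos s)\<^sup>2 * u s)"
proof (induction rule: odd_wave.induct)
  case (cos \<omega> \<theta>)
  have "(cos s)\<^sup>2 * cos (real_of_int \<omega> * s + \<theta>)
      = 1/2 * cos (real_of_int \<omega> * s + \<theta>) + (1/4 * cos (real_of_int (\<omega> + 2) * s + \<theta>)
        + 1/4 * cos (real_of_int (\<omega> - 2) * s + \<theta>))" for s
  proof -
    have 1: "real_of_int (\<omega> + 2) * s + \<theta> = (real_of_int \<omega> * s + \<theta>) + 2 * s"
      and 2: "real_of_int (\<omega> - 2) * s + \<theta> = (real_of_int \<omega> * s + \<theta>) - 2 * s"
      by (simp_all add: algebra_simps)
    show ?thesis unfolding 1 2 cos_add cos_diff cos_double_cos by (simp add: field_simps)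
  qed
  moreover have "odd_wave (\<lambda>s. 1/2 * cos (real_of_int \<omega> * s + \<theta>)
      + (1/4 * cos (real_of_int (\<omega> + 2) * s + \<theta>) + 1/4 * cos (real_of_int (\<omega> - 2) * s + \<theta>)))"
    using cos by (intro odd_wave.intros) auto
  ultimately show ?case by presburger
next
  case (add f g)
  from odd_wave.add[OF add.IH] show ?case by (simp add: distrib_left)
next
  case (scale f c)
  from odd_wave.scale[OF scale.IH, of c] show ?case by (simp add: mult.left_commute)
qed

lemma odd_wave_odd_power_cos: "odd n \<Longrightarrow> odd_wave (\<lambda>s. cos s ^ n)"
proof (induction n rule: less_induct)
  case (less n)
  show ?case
  proof (cases "n = 1")
    case True
    then show ?thesis using odd_wave.cos[of 1 0] by simp
  next
    case False
    define m where "m = n - 2"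
    have n: "n = m + 2" "odd m" "m < n" using less.prems False unfolding m_def by presburger+
    show ?thesis
      using odd_wave_times_cos_squared[OF less.IH[OF n(3,2)]]
      by (simp add: n(1) power_add power2_eq_square mult_ac)
  qed
qed

lemma odd_wave_sum:
  assumes "\<And>i. i \<in> I \<Longrightarrow> odd_wave (f i)"
  shows "odd_wave (\<lambda>s. \<Sum>i\<in>I. f i s)"
proof -
  have zero: "odd_wave (\<lambda>s. 0)" using odd_wave.scale[OF odd_wave.cos[of 1 0], of 0] by simp
  show ?thesis using assms
    by (induction I rule: infinite_finite_induct) (auto intro: zero odd_wave.add)
qed

lemma odd_wave_antiperiodic: "odd_wave u \<Longrightarrow> u (s + pi) = - u s"
proof (induction rule: odd_wave.induct)
  case (cos \<omega> \<theta>)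
  then obtain m where "\<omega> = 2 * m + 1" by (elim oddE)
  then have "real_of_int \<omega> * (s + pi) + \<theta> = (real_of_int \<omega> * s + \<theta>) + 2 * pi * real_of_int m + pi"
    by (simp add: algebra_simps)
  then show ?case by (simp only: cos_add sin_add cos_int_2pin sin_int_2pin) simp
qed (auto simp: algebra_simps)

text \<open>
  A polynomial that approximates the truncation of \<open>y / \<delta>\<close> to \<open>[-1, 1]\<close> may be replaced by its odd
  part, and odd powers of the cosine contain odd frequencies only.
\<close>

lemma exists_almost_square_wave:
  assumes "0 < \<delta>" "0 < \<epsilon>"
  shows "\<exists>u. odd_wave u \<and> (\<forall>s. \<bar>u s\<bar> \<le> 1 + \<epsilon>) \<and> (\<forall>s. \<delta> \<le> \<bar>cos s\<bar> \<longrightarrow> \<bar>\<bar>u s\<bar> - 1\<bar> \<le> \<epsilon>)"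
proof -
  define f where "f y = max (- 1) (min 1 (y / \<delta>))" for y
  have f_odd: "f (- y) = - f y" for y by (simp add: f_def max_def min_def)
  have "continuous_on {- 1..1} f"
    unfolding f_def using assms by (intro continuous_intros) auto
  then obtain p where p: "real_polynomial_function p" "\<And>y. y \<in> {- 1..1} \<Longrightarrow> \<bar>f y - p y\<bar> < \<epsilon>"
    using Stone_Weierstrass_real_polynomial_function[of "{- 1..1}" f \<epsilon>] assms by auto
  obtain a n where an: "p = (\<lambda>y. \<Sum>i\<le>n. a i * y ^ i)"
    using p(1) real_polynomial_function_iff_sum by blast
  define u where "u s = (\<Sum>i\<in>{i. i \<le> n \<and> odd i}. a i * cos s ^ i)" for s
  have u_eq: "u s = (p (cos s) - p (- cos s)) / 2" for s
  proof -
    have "p y - p (- y) = (\<Sum>i\<le>n. if odd i then 2 * (a i * y ^ i) else 0)" for y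
      unfolding an sum_subtractf[symmetric] by (intro sum.cong) auto
    also have "\<dots> y = (\<Sum>i\<in>{i. i \<le> n \<and> odd i}. 2 * (a i * y ^ i))" for y
      by (subst sum.inter_filter[symmetric]) (auto intro!: sum.cong)
    finally show ?thesis by (simp add: u_def sum_distrib_left[symmetric])
  qed
  have close: "\<bar>u s - f (cos s)\<bar> \<le> \<epsilon>" for s
  proof -
    have "\<bar>f (cos s) - p (cos s)\<bar> < \<epsilon>" "\<bar>- f (cos s) - p (- cos s)\<bar> < \<epsilon>"
      using p(2)[of "cos s"] p(2)[of "- cos s"] by (simp_all add: f_odd)
    moreover have "\<bar>(P - Q) / 2 - y\<bar> \<le> \<epsilon>" if "\<bar>y - P\<bar> < \<epsilon>" "\<bar>- y - Q\<bar> < \<epsilon>" for y P Q :: real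
      using that by (simp add: abs_le_iff abs_less_iff field_simps)
    ultimately show ?thesis unfolding u_eq by blast
  qed
  have "odd_wave u"
    unfolding u_def by (intro odd_wave_sum odd_wave.scale odd_wave_odd_power_cos) auto
  moreover have "\<bar>u s\<bar> \<le> 1 + \<epsilon>" for s
  proof -
    have "\<bar>f (cos s)\<bar> \<le> 1" unfolding f_def by linarith
    then show ?thesis using close[of s] by linarith
  qed
  moreover have "\<bar>\<bar>u s\<bar> - 1\<bar> \<le> \<epsilon>" if "\<delta> \<le> \<bar>cos s\<bar>" for s
  proof -
    have "\<bar>f (cos s)\<bar> = 1"
      using that assms(1) by (auto simp: f_def max_def min_def field_simps abs_if split: if_splits)
    then show ?thesis using close[of s] by linarith
  qed
  ultimately show ?thesis by blast
qed

lemma mnorm_le_finitely_many_values: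
  "\<exists>(d::nat) (bs::nat \<Rightarrow> 'a::euclidean_space list) K. 0 \<le> K \<and> (\<forall>i<d. length (bs i) = k) \<and>
    (\<forall>\<xi>::'a list \<Rightarrow> 'b::euclidean_space. \<xi> \<in> sym_maps k \<longrightarrow> mnorm k \<xi> \<le> K * (\<Sum>i<d. norm (\<xi> (bs i))))"
proof -
  obtain d :: nat and t and bs :: "nat \<Rightarrow> 'a list" and v and w :: "nat \<Rightarrow> 'b"
    where *: "(\<forall>i<d. length (bs i) = k) \<and> (\<forall>\<xi>\<in>sym_maps k. \<forall>us.
        \<xi> us = (\<Sum>i<d. (t i * (\<xi> (bs i) \<bullet> w i)) *\<^sub>R rank1 k (v i) (w i) us))"
    using sym_maps_sum_rank1[of k, where 'a = 'a and 'b = 'b] by (elim exE)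
  have len: "\<forall>i<d. length (bs i) = k" using * by simp
  have rep: "\<xi> us = (\<Sum>i<d. (t i * (\<xi> (bs i) \<bullet> w i)) *\<^sub>R rank1 k (v i) (w i) us)"
    if "\<xi> \<in> sym_maps k" for \<xi> us
    using conjunct2[OF *, rule_format, OF that] .
  define K where "K = (\<Sum>i<d. \<bar>t i\<bar> * norm (w i) * mnorm k (rank1 k (v i) (w i)))"
  have nn: "0 \<le> mnorm k (rank1 k (v i) (w i))" for i
    by (rule mnorm_nonneg[OF sym_maps_multilinear[OF rank1_sym_maps]])
  have "mnorm k \<xi> \<le> K * (\<Sum>i<d. norm (\<xi> (bs i)))" if \<xi>: "\<xi> \<in> sym_maps k" for \<xi> :: "'a list \<Rightarrow> 'b"
  proof -
    have "\<xi> = (\<lambda>us. \<Sum>i<d. (t i * (\<xi> (bs i) \<bullet> w i)) *\<^sub>R rank1 k (v i) (w i) us)"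
      using rep[OF \<xi>] by (rule ext)
    then have "mnorm k \<xi> = mnorm k (\<lambda>us. \<Sum>i<d. (t i * (\<xi> (bs i) \<bullet> w i)) *\<^sub>R rank1 k (v i) (w i) us)"
      by (rule arg_cong)
    also have "\<dots> \<le> (\<Sum>i<d. \<bar>t i * (\<xi> (bs i) \<bullet> w i)\<bar> * mnorm k (rank1 k (v i) (w i)))"
      by (intro mnorm_sum rank1_sym_maps)
    also have "\<dots> \<le> (\<Sum>i<d. (\<bar>t i\<bar> * norm (w i) * mnorm k (rank1 k (v i) (w i))) * (\<Sum>i<d. norm (\<xi> (bs
        i))))"
    proof (rule sum_mono)
      fix i assume i: "i \<in> {..<d}"
      have "\<bar>\<xi> (bs i) \<bullet> w i\<bar> \<le> norm (\<xi> (bs i)) * norm (w i)" by (rule Cauchy_Schwarz_ineq2)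
      also have "\<dots> \<le> (\<Sum>i<d. norm (\<xi> (bs i))) * norm (w i)"
        using i by (intro mult_right_mono member_le_sum) auto
      finally have "\<bar>t i\<bar> * \<bar>\<xi> (bs i) \<bullet> w i\<bar> * mnorm k (rank1 k (v i) (w i))
          \<le> \<bar>t i\<bar> * ((\<Sum>i<d. norm (\<xi> (bs i))) * norm (w i)) * mnorm k (rank1 k (v i) (w i))"
        using nn by (intro mult_right_mono mult_left_mono) auto
      then show "\<bar>t i * (\<xi> (bs i) \<bullet> w i)\<bar> * mnorm k (rank1 k (v i) (w i))
          \<le> (\<bar>t i\<bar> * norm (w i) * mnorm k (rank1 k (v i) (w i))) * (\<Sum>i<d. norm (\<xi> (bs i)))"
        by (simp add: abs_mult mult_ac)
    qed
    also have "\<dots> = K * (\<Sum>i<d. norm (\<xi> (bs i)))"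
      by (simp only: K_def sum_distrib_right)
    finally show ?thesis .
  qed
  moreover have "0 \<le> K" unfolding K_def using nn by (intro sum_nonneg mult_nonneg_nonneg) auto
  ultimately show ?thesis using len by blast
qed

text \<open>
  Divided by \<open>L ^ k\<close>, all terms but the leading one carry a negative power of \<open>L\<close>, and their
  coefficients are bounded because they are continuous with compact support.
\<close>

lemma modulated_wave_leading_term:
  fixes \<rho> :: "'a::euclidean_space \<Rightarrow> real"
  assumes \<rho>: "smooth_alg R \<rho>" "vanishes_beyond R \<rho>"
  shows "\<exists>K\<ge>0. \<forall>L x \<theta>. 1 \<le> \<bar>L\<bar> \<longrightarrow>
    \<bar>iter_deriv (\<lambda>x. \<rho> x * cos (L * (v \<bullet> x) + \<theta>)) vs x / L ^ length vs
      - prod_list (map ((\<bullet>) v) vs) * \<rho> x * cos (L * (v \<bullet> x) + \<theta> + real (length vs) * (pi / 2))\<bar>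
          \<le> K / \<bar>L\<bar>"
proof -
  let ?n = "length vs"
  obtain r where r: "\<And>j. smooth_alg R (r j)" "\<And>j. vanishes_beyond R (r j)"
    and top: "r ?n = (\<lambda>x. prod_list (map ((\<bullet>) v) vs) * \<rho> x)"
    and eq: "\<And>L \<theta> x. iter_deriv (\<lambda>x. \<rho> x * cos (L * (v \<bullet> x) + \<theta>)) vs x
      = (\<Sum>j\<le>?n. L ^ j * (r j x * cos (L * (v \<bullet> x) + \<theta> + real j * (pi / 2))))"
    using iter_deriv_modulated[OF \<rho>, of vs v] by blast
  have "\<exists>B. \<forall>x. norm (r j x) \<le> B" for j
    using vanishes_beyond_bounded[OF r(2) smooth_alg_continuous[OF r(1)]] .
  then obtain B where B: "\<And>j x. \<bar>r j x\<bar> \<le> B j" unfolding real_norm_def by metis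
  have Bnn: "0 \<le> B j" for j using B[of j 0] by linarith
  have "\<bar>iter_deriv (\<lambda>x. \<rho> x * cos (L * (v \<bullet> x) + \<theta>)) vs x / L ^ ?n
      - prod_list (map ((\<bullet>) v) vs) * \<rho> x * cos (L * (v \<bullet> x) + \<theta> + real ?n * (pi / 2))\<bar>
          \<le> (\<Sum>j<?n. B j) / \<bar>L\<bar>"
    if L: "1 \<le> \<bar>L\<bar>" for L x \<theta>
  proof -
    let ?c = "\<lambda>j. cos (L * (v \<bullet> x) + \<theta> + real j * (pi / 2))"
    have "iter_deriv (\<lambda>x. \<rho> x * cos (L * (v \<bullet> x) + \<theta>)) vs x / L ^ ?n
        = (\<Sum>j<?n. L ^ j / L ^ ?n * (r j x * ?c j)) + r ?n x * ?c ?n"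
      unfolding eq using L by (cases "L = 0")
          (simp_all add: sum_divide_distrib lessThan_Suc_atMost[symmetric] add_divide_distrib)
    then have "\<bar>iter_deriv (\<lambda>x. \<rho> x * cos (L * (v \<bullet> x) + \<theta>)) vs x / L ^ ?n
      - prod_list (map ((\<bullet>) v) vs) * \<rho> x * ?c ?n\<bar> = \<bar>\<Sum>j<?n. L ^ j / L ^ ?n * (r j x * ?c j)\<bar>"
      by (simp add: top)
    also have "\<dots> \<le> (\<Sum>j<?n. \<bar>L ^ j / L ^ ?n * (r j x * ?c j)\<bar>)" by (rule sum_abs)
    also have "\<dots> \<le> (\<Sum>j<?n. 1 / \<bar>L\<bar> * B j)"
    proof (rule sum_mono)
      fix j assume j: "j \<in> {..<?n}"
      have "\<bar>L\<bar> ^ Suc j \<le> \<bar>L\<bar> ^ ?n" using L j by (intro power_increasing) auto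
      moreover have "0 < \<bar>L\<bar> ^ ?n" using L by (intro zero_less_power) linarith
      ultimately have "\<bar>L ^ j / L ^ ?n\<bar> \<le> 1 / \<bar>L\<bar>"
        using L by (simp add: abs_divide power_abs divide_le_eq pos_le_divide_eq mult.commute)
      moreover have "\<bar>r j x * ?c j\<bar> \<le> B j * 1"
        unfolding abs_mult using B Bnn abs_cos_le_one by (intro mult_mono) auto
      ultimately have "\<bar>L ^ j / L ^ ?n\<bar> * \<bar>r j x * ?c j\<bar> \<le> 1 / \<bar>L\<bar> * B j"
        by (intro mult_mono) auto
      then show "\<bar>L ^ j / L ^ ?n * (r j x * ?c j)\<bar> \<le> 1 / \<bar>L\<bar> * B j"
        by (simp only: abs_mult)
    qed
    also have "\<dots> = (\<Sum>j<?n. B j) / \<bar>L\<bar>" by (simp add: sum_divide_distrib)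
    finally show ?thesis .
  qed
  moreover have "0 \<le> (\<Sum>j<?n. B j)" by (intro sum_nonneg Bnn)
  ultimately show ?thesis by blast
qed

lemma smooth_scaleR:
  assumes "smooth \<phi>"
  shows "smooth (\<lambda>x. c *\<^sub>R \<phi> x)"
    and "iter_deriv (\<lambda>x. c *\<^sub>R \<phi> x) vs = (\<lambda>x. c *\<^sub>R iter_deriv \<phi> vs x)"
  by (rule smooth_iter_derivI[where g = "\<lambda>vs x. c *\<^sub>R iter_deriv \<phi> vs x"];
      simp only: iter_deriv.simps(1) has_derivative_scaleR_right[OF smooth_has_derivative] assms)+

abbreviation near_oscillation ::
    "nat \<Rightarrow> real \<Rightarrow> ('a::euclidean_space \<Rightarrow> real) \<Rightarrow> ('a list \<Rightarrow> 'b::euclidean_space) \<Rightarrow> real \<Rightarrow> ('a \<Rightarrow> 'b) \<Rightarrow>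
        bool" where
  "near_oscillation k R f e \<epsilon> \<psi> \<equiv> smooth \<psi> \<and> vanishes_beyond R \<psi> \<and>
     (\<forall>x. mnorm k (\<lambda>vs. Dk k \<psi> x vs - f x *\<^sub>R e vs) \<le> \<epsilon>)"

text \<open>
  For one frequency \<open>\<omega>\<close>, take the wave retarded by \<open>k\<close> quarter periods and divide it by \<open>(M \<omega>)\<^sup>k\<close>;
  differentiating \<open>k\<close> times undoes both. The error is of order \<open>1 / M\<close>, uniformly in the phase \<open>s\<close>.
\<close>

lemma oscillating_perturbation:
  fixes \<rho> :: "'a::euclidean_space \<Rightarrow> real" and w :: "'b::euclidean_space"
  assumes \<rho>: "smooth_alg R \<rho>" "vanishes_beyond R \<rho>"
  shows "odd_wave u \<Longrightarrow> 0 < \<epsilon> \<Longrightarrow> \<exists>M0. \<forall>M\<ge>M0. \<forall>s. \<exists>\<psi>::'a \<Rightarrow> 'b.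
      near_oscillation k R (\<lambda>x. \<rho> x * u (M * (v \<bullet> x) + s)) (rank1 k v w) \<epsilon> \<psi>"
proof (induction arbitrary: \<epsilon> rule: odd_wave.induct)
  case (cos \<omega> \<theta>)
  obtain d :: nat and bs :: "nat \<Rightarrow> 'a list" and K where K: "0 \<le> K"
    and len: "\<forall>i<d. length (bs i) = k"
    and mn: "\<forall>\<xi>::'a list \<Rightarrow> 'b. \<xi> \<in> sym_maps k \<longrightarrow> mnorm k \<xi> \<le> K * (\<Sum>i<d. norm (\<xi> (bs i)))"
    using mnorm_le_finitely_many_values[of k, where 'a = 'a and 'b = 'b] by (elim exE conjE)
  have "\<forall>vs. \<exists>C. 0 \<le> C \<and> (\<forall>L x \<theta>. 1 \<le> \<bar>L\<bar> \<longrightarrow>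
    \<bar>iter_deriv (\<lambda>x. \<rho> x * cos (L * (v \<bullet> x) + \<theta>)) vs x / L ^ length vs
      - prod_list (map ((\<bullet>) v) vs) * \<rho> x * cos (L * (v \<bullet> x) + \<theta> + real (length vs) * (pi / 2))\<bar>
          \<le> C / \<bar>L\<bar>)"
    using modulated_wave_leading_term[OF \<rho>] by blast
  from choice[OF this] obtain C where C0: "\<And>vs. 0 \<le> C vs"
    and C: "\<And>vs L x \<theta>. 1 \<le> \<bar>L\<bar> \<Longrightarrow>
    \<bar>iter_deriv (\<lambda>x. \<rho> x * cos (L * (v \<bullet> x) + \<theta>)) vs x / L ^ length vs
      - prod_list (map ((\<bullet>) v) vs) * \<rho> x * cos (L * (v \<bullet> x) + \<theta> + real (length vs) * (pi / 2))\<bar>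
          \<le> C vs / \<bar>L\<bar>"
    by blast
  define Q where "Q = K * (\<Sum>i<d. C (bs i) * norm w)"
  have Q: "0 \<le> Q" unfolding Q_def by (intro mult_nonneg_nonneg sum_nonneg K C0) auto
  show ?case
  proof (intro exI[of _ "max 1 (Q / \<epsilon>)"] allI impI)
    fix M s :: real assume M: "max 1 (Q / \<epsilon>) \<le> M"
    define L where "L = M * real_of_int \<omega>"
    have M1: "1 \<le> M" "Q \<le> \<epsilon> * M" using M cos(2) by (simp_all add: divide_le_eq mult.commute)
    have "1 \<le> \<bar>real_of_int \<omega>\<bar>" using cos(1) by (cases "\<omega> = 0") (auto simp flip: of_int_abs)
    then have LM: "M \<le> \<bar>L\<bar>" using M1 mult_left_mono[of 1 "\<bar>real_of_int \<omega>\<bar>" M]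
      by (simp add: L_def abs_mult)
    then have L1: "1 \<le> \<bar>L\<bar>" using M1 by linarith
    \<comment> \<open>retarded by \<open>k\<close> quarter periods, which \<open>k\<close> differentiations make up for\<close>
    define \<theta>' where "\<theta>' = real_of_int \<omega> * s + \<theta> - real k * (pi / 2)"
    define f where "f = (\<lambda>x. \<rho> x * cos (L * (v \<bullet> x) + \<theta>'))"
    have "smooth_alg R (\<lambda>x. \<rho> x * cos ((L *\<^sub>R v) \<bullet> x + \<theta>'))"
      by (intro smooth_alg.mult \<rho> smooth_alg.cos)
    then have f: "smooth f" unfolding f_def using smooth_alg_smooth(1) by simp
    define \<psi> where "\<psi> = (\<lambda>x. ((1 / L ^ k) * f x) *\<^sub>R w)"
    have sm: "smooth \<psi>" unfolding \<psi>_def by (intro smooth_scaleR_vector smooth_cmult f)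
    have der: "iter_deriv \<psi> vs x = (iter_deriv f vs x / L ^ k) *\<^sub>R w" for vs x
      unfolding \<psi>_def smooth_scaleR_vector(2)[OF smooth_cmult(1)[OF f]] smooth_cmult(2)[OF f] by simp
    have "vanishes_beyond R \<psi>" using \<rho>(2) by (auto simp: \<psi>_def f_def vanishes_beyond_def)
    moreover have "mnorm k (\<lambda>vs. Dk k \<psi> x vs
        - (\<rho> x * cos (real_of_int \<omega> * (M * (v \<bullet> x) + s) + \<theta>)) *\<^sub>R rank1 k v w vs) \<le> \<epsilon>"
      (is "mnorm k ?E \<le> \<epsilon>") for x
    proof -
      have ph: "real_of_int \<omega> * (M * (v \<bullet> x) + s) + \<theta> = L * (v \<bullet> x) + \<theta>' + real k * (pi / 2)"
        by (simp add: L_def \<theta>'_def algebra_simps)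
      have val: "norm (?E (bs i)) \<le> C (bs i) * norm w / \<bar>L\<bar>" if "i < d" for i
      proof -
        have li: "length (bs i) = k" using len that by blast
        have "?E (bs i) = (iter_deriv f (bs i) x / L ^ k - prod_list (map ((\<bullet>) v) (bs i)) * \<rho> x
            * cos (L * (v \<bullet> x) + \<theta>' + real k * (pi / 2))) *\<^sub>R w"
          unfolding ph by (simp add: Dk_def rank1_def li der scaleR_diff_left mult_ac)
        then show ?thesis
          using mult_right_mono[OF C[where vs = "bs i" and L = L and x = x and \<theta>
              = \<theta>', OF L1] norm_ge_zero[of w]]
          by (simp add: li f_def)
      qed
      have "mnorm k ?E \<le> K * (\<Sum>i<d. norm (?E (bs i)))"
        by (intro mn[rule_format] sym_maps_diff Dk_sym_maps[OF sm] sym_maps_scale rank1_sym_maps)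
      also have "\<dots> \<le> K * (\<Sum>i<d. C (bs i) * norm w / \<bar>L\<bar>)"
        using val by (intro mult_left_mono K sum_mono) auto
      also have "\<dots> = Q / \<bar>L\<bar>" unfolding Q_def sum_divide_distrib[symmetric] by simp
      also have "\<dots> \<le> \<epsilon>"
      proof -
        have "Q \<le> \<epsilon> * \<bar>L\<bar>" using M1(2) mult_left_mono[OF LM, of \<epsilon>] cos(2) by linarith
        then show ?thesis using L1 by (simp add: divide_le_eq)
      qed
      finally show ?thesis .
    qed
    ultimately show "\<exists>\<psi>::'a \<Rightarrow> 'b.
      near_oscillation k R (\<lambda>x. \<rho> x * cos (real_of_int \<omega> * (M * (v \<bullet> x) + s) + \<theta>)) (rank1 k v w) \<epsilon> \<psi>"
      using sm by blast
  qed
next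
  case (add f g)
  have half: "0 < \<epsilon> / 2" using add.prems by simp
  obtain M1 M2 where M1: "\<forall>M\<ge>M1. \<forall>s. \<exists>\<psi>::'a \<Rightarrow> 'b.
      near_oscillation k R (\<lambda>x. \<rho> x * f (M * (v \<bullet> x) + s)) (rank1 k v w) (\<epsilon> / 2) \<psi>"
    and M2: "\<forall>M\<ge>M2. \<forall>s. \<exists>\<psi>::'a \<Rightarrow> 'b.
      near_oscillation k R (\<lambda>x. \<rho> x * g (M * (v \<bullet> x) + s)) (rank1 k v w) (\<epsilon> / 2) \<psi>"
    using add.IH(1)[OF half] add.IH(2)[OF half] by blast
  show ?case
  proof (intro exI[of _ "max M1 M2"] allI impI)
    fix M s :: real assume M: "max M1 M2 \<le> M"
    obtain \<psi>1 :: "'a \<Rightarrow> 'b" where 1: "smooth \<psi>1" "vanishes_beyond R \<psi>1"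
      "\<forall>x. mnorm k (\<lambda>vs. Dk k \<psi>1 x vs - (\<rho> x * f (M * (v \<bullet> x) + s)) *\<^sub>R rank1 k v w vs) \<le> \<epsilon> / 2"
      using M1 M by (meson max.boundedE)
    obtain \<psi>2 :: "'a \<Rightarrow> 'b" where 2: "smooth \<psi>2" "vanishes_beyond R \<psi>2"
      "\<forall>x. mnorm k (\<lambda>vs. Dk k \<psi>2 x vs - (\<rho> x * g (M * (v \<bullet> x) + s)) *\<^sub>R rank1 k v w vs) \<le> \<epsilon> / 2"
      using M2 M by (meson max.boundedE)
    have "vanishes_beyond R (\<lambda>x. \<psi>1 x + \<psi>2 x)"
      using 1(2) 2(2) by (simp add: vanishes_beyond_def)
    moreover have "mnorm k (\<lambda>vs. Dk k (\<lambda>x. \<psi>1 x + \<psi>2 x) x vs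
        - (\<rho> x * (f (M * (v \<bullet> x) + s) + g (M * (v \<bullet> x) + s))) *\<^sub>R rank1 k v w vs) \<le> \<epsilon>" for x
    proof -
      have eq: "(\<lambda>vs. Dk k (\<lambda>x. \<psi>1 x + \<psi>2 x) x vs
          - (\<rho> x * (f (M * (v \<bullet> x) + s) + g (M * (v \<bullet> x) + s))) *\<^sub>R rank1 k v w vs)
        = (\<lambda>vs. (Dk k \<psi>1 x vs - (\<rho> x * f (M * (v \<bullet> x) + s)) *\<^sub>R rank1 k v w vs)
          + (Dk k \<psi>2 x vs - (\<rho> x * g (M * (v \<bullet> x) + s)) *\<^sub>R rank1 k v w vs))"
        by (auto simp: Dk_def smooth_add(2)[OF 1(1) 2(1)] fun_eq_iff algebra_simps)
      have "mnorm k (\<lambda>vs. (Dk k \<psi>1 x vs - (\<rho> x * f (M * (v \<bullet> x) + s)) *\<^sub>R rank1 k v w vs)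
          + (Dk k \<psi>2 x vs - (\<rho> x * g (M * (v \<bullet> x) + s)) *\<^sub>R rank1 k v w vs)) \<le> \<epsilon> / 2 + \<epsilon> / 2"
        by (intro order_trans[OF mnorm_add add_mono] 1(3)[rule_format] 2(3)[rule_format]
            sym_maps_diff Dk_sym_maps 1(1) 2(1) sym_maps_scale rank1_sym_maps)
      then show ?thesis unfolding eq by simp
    qed
    ultimately show "\<exists>\<psi>::'a \<Rightarrow> 'b.
      near_oscillation k R (\<lambda>x. \<rho> x * (f (M * (v \<bullet> x) + s) + g (M * (v \<bullet> x) + s))) (rank1 k v w) \<epsilon> \<psi>"
      using smooth_add(1)[OF 1(1) 2(1)] by blast
  qed
next
  case (scale f c)
  have \<epsilon>': "0 < \<epsilon> / (\<bar>c\<bar> + 1)" using scale.prems by simp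
  obtain M0 where M0: "\<forall>M\<ge>M0. \<forall>s. \<exists>\<psi>::'a \<Rightarrow> 'b.
      near_oscillation k R (\<lambda>x. \<rho> x * f (M * (v \<bullet> x) + s)) (rank1 k v w) (\<epsilon> / (\<bar>c\<bar> + 1)) \<psi>"
    using scale.IH[OF \<epsilon>'] by blast
  show ?case
  proof (intro exI[of _ M0] allI impI)
    fix M s :: real assume M: "M0 \<le> M"
    obtain \<psi> :: "'a \<Rightarrow> 'b" where 1: "smooth \<psi>" "vanishes_beyond R \<psi>"
      "\<forall>x. mnorm k (\<lambda>vs. Dk k \<psi> x vs - (\<rho> x * f (M * (v \<bullet> x) + s)) *\<^sub>R rank1 k v w vs) \<le> \<epsilon> / (\<bar>c\<bar> + 1)"
      using M0 M by meson
    have "vanishes_beyond R (\<lambda>x. c *\<^sub>R \<psi> x)" using 1(2) by (simp add: vanishes_beyond_def)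
    moreover have "mnorm k (\<lambda>vs. Dk k (\<lambda>x. c *\<^sub>R \<psi> x) x vs
        - (\<rho> x * (c * f (M * (v \<bullet> x) + s))) *\<^sub>R rank1 k v w vs) \<le> \<epsilon>" for x
    proof -
      let ?E = "\<lambda>vs. Dk k \<psi> x vs - (\<rho> x * f (M * (v \<bullet> x) + s)) *\<^sub>R rank1 k v w vs"
      have eq: "(\<lambda>vs. Dk k (\<lambda>x. c *\<^sub>R \<psi> x) x vs
          - (\<rho> x * (c * f (M * (v \<bullet> x) + s))) *\<^sub>R rank1 k v w vs) = (\<lambda>vs. c *\<^sub>R ?E vs)"
        by (auto simp: Dk_def smooth_scaleR(2)[OF 1(1)] fun_eq_iff scaleR_diff_right mult_ac)
      have "mnorm k (\<lambda>vs. c *\<^sub>R ?E vs) \<le> \<bar>c\<bar> * mnorm k ?E"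
        by (intro mnorm_scale_le sym_maps_diff Dk_sym_maps 1(1) sym_maps_scale rank1_sym_maps)
      also have "\<dots> \<le> \<bar>c\<bar> * (\<epsilon> / (\<bar>c\<bar> + 1))" using 1(3) by (intro mult_left_mono) auto
      also have "\<dots> \<le> \<epsilon>" using scale.prems by (simp add: divide_le_eq mult.commute)
      finally show ?thesis unfolding eq .
    qed
    ultimately show "\<exists>\<psi>::'a \<Rightarrow> 'b.
      near_oscillation k R (\<lambda>x. \<rho> x * (c * f (M * (v \<bullet> x) + s))) (rank1 k v w) \<epsilon> \<psi>"
      using smooth_scaleR(1)[OF 1(1)] by blast
  qed
qed

text \<open>
  By measurability the indicator is an almost everywhere limit of continuous functions, which
  polynomials approximate uniformly on the ball. The factors \<open>1 - (1 - b)\<^sup>m\<close>, with \<open>b\<close> a bump that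
  is positive exactly in the open ball, provide compact support and tend to \<open>1\<close> inside.
\<close>

lemma smooth_approximation_of_indicator:
  fixes U :: "'a::euclidean_space set"
  assumes U: "U \<in> sets lebesgue" "U \<subseteq> cball 0 R" and R: "0 < R"
  shows "\<exists>\<rho>. (\<forall>m. smooth_alg R (\<rho> m) \<and> vanishes_beyond R (\<rho> m)) \<and> (\<forall>m x. \<bar>\<rho> m x\<bar> \<le> 2) \<and>
    (AE x in lebesgue. (\<lambda>m::nat. \<rho> m x) \<longlonglongrightarrow> indicator U x)"
proof -
  have "(indicator U :: 'a \<Rightarrow> real) \<in> borel_measurable lebesgue" using U(1) by simp
  then have "(indicator U :: 'a \<Rightarrow> real) measurable_on UNIV"
    by (rule lebesgue_measurable_imp_measurable_on_real) simp
  then obtain N and g :: "nat \<Rightarrow> 'a \<Rightarrow> real" where N: "negligible N"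
    and g: "\<And>n. continuous_on UNIV (g n)" "\<And>x. x \<notin> N \<Longrightarrow> (\<lambda>n. g n x) \<longlonglongrightarrow> indicator U x"
    unfolding measurable_on_def by auto
  define h where "h n x = max 0 (min 1 (g n x))" for n x
  have h_lim: "(\<lambda>n. h n x) \<longlonglongrightarrow> indicator U x" if "x \<notin> N" for x
  proof -
    have "(\<lambda>n. h n x) \<longlonglongrightarrow> max 0 (min 1 (indicator U x))"
      unfolding h_def by (intro tendsto_intros g(2) that)
    then show ?thesis by (cases "x \<in> U") auto
  qed
  have "\<exists>p. real_polynomial_function p \<and> (\<forall>x\<in>cball 0 R. \<bar>h n x - p x\<bar> < 1 / real (Suc n))" for n
  proof -
    have "continuous_on (cball 0 R) (h n)"
      unfolding h_def by (intro continuous_intros continuous_on_subset[OF g(1)]) auto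
    from Stone_Weierstrass_real_polynomial_function[OF compact_cball this, of "1 / real (Suc n)"]
    show ?thesis by (metis zero_less_divide_1_iff of_nat_0_less_iff zero_less_Suc)
  qed
  then obtain p where p: "\<And>n. real_polynomial_function (p n)"
    "\<And>n x. x \<in> cball 0 R \<Longrightarrow> \<bar>h n x - p n x\<bar> < 1 / real (Suc n)" by metis
  define b where "b = (\<lambda>x::'a. flat_exp 0 (R\<^sup>2 - x \<bullet> x))"
  have b01: "0 \<le> b x" "b x \<le> 1" for x by (simp_all add: b_def flat_exp_def)
  have b_pos: "0 < b x" if "norm x < R" for x
  proof -
    have "x \<bullet> x < R\<^sup>2" using that R by (simp add: dot_square_norm power_strict_mono)
    then show ?thesis by (simp add: b_def flat_exp_def)
  qed
  have b_0: "b x = 0" if "R < norm x" for x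
  proof -
    have "R\<^sup>2 < x \<bullet> x" using that R by (simp add: dot_square_norm power_strict_mono)
    then show ?thesis by (simp add: b_def flat_exp_def)
  qed
  define \<theta> where "\<theta> n x = 1 - (1 - b x) ^ n" for n x
  have \<theta>01: "0 \<le> \<theta> n x" "\<theta> n x \<le> 1" for n x
    using b01[of x] power_le_one[of "1 - b x" n] by (auto simp: \<theta>_def)
  define \<rho> where "\<rho> n x = p n x * \<theta> n x" for n x
  have "smooth_alg R b" unfolding b_def by (rule smooth_alg.bump)
  then have "smooth_alg R (\<theta> n)" for n
    unfolding \<theta>_def by (intro smooth_alg_diff smooth_alg_power smooth_alg.const)
  then have "smooth_alg R (\<rho> n)" for n
    unfolding \<rho>_def by (intro smooth_alg.mult[OF smooth_alg_polynomial[OF p(1)]])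
  moreover have "vanishes_beyond R (\<rho> n)" for n
    by (simp add: vanishes_beyond_def \<rho>_def \<theta>_def b_0)
  moreover have "\<bar>\<rho> n x\<bar> \<le> 2" for n x
  proof (cases "R < norm x")
    case True
    then show ?thesis by (simp add: \<rho>_def \<theta>_def b_0)
  next
    case False
    have "\<bar>h n x\<bar> \<le> 1" by (simp add: h_def max_def min_def)
    moreover have "\<bar>h n x - p n x\<bar> < 1 / real (Suc n)" using False by (intro p) simp
    moreover have "1 / real (Suc n) \<le> 1" by simp
    ultimately have "\<bar>p n x\<bar> \<le> 2" by linarith
    then have "\<bar>p n x\<bar> * \<bar>\<theta> n x\<bar> \<le> 2 * 1" using \<theta>01[of n x] by (intro mult_mono) auto
    then show ?thesis by (simp add: \<rho>_def abs_mult)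
  qed
  moreover have "AE x in lebesgue. (\<lambda>m. \<rho> m x) \<longlonglongrightarrow> indicator U x"
  proof -
    have "negligible (N \<union> sphere 0 R)" using N by (simp add: negligible_sphere)
    then have "N \<union> sphere 0 R \<in> null_sets lebesgue" by (simp add: negligible_iff_null_sets)
    then have "AE x in lebesgue. x \<notin> N \<union> sphere 0 R" by (rule AE_not_in)
    then show ?thesis
    proof (rule AE_mp, intro AE_I2 impI)
      fix x assume x: "x \<notin> N \<union> sphere 0 R"
      show "(\<lambda>m. \<rho> m x) \<longlonglongrightarrow> indicator U x"
      proof (cases "R < norm x")
        case True
        then have "x \<notin> U" using U(2) by auto
        then show ?thesis using True by (simp add: \<rho>_def \<theta>_def b_0)
      next
        case False
        then have lt: "norm x < R" using x by simp
        have "(\<lambda>n. h n x - p n x) \<longlonglongrightarrow> 0"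
        proof (rule Lim_null_comparison)
          show "\<forall>\<^sub>F n in sequentially. norm (h n x - p n x) \<le> 1 / real (Suc n)"
            using p(2)[of x] lt by (intro always_eventually allI) (simp add: less_imp_le)
          show "(\<lambda>n. 1 / real (Suc n)) \<longlonglongrightarrow> 0"
            using LIMSEQ_inverse_real_of_nat by (simp add: inverse_eq_divide)
        qed
        then have "(\<lambda>n. h n x - (h n x - p n x)) \<longlonglongrightarrow> indicator U x - 0"
          using x by (intro tendsto_diff h_lim) auto
        moreover have "(\<lambda>n. \<theta> n x) \<longlonglongrightarrow> 1 - 0"
          unfolding \<theta>_def using b_pos[OF lt] b01[of x]
          by (intro tendsto_diff tendsto_const LIMSEQ_realpow_zero) auto
        ultimately have "(\<lambda>n. p n x * \<theta> n x) \<longlonglongrightarrow> indicator U x * (1 - 0)"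
          by (intro tendsto_mult) auto
        then show ?thesis by (simp add: \<rho>_def)
      qed
    qed
  qed
  ultimately show ?thesis by (intro exI[of _ \<rho>]) blast
qed

section \<open>Integrands along fields of symmetric maps\<close>

text \<open>
  Continuity with respect to \<open>sym_topology\<close> in terms of the norm, in which form it is stable under
  translations and minima by direct estimates.
\<close>

definition sym_continuous ::
    "nat \<Rightarrow> (('a::euclidean_space list \<Rightarrow> 'b::euclidean_space) \<Rightarrow> real) \<Rightarrow> bool" where
  "sym_continuous k f \<longleftrightarrow> (\<forall>\<xi>\<in>sym_maps k. \<forall>\<epsilon>>0. \<exists>\<delta>>0. \<forall>\<eta>\<in>sym_maps k.
     mnorm k (\<lambda>vs. \<eta> vs - \<xi> vs) < \<delta> \<longrightarrow> \<bar>f \<eta> - f \<xi>\<bar> < \<epsilon>)"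

lemma continuous_map_imp_sym_continuous:
  fixes f :: "('a::euclidean_space list \<Rightarrow> 'b::euclidean_space) \<Rightarrow> real"
  assumes "continuous_map (sym_topology k) euclidean f"
  shows "sym_continuous k f"
  unfolding sym_continuous_def
proof (intro ballI allI impI)
  interpret Metric_space "sym_maps k :: ('a list \<Rightarrow> 'b) set" "sym_dist k"
    by (rule Metric_space_sym_maps)
  fix \<xi> :: "'a list \<Rightarrow> 'b" and \<epsilon> :: real assume \<xi>: "\<xi> \<in> sym_maps k" and \<epsilon>: "0 < \<epsilon>"
  have "openin mtopology {x \<in> topspace mtopology. f x \<in> ball (f \<xi>) \<epsilon>}"
    using assms unfolding sym_topology_def
    by (rule openin_continuous_map_preimage) (simp flip: open_openin)
  moreover have "\<xi> \<in> {x \<in> topspace mtopology. f x \<in> ball (f \<xi>) \<epsilon>}" using \<xi> \<epsilon> by simp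
  ultimately obtain r where r: "0 < r" "mball \<xi> r \<subseteq> {x \<in> topspace mtopology. f x \<in> ball (f \<xi>) \<epsilon>}"
    unfolding openin_mtopology by blast
  show "\<exists>\<delta>>0. \<forall>\<eta>\<in>sym_maps k. mnorm k (\<lambda>vs. \<eta> vs - \<xi> vs) < \<delta> \<longrightarrow> \<bar>f \<eta> - f \<xi>\<bar> < \<epsilon>"
  proof (intro exI[of _ r] conjI ballI impI r(1))
    fix \<eta> assume \<eta>: "\<eta> \<in> sym_maps k" "mnorm k (\<lambda>vs. \<eta> vs - \<xi> vs) < r"
    then have "\<eta> \<in> mball \<xi> r"
      using \<xi> by (simp add: in_mball commute[of \<xi> \<eta>]) (simp add: sym_dist_def)
    then have "f \<eta> \<in> ball (f \<xi>) \<epsilon>" using r(2) by blast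
    then show "\<bar>f \<eta> - f \<xi>\<bar> < \<epsilon>" by (simp add: dist_real_def abs_minus_commute)
  qed
qed

lemma sym_continuousD:
  assumes "sym_continuous k f" "\<xi> \<in> sym_maps k" "0 < \<epsilon>"
  obtains \<delta> where "0 < \<delta>"
    "\<And>\<eta>. \<eta> \<in> sym_maps k \<Longrightarrow> mnorm k (\<lambda>vs. \<eta> vs - \<xi> vs) < \<delta> \<Longrightarrow> \<bar>f \<eta> - f \<xi>\<bar> < \<epsilon>"
  using assms unfolding sym_continuous_def by meson

lemma sym_continuous_sequentially:
  assumes f: "sym_continuous k f" and \<xi>: "\<xi> \<in> sym_maps k" "\<And>m. \<eta> m \<in> sym_maps k"
    and lim: "(\<lambda>m::nat. mnorm k (\<lambda>vs. \<eta> m vs - \<xi> vs)) \<longlonglongrightarrow> 0"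
  shows "(\<lambda>m. f (\<eta> m)) \<longlonglongrightarrow> f \<xi>"
proof (rule tendstoI)
  fix \<epsilon> :: real assume "0 < \<epsilon>"
  then obtain \<delta> where \<delta>: "0 < \<delta>"
    "\<And>\<eta>. \<eta> \<in> sym_maps k \<Longrightarrow> mnorm k (\<lambda>vs. \<eta> vs - \<xi> vs) < \<delta> \<Longrightarrow> \<bar>f \<eta> - f \<xi>\<bar> < \<epsilon>"
    using sym_continuousD[OF f \<xi>(1)] by metis
  have "\<forall>\<^sub>F m in sequentially. mnorm k (\<lambda>vs. \<eta> m vs - \<xi> vs) < \<delta>"
    using lim \<delta>(1) by (rule order_tendstoD(2))
  then show "\<forall>\<^sub>F m in sequentially. dist (f (\<eta> m)) (f \<xi>) < \<epsilon>"
    by (rule eventually_mono) (simp add: dist_real_def \<delta>(2) \<xi>(2))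
qed

text \<open>
  The hypotheses on the integrand that survive the minimum with an average of translates. The
  constant \<open>K\<close> absorbs the translations, which destroy homogeneity of the growth bound. Continuity
  and growth are asked for at every point, which a change of the integrand on a null set achieves.
\<close>

definition tame_integrand ::
    "nat \<Rightarrow> ('a::euclidean_space \<Rightarrow> real) \<Rightarrow> ('a \<Rightarrow> ('a list \<Rightarrow> 'b::euclidean_space) \<Rightarrow> real) \<Rightarrow> bool" where
  "tame_integrand k a G \<longleftrightarrow>
     (\<forall>\<xi>\<in>sym_maps k. (\<lambda>x. G x \<xi>) \<in> borel_measurable lebesgue) \<and>
     (\<forall>x. sym_continuous k (G x)) \<and>
     (\<exists>K\<ge>0. \<forall>x. \<forall>\<xi>\<in>sym_maps k. \<bar>G x \<xi>\<bar> \<le> \<bar>a x\<bar> * (K + mnorm k \<xi>))"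

lemma floor_approximation: "\<bar>real_of_int \<lfloor>real (Suc m) * c\<rfloor> / real (Suc m) - c\<bar> \<le> 1 / real (Suc m)"
proof -
  have "\<bar>real_of_int \<lfloor>real (Suc m) * c\<rfloor> - real (Suc m) * c\<bar> \<le> 1" by linarith
  then have "\<bar>(real_of_int \<lfloor>real (Suc m) * c\<rfloor> - real (Suc m) * c) / real (Suc m)\<bar> \<le> 1 / real (Suc m)"
    unfolding abs_divide by (simp add: divide_right_mono)
  moreover have "(y - real (Suc m) * c) / real (Suc m) = y / real (Suc m) - c" for y
    by (simp add: diff_divide_distrib del: of_nat_Suc)
  ultimately show ?thesis by (simp only:)
qed

lemma coordinate_approximation:
  fixes E :: "nat \<Rightarrow> 'a::euclidean_space list \<Rightarrow> 'b::euclidean_space"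
  assumes E: "\<And>i. E i \<in> sym_maps k" and c: "\<And>m i. \<bar>c' m i - c i\<bar> \<le> 1 / real (Suc m)"
  shows "(\<lambda>m. mnorm k (\<lambda>us. (\<Sum>i<d. c' m i *\<^sub>R E i us) - (\<Sum>i<d. c i *\<^sub>R E i us))) \<longlonglongrightarrow> 0"
proof (rule Lim_null_comparison)
  define B where "B = (\<Sum>i<d. mnorm k (E i))"
  have nn: "0 \<le> mnorm k (E i)" for i by (rule mnorm_nonneg[OF sym_maps_multilinear[OF E]])
  have "norm (mnorm k (\<lambda>us. (\<Sum>i<d. c' m i *\<^sub>R E i us) - (\<Sum>i<d. c i *\<^sub>R E i us)))
      \<le> 1 / real (Suc m) * B" for m
  proof -
    have eq: "(\<lambda>us. (\<Sum>i<d. c' m i *\<^sub>R E i us) - (\<Sum>i<d. c i *\<^sub>R E i us))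
        = (\<lambda>us. \<Sum>i<d. (c' m i - c i) *\<^sub>R E i us)"
      by (simp add: sum_subtractf scaleR_diff_left)
    have "mnorm k (\<lambda>us. \<Sum>i<d. (c' m i - c i) *\<^sub>R E i us) \<le> (\<Sum>i<d. \<bar>c' m i - c i\<bar> * mnorm k (E i))"
      by (intro mnorm_sum E)
    also have "\<dots> \<le> (\<Sum>i<d. 1 / real (Suc m) * mnorm k (E i))"
      by (intro sum_mono mult_right_mono c nn)
    also have "\<dots> = 1 / real (Suc m) * B" by (simp add: B_def sum_distrib_left)
    finally show ?thesis
      unfolding eq
      using mnorm_nonneg[OF sym_maps_multilinear[OF sym_maps_sum[of "{..<d}" E k "\<lambda>i. c' m i
          - c i"]]] E by simp
  qed
  then show "\<forall>\<^sub>F m in sequentially. norm (mnorm k (\<lambda>us. (\<Sum>i<d. c' m i *\<^sub>R E i us)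
      - (\<Sum>i<d. c i *\<^sub>R E i us)))
      \<le> 1 / real (Suc m) * B" by simp
  have "(\<lambda>m. 1 / real (Suc m)) \<longlonglongrightarrow> 0"
    using LIMSEQ_inverse_real_of_nat by (simp add: inverse_eq_divide)
  then show "(\<lambda>m. 1 / real (Suc m) * B) \<longlonglongrightarrow> 0" by (rule tendsto_mult_left_zero)
qed

text \<open>
  Rounding the coordinates of the field to multiples of \<open>1 / (m + 1)\<close> leaves countably many values,
  and along a field with countably many values measurability in \<open>x\<close> for each fixed value is enough.
  Continuity in the second argument handles the limit \<open>m \<longlonglongrightarrow> \<infinity>\<close>.
\<close>

lemma tame_integrand_measurable_along:
  fixes G :: "'a::euclidean_space \<Rightarrow> ('a list \<Rightarrow> 'b::euclidean_space) \<Rightarrow> real"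
  assumes G: "tame_integrand k a G" and \<xi>: "\<And>x. \<xi> x \<in> sym_maps k"
    and meas: "\<And>vs. (\<lambda>x. \<xi> x vs) \<in> borel_measurable lebesgue"
  shows "(\<lambda>x. G x (\<xi> x)) \<in> borel_measurable lebesgue"
proof -
  obtain d :: nat and t and bs :: "nat \<Rightarrow> 'a list" and v and w :: "nat \<Rightarrow> 'b"
    where *: "(\<forall>i<d. length (bs i) = k) \<and> (\<forall>\<xi>\<in>sym_maps k. \<forall>us.
        \<xi> us = (\<Sum>i<d. (t i * (\<xi> (bs i) \<bullet> w i)) *\<^sub>R rank1 k (v i) (w i) us))"
    using sym_maps_sum_rank1[of k, where 'a = 'a and 'b = 'b] by (elim exE)
  define c where "c x i = t i * (\<xi> x (bs i) \<bullet> w i)" for x i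
  define E where "E i = rank1 k (v i) (w i)" for i
  have E: "E i \<in> sym_maps k" for i unfolding E_def by (rule rank1_sym_maps)
  have rep: "\<xi> x = (\<lambda>us. \<Sum>i<d. c x i *\<^sub>R E i us)" for x
    using conjunct2[OF *, rule_format, OF \<xi>] unfolding c_def E_def by (rule ext)
  have c_meas: "(\<lambda>x. c x i) \<in> borel_measurable lebesgue" for i
    unfolding c_def using meas by measurable
  define c' where "c' m x i = real_of_int \<lfloor>real (Suc m) * c x i\<rfloor> / real (Suc m)" for m x i
  define \<eta> where "\<eta> m x = (\<lambda>us. \<Sum>i<d. c' m x i *\<^sub>R E i us)" for m x
  have \<eta>: "\<eta> m x \<in> sym_maps k" for m x unfolding \<eta>_def by (intro sym_maps_sum E)
  show ?thesis
  proof (rule borel_measurable_LIMSEQ_real)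
    fix x
    have "(\<lambda>m. mnorm k (\<lambda>us. \<eta> m x us - \<xi> x us)) \<longlonglongrightarrow> 0"
      unfolding \<eta>_def rep
      by (intro coordinate_approximation E) (unfold c'_def, rule floor_approximation)
    moreover have "sym_continuous k (G x)" using G by (simp add: tame_integrand_def)
    ultimately show "(\<lambda>m. G x (\<eta> m x)) \<longlonglongrightarrow> G x (\<xi> x)"
      by (intro sym_continuous_sequentially[of k "G x" "\<xi> x" "\<lambda>m. \<eta> m x"] \<xi> \<eta>)
  next
    fix m
    define z where "z x = map (\<lambda>i. \<lfloor>real (Suc m) * c x i\<rfloor>) [0..<d]" for x
    have z: "z x ! i = \<lfloor>real (Suc m) * c x i\<rfloor>" if "i < d" for x i
      unfolding z_def using that by simp
    have eq: "\<eta> m x = (\<lambda>us. \<Sum>i<d. (real_of_int (z x ! i) / real (Suc m)) *\<^sub>R E i us)" for x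
      unfolding \<eta>_def c'_def by (intro ext sum.cong refl) (simp only: z lessThan_iff)
    have "(\<lambda>x. G x (\<lambda>us. \<Sum>i<d. (real_of_int (z x ! i) / real (Suc m)) *\<^sub>R E i us))
        \<in> borel_measurable lebesgue"
    proof (rule measurable_compose_countable[where g = z and
          f = "\<lambda>zs x. G x (\<lambda>us. \<Sum>i<d. (real_of_int (zs ! i) / real (Suc m)) *\<^sub>R E i us)"])
      fix zs :: "int list"
      have "(\<lambda>us. \<Sum>i<d. (real_of_int (zs ! i) / real (Suc m)) *\<^sub>R E i us) \<in> sym_maps k"
        by (intro sym_maps_sum E)
      then show "(\<lambda>x. G x (\<lambda>us. \<Sum>i<d. (real_of_int (zs ! i) / real (Suc m)) *\<^sub>R E i us))
          \<in> borel_measurable lebesgue"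
        using G by (simp add: tame_integrand_def)
    next
      have "z -` {zs} \<in> sets lebesgue" for zs
      proof (cases "length zs = d")
        case True
        have "z -` {zs} = {x \<in> space lebesgue. \<forall>i\<in>{..<d}. \<lfloor>real (Suc m) * c x i\<rfloor> = zs ! i}"
        proof -
          have "z x = zs \<longleftrightarrow> (\<forall>i\<in>{..<d}. \<lfloor>real (Suc m) * c x i\<rfloor> = zs ! i)" for x
          proof -
            have "length (z x) = d" by (simp add: z_def)
            then show ?thesis
              unfolding list_eq_iff_nth_eq[of "z x" zs] Ball_def lessThan_iff using True z by metis
          qed
          then show ?thesis by (simp only: vimage_def singleton_iff space_completion space_lborel
              space_borel UNIV_I simp_thms)
        qed
        also have "\<dots> \<in> sets lebesgue"
        proof (rule sets.sets_Collect_finite_All)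
          fix i
          have [measurable]: "(\<lambda>x. c x i) \<in> borel_measurable lebesgue" by (rule c_meas)
          show "{x \<in> space lebesgue. \<lfloor>real (Suc m) * c x i\<rfloor> = zs ! i} \<in> sets lebesgue"
            by measurable
        qed auto
        finally show ?thesis .
      next
        case False
        then have "z -` {zs} = {}" by (auto simp: z_def)
        then show ?thesis by simp
      qed
      then show "z \<in> lebesgue \<rightarrow>\<^sub>M count_space UNIV"
        by (simp add: measurable_count_space_eq2_countable)
    qed
    then show "(\<lambda>x. G x (\<eta> m x)) \<in> borel_measurable lebesgue" unfolding eq .
  qed
qed

lemma Dk_measurable:
  fixes \<phi> :: "'a::euclidean_space \<Rightarrow> 'b::euclidean_space"
  assumes "smooth \<phi>"
  shows "(\<lambda>x. Dk k \<phi> x vs) \<in> borel_measurable lebesgue"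
proof -
  have "continuous_on UNIV (\<lambda>x. Dk k \<phi> x vs)"
    unfolding Dk_def using smooth_iter_deriv_continuous[OF assms] by (cases "length vs = k") auto
  then have "(\<lambda>x. Dk k \<phi> x vs) \<in> borel_measurable borel"
    by (rule borel_measurable_continuous_onI)
  then show ?thesis by (simp add: measurable_completion)
qed

lemma Dk_bounded:
  fixes \<phi> :: "'a::euclidean_space \<Rightarrow> 'b::euclidean_space"
  assumes \<phi>: "smooth \<phi>" "vanishes_beyond R \<phi>"
  shows "\<exists>B\<ge>0. \<forall>x. mnorm k (Dk k \<phi> x) \<le> B"
proof -
  obtain d :: nat and bs :: "nat \<Rightarrow> 'a list" and K where K: "0 \<le> K"
    and mn: "\<forall>\<xi>::'a list \<Rightarrow> 'b. \<xi> \<in> sym_maps k \<longrightarrow> mnorm k \<xi> \<le> K * (\<Sum>i<d. norm (\<xi> (bs i)))"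
    using mnorm_le_finitely_many_values[of k, where 'a = 'a and 'b = 'b] by (elim exE conjE)
  have "\<exists>B. \<forall>x. norm (iter_deriv \<phi> vs x) \<le> B" for vs
    by (rule vanishes_beyond_bounded[OF vanishes_beyond_iter_deriv[OF \<phi>]
        smooth_iter_deriv_continuous[OF \<phi>(1)]])
  then obtain B where B: "\<And>vs x. norm (iter_deriv \<phi> vs x) \<le> B vs" by metis
  have B0: "0 \<le> B vs" for vs using order_trans[OF norm_ge_zero B] .
  have "norm (Dk k \<phi> x vs) \<le> B vs" for x vs using B B0 by (simp add: Dk_def)
  then have "mnorm k (Dk k \<phi> x) \<le> K * (\<Sum>i<d. B (bs i))" for x
    by (intro order_trans[OF mn[rule_format, OF Dk_sym_maps[OF \<phi>(1)]]] mult_left_mono K sum_mono)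
  moreover have "0 \<le> K * (\<Sum>i<d. B (bs i))" by (intro mult_nonneg_nonneg K sum_nonneg B0)
  ultimately show ?thesis by blast
qed

lemma indicator_cball_measurable:
  "(indicator (cball 0 R) :: 'a::euclidean_space \<Rightarrow> real) \<in> borel_measurable lebesgue"
  by (rule borel_measurable_indicator[OF fmeasurableD[OF lmeasurable_cball]])

lemma locally_integrable_dominating:
  fixes a :: "'a::euclidean_space \<Rightarrow> real"
  assumes "locally_integrable a"
  shows "integrable lebesgue (\<lambda>x. indicator (cball 0 R) x * (\<bar>a x\<bar> * C))"
proof -
  have "a absolutely_integrable_on cball 0 R"
    using assms by (simp add: locally_integrable_def)
  then have "integrable lebesgue (\<lambda>x. indicator (cball 0 R) x *\<^sub>R a x)"
    by (simp add: set_integrable_def)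
  then have "integrable lebesgue (\<lambda>x. \<bar>indicator (cball 0 R) x *\<^sub>R a x\<bar> * C)"
    by (intro integrable_mult_left integrable_abs)
  moreover have "(\<lambda>x. \<bar>indicator (cball 0 R) x *\<^sub>R a x\<bar> * C)
      = (\<lambda>x. indicator (cball 0 R) x * (\<bar>a x\<bar> * C))"
    by (auto simp: fun_eq_iff indicator_def)
  ultimately show ?thesis by (simp only:)
qed

lemma tame_integrand_integrable:
  fixes G :: "'a::euclidean_space \<Rightarrow> ('a list \<Rightarrow> 'b::euclidean_space) \<Rightarrow> real"
  assumes G: "tame_integrand k a G" and a: "locally_integrable a"
    and \<xi>: "\<And>x. \<xi> x \<in> sym_maps k" "\<And>vs. (\<lambda>x. \<xi> x vs) \<in> borel_measurable lebesgue"
      "\<And>x. mnorm k (\<xi> x) \<le> B"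
  shows "integrable lebesgue (\<lambda>x. indicator (cball 0 R) x * G x (\<xi> x))"
proof -
  obtain K where K: "\<And>x \<xi>. \<xi> \<in> sym_maps k \<Longrightarrow> \<bar>G x \<xi>\<bar> \<le> \<bar>a x\<bar> * (K + mnorm k \<xi>)"
    using G unfolding tame_integrand_def by blast
  have "\<bar>G x (\<xi> x)\<bar> \<le> \<bar>a x\<bar> * (K + B)" for x
    by (intro order_trans[OF K[OF \<xi>(1)]] mult_left_mono add_left_mono \<xi>(3)) simp
  then have "norm (indicator (cball 0 R) x * G x (\<xi> x))
      \<le> norm (indicator (cball 0 R) x * (\<bar>a x\<bar> * (K + B)))" for x
    using order_trans[OF _ abs_ge_self] by (auto simp: indicator_def simp del: abs_mult)
  then show ?thesis
    by (intro Bochner_Integration.integrable_bound[OF locally_integrable_dominating[OF a, of R "K + B"]]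
        AE_I2 borel_measurable_times indicator_cball_measurable tame_integrand_measurable_along[OF G
            \<xi>(1,2)])
qed

lemma dominated_limit_nonneg:
  fixes a :: "'a::euclidean_space \<Rightarrow> real"
  assumes a: "locally_integrable a"
    and meas: "\<And>m::nat. s m \<in> borel_measurable lebesgue" "T \<in> borel_measurable lebesgue"
    and bound: "\<And>m x. \<bar>s m x\<bar> \<le> \<bar>a x\<bar> * C"
    and lim: "AE x in lebesgue. x \<in> cball 0 R \<longrightarrow> (\<lambda>m. s m x) \<longlonglongrightarrow> T x"
    and nonneg: "\<And>m. 0 \<le> (LINT x|lebesgue. indicator (cball 0 R) x * s m x)"
  shows "0 \<le> (LINT x|lebesgue. indicator (cball 0 R) x * T x)"
proof -
  have "(\<lambda>m. LINT x|lebesgue. indicator (cball 0 R) x * s m x) \<longlonglongrightarrow> (LINT x|lebesgue. indicator (cball 0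
      R) x * T x)"
  proof (rule integral_dominated_convergence[where w = "\<lambda>x. indicator (cball 0 R) x * (\<bar>a x\<bar> * C)"])
    show "AE x in lebesgue. (\<lambda>m. indicator (cball 0 R) x * s m x) \<longlonglongrightarrow> indicator (cball 0 R) x * T x"
      using lim by eventually_elim (auto simp: indicator_def)
    show "AE x in lebesgue. norm (indicator (cball 0 R) x * s m x)
        \<le> indicator (cball 0 R) x * (\<bar>a x\<bar> * C)" for m
      using bound by (intro AE_I2) (simp add: indicator_def)
  qed (intro borel_measurable_times indicator_cball_measurable meas locally_integrable_dominating[OF
      a])+
  then show ?thesis by (rule LIMSEQ_le_const) (use nonneg in auto)
qed

text \<open>
  The integral is restricted to the ball because an integrand produced by an average of translates
  may be nonzero, and not integrable over the whole space, where the derivative of the test map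
  vanishes.
\<close>

definition nonneg_on_tests ::
    "nat \<Rightarrow> real \<Rightarrow> ('a::euclidean_space \<Rightarrow> ('a list \<Rightarrow> 'b::euclidean_space) \<Rightarrow> real) \<Rightarrow> bool" where
  "nonneg_on_tests k R G \<longleftrightarrow> (\<forall>\<phi>. smooth \<phi> \<longrightarrow> vanishes_beyond R \<phi> \<longrightarrow>
     0 \<le> (LINT x|lebesgue. indicator (cball 0 R) x * G x (Dk k \<phi> x)))"

section \<open>Two-point averages of the integrand\<close>

lemma sin_ge_of_between:
  assumes "0 \<le> \<alpha>" "\<alpha> \<le> x" "x \<le> pi - \<alpha>"
  shows "sin \<alpha> \<le> sin x"
proof (cases "x \<le> pi / 2")
  case True
  then show ?thesis using assms by (intro sin_monotone_2pi_le) auto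
next
  case False
  then have "sin \<alpha> \<le> sin (pi - x)" using assms by (intro sin_monotone_2pi_le) auto
  then show ?thesis by simp
qed

text \<open>
  If two of the equally spaced phases were bad, the sine of their difference would be smaller than
  \<open>sin (pi / q)\<close>; but the difference lies between \<open>pi / q\<close> and \<open>pi - pi / q\<close>.
\<close>

lemma at_most_one_bad_shift:
  "card {j. j < q \<and> \<bar>cos (t + pi * real j / real q)\<bar> < sin (pi / real q) / 2} \<le> 1" (is "card ?B \<le> 1")
proof -
  have no: False if ij: "i < j" and i: "i \<in> ?B" and j: "j \<in> ?B" for i j
  proof -
    let ?a = "t + pi * real i / real q" and ?b = "t + pi * real j / real q"
    have q: "0 < q" "j < q" using j by auto
    have diff: "?b - ?a = pi * real (j - i) / real q"
      using ij by (simp add: of_nat_diff right_diff_distrib diff_divide_distrib)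
    have r: "1 \<le> real (j - i)" "real (j - i) \<le> real q - 1" using ij q by linarith+
    have "pi * 1 / real q \<le> pi * real (j - i) / real q" "pi * real (j - i) / real q
        \<le> pi * (real q - 1) / real q"
      by (intro divide_right_mono mult_left_mono r; simp)+
    moreover have "pi * (real q - 1) / real q = pi - pi / real q"
      using q by (simp add: right_diff_distrib diff_divide_distrib)
    ultimately have "pi / real q \<le> ?b - ?a" "?b - ?a \<le> pi - pi / real q"
      unfolding diff by (simp_all only: mult_1_right)
    then have "sin (pi / real q) \<le> sin (?b - ?a)" by (intro sin_ge_of_between) auto
    also have "\<dots> = sin ?b * cos ?a - cos ?b * sin ?a" by (rule sin_diff)
    also have "\<dots> \<le> \<bar>cos ?a\<bar> + \<bar>cos ?b\<bar>"
    proof -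
      have "\<bar>sin ?b * cos ?a\<bar> \<le> 1 * \<bar>cos ?a\<bar>" "\<bar>cos ?b * sin ?a\<bar> \<le> \<bar>cos ?b\<bar> * 1"
        unfolding abs_mult by (intro mult_mono abs_sin_le_one order_refl; simp)+
      then show ?thesis by linarith
    qed
    also have "\<dots> < sin (pi / real q)" using i j by simp
    finally show False by simp
  qed
  have "i = j" if "i \<in> ?B" "j \<in> ?B" for i j
    using no[of i j] no[of j i] that by (cases i j rule: linorder_cases) blast+
  then have "card ?B \<le> Suc 0" by (subst card_le_Suc0_iff_eq) auto
  then show ?thesis by simp
qed

lemma mnorm_diff_le:
  fixes \<xi> \<eta> :: "'a::euclidean_space list \<Rightarrow> 'b::real_normed_vector"
  assumes "\<xi> \<in> sym_maps k" "\<eta> \<in> sym_maps k"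
  shows "mnorm k \<xi> \<le> mnorm k \<eta> + mnorm k (\<lambda>vs. \<xi> vs - \<eta> vs)"
  using mnorm_add[OF assms(2) sym_maps_diff[OF assms]] by simp

text \<open>
  Perturb \<open>\<phi>\<close> by oscillations whose \<open>k\<close>-th derivative is close to \<open>\<rho>(x) u(M (v \<bullet> x) + s)\<close> times
  \<open>v\<^sup>k \<otimes> w\<close>, where \<open>u\<close> is nearly \<open>\<plusminus>1\<close>-valued, and average over \<open>q\<close> equally spaced phases \<open>s\<close> in a
  half period together with their translates by \<open>pi\<close>. For a good phase the two translates contribute
  the two points \<open>\<plusminus>\<rho>(x)\<close>, in one order or the other, and at each \<open>x\<close> at most one phase in \<open>q\<close> is
  bad. So the averaged integrands converge pointwise as \<open>q \<longlonglongrightarrow> \<infinity>\<close>, and dominated convergence applies.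
\<close>

lemma two_point_average_nonneg:
  fixes G :: "'a::euclidean_space \<Rightarrow> ('a list \<Rightarrow> 'b::euclidean_space) \<Rightarrow> real" and v :: 'a and w :: 'b
  assumes G: "tame_integrand k a G" and a: "locally_integrable a" and test: "nonneg_on_tests k R G"
    and \<rho>: "smooth_alg R \<rho>" "vanishes_beyond R \<rho>" and \<phi>: "smooth \<phi>" "vanishes_beyond R \<phi>"
  shows "0 \<le> (LINT x|lebesgue. indicator (cball 0 R) x *
    ((G x (\<lambda>vs. Dk k \<phi> x vs + \<rho> x *\<^sub>R rank1 k v w vs)
        + G x (\<lambda>vs. Dk k \<phi> x vs - \<rho> x *\<^sub>R rank1 k v w vs)) / 2))"
proof -
  define e where "e = rank1 k v w"
  have e: "e \<in> sym_maps k" unfolding e_def by (rule rank1_sym_maps)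
  define me where "me = mnorm k e"
  have me: "0 \<le> me" unfolding me_def by (rule mnorm_nonneg[OF sym_maps_multilinear[OF e]])
  obtain K where K0: "0 \<le> K" and K: "\<And>x \<xi>. \<xi> \<in> sym_maps k \<Longrightarrow> \<bar>G x \<xi>\<bar> \<le> \<bar>a x\<bar> * (K + mnorm k \<xi>)"
    using G unfolding tame_integrand_def by blast
  obtain B where B0: "0 \<le> B" and B: "\<And>x. mnorm k (Dk k \<phi> x) \<le> B" using Dk_bounded[OF \<phi>] by blast
  obtain S where S: "\<And>x. \<bar>\<rho> x\<bar> \<le> S"
    using vanishes_beyond_bounded[OF \<rho>(2) smooth_alg_continuous[OF \<rho>(1)]] by auto
  have S0: "0 \<le> S" using order_trans[OF abs_ge_zero S] .
  \<comment> \<open>\<open>\<bar>a x\<bar> * C\<close> dominates all integrands below, as the waves are at most \<open>2\<close> and the errors at most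
      \<open>1\<close>\<close>
  define C where "C = K + (B + (2 * S * me + 1))"
  \<comment> \<open>the number of phases; at least two, so that \<open>sin (pi / q)\<close> is positive\<close>
  define q where "q m = real (m + 2)" for m :: nat
  have q: "1 \<le> q m" "0 < q m" "2 \<le> q m" for m by (simp_all add: q_def)
  have waves: "\<forall>m. \<exists>u M \<psi>. odd_wave u \<and> (\<forall>s. \<bar>u s\<bar> \<le> 1 + 1 / q m) \<and>
      (\<forall>s. sin (pi / q m) / 2 \<le> \<bar>cos s\<bar> \<longrightarrow> \<bar>\<bar>u s\<bar> - 1\<bar> \<le> 1 / q m) \<and>
      (\<forall>s. near_oscillation k R (\<lambda>x. \<rho> x * u (M * (v \<bullet> x) + s)) e (1 / q m) (\<psi> s))"
  proof (rule allI)
    fix m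
    have "pi / q m < pi" using q(3)[of m] by (simp add: divide_less_eq)
    then have "0 < sin (pi / q m) / 2" using q(2)[of m] by (simp add: sin_gt_zero)
    then obtain u where u: "odd_wave u" "\<forall>s. \<bar>u s\<bar> \<le> 1 + 1 / q m"
      "\<forall>s. sin (pi / q m) / 2 \<le> \<bar>cos s\<bar> \<longrightarrow> \<bar>\<bar>u s\<bar> - 1\<bar> \<le> 1 / q m"
      using exists_almost_square_wave[of "sin (pi / q m) / 2" "1 / q m"] q(2)[of m] by auto
    have "0 < 1 / q m" using q(2)[of m] by simp
    from oscillating_perturbation[OF \<rho> u(1) this, of k v w] obtain M where
      "\<forall>s. \<exists>\<psi>::'a \<Rightarrow> 'b.
      near_oscillation k R (\<lambda>x. \<rho> x * u (M * (v \<bullet> x) + s)) e (1 / q m) \<psi>"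
      unfolding e_def by blast
    from choice[OF this] u show "\<exists>u M \<psi>. odd_wave u \<and> (\<forall>s. \<bar>u s\<bar> \<le> 1 + 1 / q m) \<and>
      (\<forall>s. sin (pi / q m) / 2 \<le> \<bar>cos s\<bar> \<longrightarrow> \<bar>\<bar>u s\<bar> - 1\<bar> \<le> 1 / q m) \<and>
      (\<forall>s. near_oscillation k R (\<lambda>x. \<rho> x * u (M * (v \<bullet> x) + s)) e (1 / q m) (\<psi> s))"
      by blast
  qed
  from waves[unfolded choice_iff] obtain u M and \<psi> :: "nat \<Rightarrow> real \<Rightarrow> 'a \<Rightarrow> 'b"
    where W: "\<forall>m. odd_wave (u m) \<and> (\<forall>s. \<bar>u m s\<bar> \<le> 1 + 1 / q m) \<and>
      (\<forall>s. sin (pi / q m) / 2 \<le> \<bar>cos s\<bar> \<longrightarrow> \<bar>\<bar>u m s\<bar> - 1\<bar> \<le> 1 / q m) \<and>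
      (\<forall>s. near_oscillation k R (\<lambda>x. \<rho> x * u m (M m * (v \<bullet> x) + s)) e (1 / q m) (\<psi> m s))"
    by (elim exE)
  have wave: "odd_wave (u m)" and u_le: "\<bar>u m s\<bar> \<le> 1 + 1 / q m"
    and u_near: "sin (pi / q m) / 2 \<le> \<bar>cos s\<bar> \<Longrightarrow> \<bar>\<bar>u m s\<bar> - 1\<bar> \<le> 1 / q m"
    and \<psi>: "smooth (\<psi> m s)" "vanishes_beyond R (\<psi> m s)"
    and \<psi>_near: "mnorm k (\<lambda>vs. Dk k (\<psi> m s) x vs - (\<rho> x * u m (M m * (v \<bullet> x) + s)) *\<^sub>R e vs) \<le> 1 / q m"
    for m s x
    using W[rule_format, of m] by blast+
  define \<Phi> where "\<Phi> m s = (\<lambda>x. \<phi> x + \<psi> m s x)" for m s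
  have \<Phi>: "smooth (\<Phi> m s)" "vanishes_beyond R (\<Phi> m s)" for m s
    unfolding \<Phi>_def using smooth_add(1)[OF \<phi>(1) \<psi>(1)] \<phi>(2) \<psi>(2)[of m s]
    by (auto simp: vanishes_beyond_def)
  note D\<Phi> = Dk_sym_maps[OF \<Phi>(1)] and D\<phi> = Dk_sym_maps[OF \<phi>(1)]
  have target: "(\<lambda>vs. Dk k \<phi> x vs + y *\<^sub>R e vs) \<in> sym_maps k" for x y
    by (intro sym_maps_add sym_maps_scale D\<phi> e)
  \<comment> \<open>\<open>y = 0\<close> bounds the derivative, \<open>y = \<plusminus>\<rho> x\<close> compares it with the two target points\<close>
  have near: "mnorm k (\<lambda>vs. Dk k (\<Phi> m s) x vs - (Dk k \<phi> x vs + y *\<^sub>R e vs))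
      \<le> \<bar>\<rho> x * u m (M m * (v \<bullet> x) + s) - y\<bar> * me + 1 / q m" for m s x y
  proof -
    let ?z = "\<rho> x * u m (M m * (v \<bullet> x) + s)"
    have eq: "(\<lambda>vs. Dk k (\<Phi> m s) x vs - (Dk k \<phi> x vs + y *\<^sub>R e vs))
        = (\<lambda>vs. (?z - y) *\<^sub>R e vs + (Dk k (\<psi> m s) x vs - ?z *\<^sub>R e vs))"
      unfolding \<Phi>_def Dk_def smooth_add(2)[OF \<phi>(1) \<psi>(1)] by (auto simp: fun_eq_iff scaleR_diff_left)
    have "mnorm k (\<lambda>vs. (?z - y) *\<^sub>R e vs + (Dk k (\<psi> m s) x vs - ?z *\<^sub>R e vs))
        \<le> mnorm k (\<lambda>vs. (?z - y) *\<^sub>R e vs) + mnorm k (\<lambda>vs. Dk k (\<psi> m s) x vs - ?z *\<^sub>R e vs)"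
      by (intro mnorm_add sym_maps_scale sym_maps_diff e Dk_sym_maps \<psi>)
    also have "\<dots> \<le> \<bar>?z - y\<bar> * me + 1 / q m"
      unfolding me_def by (intro add_mono mnorm_scale_le e \<psi>_near)
    finally show ?thesis unfolding eq .
  qed
  have u_le2: "\<bar>u m s\<bar> \<le> 2" for m s
  proof -
    have "1 / q m \<le> 1" using q[of m] by simp
    then show ?thesis using u_le[of m s] by linarith
  qed
  have \<Phi>_bound: "mnorm k (Dk k (\<Phi> m s) x) \<le> B + (2 * S * me + 1)" for m s x
  proof -
    let ?z = "\<rho> x * u m (M m * (v \<bullet> x) + s)"
    have "\<bar>?z\<bar> \<le> S * 2" unfolding abs_mult by (intro mult_mono S u_le2 S0 abs_ge_zero)
    then have "\<bar>?z\<bar> * me \<le> 2 * S * me" using me by (intro mult_right_mono) auto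
    moreover have "1 / q m \<le> 1" using q[of m] by simp
    moreover have "mnorm k (Dk k (\<Phi> m s) x) \<le> mnorm k (Dk k \<phi> x)
        + mnorm k (\<lambda>vs. Dk k (\<Phi> m s) x vs - Dk k \<phi> x vs)"
      by (rule mnorm_diff_le[OF D\<Phi> D\<phi>])
    moreover have "mnorm k (\<lambda>vs. Dk k (\<Phi> m s) x vs - Dk k \<phi> x vs) \<le> \<bar>?z\<bar> * me + 1 / q m"
      using near[of m s x 0] by simp
    ultimately show ?thesis using B[of x] by linarith
  qed
  have G_bound: "\<bar>G x (Dk k (\<Phi> m s) x)\<bar> \<le> \<bar>a x\<bar> * C" for m s x
    unfolding C_def by (intro order_trans[OF K[OF D\<Phi>]] mult_left_mono add_left_mono \<Phi>_bound abs_ge_zero)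
  have target_bound: "\<bar>G x (\<lambda>vs. Dk k \<phi> x vs + y *\<^sub>R e vs)\<bar> \<le> \<bar>a x\<bar> * C" if "\<bar>y\<bar> \<le> S" for x y
  proof -
    have "mnorm k (\<lambda>vs. Dk k \<phi> x vs + y *\<^sub>R e vs) \<le> mnorm k (Dk k \<phi> x) + \<bar>y\<bar> * me"
      unfolding me_def by (intro order_trans[OF mnorm_add add_mono] sym_maps_scale D\<phi> e order_refl
          mnorm_scale_le)
    also have "\<dots> \<le> B + (2 * S * me + 1)"
      using B[of x] mult_right_mono[OF that me] mult_nonneg_nonneg[OF S0 me] by linarith
    finally show ?thesis
      unfolding C_def by (intro order_trans[OF K[OF target]] mult_left_mono add_left_mono) auto
  qed
  define s where "s m j = pi * real j / q m" for m j :: nat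
  define H where "H m x = (\<Sum>j<m + 2. G x (Dk k (\<Phi> m (s m j)) x) + G x (Dk k (\<Phi> m (s m j
      + pi)) x)) / (2 * q m)" for m x
  define T where "T x = (G x (\<lambda>vs. Dk k \<phi> x vs + \<rho> x *\<^sub>R e vs) + G x (\<lambda>vs. Dk k \<phi> x vs
      + (- \<rho> x) *\<^sub>R e vs)) / 2" for x
  have int: "integrable lebesgue (\<lambda>x. indicator (cball 0 R) x * G x (Dk k (\<Phi> m t) x))" for m t
    by (rule tame_integrand_integrable[OF G a D\<Phi> Dk_measurable[OF \<Phi>(1)] \<Phi>_bound])
  have G_meas: "(\<lambda>x. G x (Dk k (\<Phi> m t) x)) \<in> borel_measurable lebesgue" for m t
    by (rule tame_integrand_measurable_along[OF G D\<Phi> Dk_measurable[OF \<Phi>(1)]])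
  have "0 \<le> (LINT x|lebesgue. indicator (cball 0 R) x * T x)"
  proof (rule dominated_limit_nonneg[OF a, where s = H and C = C])
    show "H m \<in> borel_measurable lebesgue" for m
      unfolding H_def by (intro borel_measurable_divide borel_measurable_sum borel_measurable_add
          G_meas) simp
    have \<rho>_meas: "\<rho> \<in> borel_measurable lebesgue"
      using borel_measurable_continuous_onI[OF smooth_alg_continuous[OF \<rho>(1)]]
      by (simp add: measurable_completion)
    have "(\<lambda>x. G x (\<lambda>vs. Dk k \<phi> x vs + (c * \<rho> x) *\<^sub>R e vs)) \<in> borel_measurable lebesgue" for c
      by (intro tame_integrand_measurable_along[OF G target] borel_measurable_add
          borel_measurable_scaleR
          borel_measurable_times Dk_measurable \<phi> \<rho>_meas borel_measurable_const)
    from this[of 1] this[of "- 1"] show "T \<in> borel_measurable lebesgue"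
      unfolding T_def by simp
    show "\<bar>H m x\<bar> \<le> \<bar>a x\<bar> * C" for m x
    proof -
      have "\<bar>\<Sum>j<m + 2. G x (Dk k (\<Phi> m (s m j)) x) + G x (Dk k (\<Phi> m (s m j + pi)) x)\<bar>
          \<le> (\<Sum>j<m + 2. \<bar>a x\<bar> * C + \<bar>a x\<bar> * C)"
        by (rule order_trans[OF sum_abs sum_mono[OF order_trans[OF abs_triangle_ineq add_mono]]])
            (rule G_bound)+
      also have "\<dots> = (\<bar>a x\<bar> * C) * (2 * q m)" by (simp add: q_def algebra_simps)
      finally show ?thesis using q(2)[of m] by
          (simp add: H_def abs_divide pos_divide_le_eq del: sum.lessThan_Suc)
    qed
    show "0 \<le> (LINT x|lebesgue. indicator (cball 0 R) x * H m x)" for m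
    proof -
      have "(LINT x|lebesgue. indicator (cball 0 R) x * H m x)
          = (LINT x|lebesgue. (\<Sum>j<m + 2. indicator (cball 0 R) x * G x (Dk k (\<Phi> m (s m j)) x)
              + indicator (cball 0 R) x * G x (Dk k (\<Phi> m (s m j + pi)) x)) / (2 * q m))"
        by (simp only: H_def times_divide_eq_right sum_distrib_left distrib_left)
      also have "\<dots> = (\<Sum>j<m + 2. (LINT x|lebesgue. indicator (cball 0 R) x * G x (Dk k (\<Phi> m (s m j)) x))
              + (LINT x|lebesgue. indicator (cball 0 R) x * G x (Dk k (\<Phi> m (s m j
                  + pi)) x))) / (2 * q m)"
        by (simp only: integral_divide_zero Bochner_Integration.integral_sum
            Bochner_Integration.integrable_add
            Bochner_Integration.integral_add int)
      also have "\<dots> \<ge> 0"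
        using test \<Phi> q(2)[of m] unfolding nonneg_on_tests_def
        by (intro divide_nonneg_nonneg sum_nonneg add_nonneg_nonneg) auto
      finally show ?thesis .
    qed
    show "AE x in lebesgue. x \<in> cball 0 R \<longrightarrow> (\<lambda>m. H m x) \<longlonglongrightarrow> T x"
    proof (intro AE_I2 impI tendstoI)
      fix x and \<epsilon> :: real assume \<epsilon>: "0 < \<epsilon>"
      have cont: "sym_continuous k (G x)" using G by (simp add: tame_integrand_def)
      let ?A = "\<lambda>y. G x (\<lambda>vs. Dk k \<phi> x vs + y *\<^sub>R e vs)"
      have \<epsilon>4: "0 < \<epsilon> / 4" using \<epsilon> by simp
      obtain \<delta>1 where \<delta>1: "0 < \<delta>1" "\<And>\<eta>. \<eta> \<in> sym_maps k \<Longrightarrow>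
          mnorm k (\<lambda>vs. \<eta> vs - (Dk k \<phi> x vs + \<rho> x *\<^sub>R e vs)) < \<delta>1 \<Longrightarrow> \<bar>G x \<eta> - ?A (\<rho> x)\<bar> < \<epsilon> / 4"
        using sym_continuousD[OF cont target \<epsilon>4] by blast
      obtain \<delta>2 where \<delta>2: "0 < \<delta>2" "\<And>\<eta>. \<eta> \<in> sym_maps k \<Longrightarrow>
          mnorm k (\<lambda>vs. \<eta> vs - (Dk k \<phi> x vs + (- \<rho> x) *\<^sub>R e vs)) < \<delta>2 \<Longrightarrow> \<bar>G x \<eta> - ?A (- \<rho> x)\<bar> < \<epsilon> / 4"
        using sym_continuousD[OF cont target \<epsilon>4] by blast
      have q_lim: "(\<lambda>m. c / q m) \<longlonglongrightarrow> 0" for c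
      proof -
        have "(\<lambda>m. c * inverse (real (Suc m))) \<longlonglongrightarrow> c * 0"
          by (intro tendsto_mult tendsto_const LIMSEQ_inverse_real_of_nat)
        from LIMSEQ_Suc[OF this] show ?thesis by (simp add: q_def divide_inverse add_ac)
      qed
      have "\<forall>\<^sub>F m in sequentially. (S * me + 1) / q m < min \<delta>1 \<delta>2"
        by (rule order_tendstoD(2)[OF q_lim]) (use \<delta>1(1) \<delta>2(1) in simp)
      moreover have "\<forall>\<^sub>F m in sequentially. 2 * (\<bar>a x\<bar> * C) / q m < \<epsilon> / 2"
        by (rule order_tendstoD(2)[OF q_lim]) (use \<epsilon> in simp)
      ultimately show "\<forall>\<^sub>F m in sequentially. dist (H m x) (T x) < \<epsilon>"
      proof eventually_elim
        case (elim m)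
        define X where "X j = G x (Dk k (\<Phi> m (s m j)) x) + G x (Dk k (\<Phi> m (s m j
            + pi)) x) - 2 * T x" for j
        have "2 * (z / 2) = z" for z :: real by simp
        then have X_eq: "X j = G x (Dk k (\<Phi> m (s m j)) x) + G x (Dk k (\<Phi> m (s m j + pi)) x)
            - (?A (\<rho> x) + ?A (- \<rho> x))" for j
          unfolding X_def T_def by (simp only:)
        have close: "\<bar>p + p' - (y + y')\<bar> \<le> \<epsilon> / 2"
            if "\<bar>p - y\<bar> < \<epsilon> / 4" "\<bar>p' - y'\<bar> < \<epsilon> / 4" for p p' y y' :: real
          using that by linarith
        let ?bad = "\<lambda>j. \<bar>cos (M m * (v \<bullet> x) + pi * real j / real (m + 2))\<bar>
            < sin (pi / real (m + 2)) / 2"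
        have good: "\<bar>X j\<bar> \<le> \<epsilon> / 2" if "\<not> ?bad j" for j
        proof -
          let ?u = "u m (M m * (v \<bullet> x) + s m j)"
          have u1: "\<bar>\<bar>?u\<bar> - 1\<bar> \<le> 1 / q m"
            by (rule u_near) (use that in \<open>simp add: s_def q_def\<close>)
          have u2: "u m (M m * (v \<bullet> x) + (s m j + pi)) = - ?u"
            using odd_wave_antiperiodic[OF wave, of m "M m * (v \<bullet> x) + s m j"] by (simp add: add_ac)
          have small: "mnorm k (\<lambda>vs. Dk k (\<Phi> m t) x vs - (Dk k \<phi> x vs + (\<sigma> * \<rho> x) *\<^sub>R e vs))
              < min \<delta>1 \<delta>2"
            if "\<bar>u m (M m * (v \<bullet> x) + t) - \<sigma>\<bar> \<le> 1 / q m" for t \<sigma>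
          proof -
            have "\<rho> x * u m (M m * (v \<bullet> x) + t) - \<sigma> * \<rho> x = \<rho> x * (u m (M m * (v \<bullet> x) + t) - \<sigma>)"
              by (simp add: algebra_simps)
            then have "\<bar>\<rho> x * u m (M m * (v \<bullet> x) + t) - \<sigma> * \<rho> x\<bar> \<le> S * (1 / q m)"
              using S that S0 by (simp only: abs_mult) (intro mult_mono; simp)
            then have "\<bar>\<rho> x * u m (M m * (v \<bullet> x) + t) - \<sigma> * \<rho> x\<bar> * me \<le> S * (1 / q m) * me"
              using me by (rule mult_right_mono)
            then have "mnorm k (\<lambda>vs. Dk k (\<Phi> m t) x vs - (Dk k \<phi> x vs + (\<sigma> * \<rho> x) *\<^sub>R e vs))
                \<le> S * (1 / q m) * me + 1 / q m"
              using near[of m t x "\<sigma> * \<rho> x"] by linarith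
            also have "\<dots> = (S * me + 1) / q m" by (simp add: add_divide_distrib)
            finally show ?thesis using elim(1) by linarith
          qed
          show ?thesis
          proof (cases "0 \<le> ?u")
            case True
            then have "\<bar>?u - 1\<bar> \<le> 1 / q m" "\<bar>u m (M m * (v \<bullet> x) + (s m j + pi)) - (- 1)\<bar> \<le> 1 / q m"
              unfolding u2 using u1 by linarith+
            from small[OF this(1)] small[OF this(2)]
            have "\<bar>G x (Dk k (\<Phi> m (s m j)) x) - ?A (\<rho> x)\<bar>
                < \<epsilon> / 4" "\<bar>G x (Dk k (\<Phi> m (s m j + pi)) x) - ?A (- \<rho> x)\<bar> < \<epsilon> / 4"
              by (intro \<delta>1(2) \<delta>2(2) D\<Phi>; simp)+
            then show ?thesis unfolding X_eq by (rule close)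
          next
            case False
            then have "\<bar>?u - (- 1)\<bar> \<le> 1 / q m" "\<bar>u m (M m * (v \<bullet> x) + (s m j + pi)) - 1\<bar> \<le> 1 / q m"
              unfolding u2 using u1 by linarith+
            from small[OF this(1)] small[OF this(2)]
            have "\<bar>G x (Dk k (\<Phi> m (s m j)) x) - ?A (- \<rho> x)\<bar>
                < \<epsilon> / 4" "\<bar>G x (Dk k (\<Phi> m (s m j + pi)) x) - ?A (\<rho> x)\<bar> < \<epsilon> / 4"
              by (intro \<delta>1(2) \<delta>2(2) D\<Phi>; simp)+
            then show ?thesis unfolding X_eq add.commute[of "?A (\<rho> x)"] by (rule close)
          qed
        qed
        have any: "\<bar>X j\<bar> \<le> 4 * (\<bar>a x\<bar> * C)" for j
          using G_bound[of x m "s m j"] G_bound[of x m "s m j + pi"]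
            target_bound[of "\<rho> x" x] target_bound[of "- \<rho> x" x] S[of x]
          unfolding X_eq abs_minus_cancel by (smt (verit))
        have aC: "0 \<le> \<bar>a x\<bar> * C" using order_trans[OF abs_ge_zero G_bound] .
        have "\<bar>\<Sum>j<m + 2. X j\<bar> \<le> (\<Sum>j<m + 2. \<epsilon> / 2 + (if ?bad j then 4 * (\<bar>a x\<bar> * C) else 0))"
        proof (rule order_trans[OF sum_abs sum_mono])
          fix j show "\<bar>X j\<bar> \<le> \<epsilon> / 2 + (if ?bad j then 4 * (\<bar>a x\<bar> * C) else 0)"
            using good[of j] any[of j] \<epsilon> by (cases "?bad j") auto
        qed
        also have "\<dots> = q m * (\<epsilon> / 2) + (\<Sum>j\<in>{j. j < m + 2 \<and> ?bad j}. 4 * (\<bar>a x\<bar> * C))"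
        proof -
          have "{j. j < m + 2 \<and> ?bad j} = {j \<in> {..<m + 2}. ?bad j}" by auto
          then have "(\<Sum>j\<in>{j. j < m + 2 \<and> ?bad j}. 4 * (\<bar>a x\<bar> * C))
              = (\<Sum>j<m + 2. if ?bad j then 4 * (\<bar>a x\<bar> * C) else 0)"
            by (simp only: sum.inter_filter finite_lessThan)
          then show ?thesis by (simp only: sum.distrib sum_constant card_lessThan q_def)
        qed
        also have "\<dots> \<le> q m * (\<epsilon> / 2) + 1 * (4 * (\<bar>a x\<bar> * C))"
          using at_most_one_bad_shift[of "m + 2" "M m * (v \<bullet> x)"] aC
          unfolding sum_constant by (intro add_left_mono mult_right_mono) auto
        finally have sumX: "\<bar>\<Sum>j<m + 2. X j\<bar> \<le> q m * (\<epsilon> / 2) + 4 * (\<bar>a x\<bar> * C)" by simp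
        have "(\<Sum>j<m + 2. X j) = 2 * q m * (H m x - T x)"
          using q(2)[of m] unfolding X_def sum_subtractf H_def
          by (simp add: q_def right_diff_distrib del: sum.lessThan_Suc)
        then have "2 * q m * \<bar>H m x - T x\<bar> \<le> q m * (\<epsilon> / 2) + 4 * (\<bar>a x\<bar> * C)"
          using sumX q(2)[of m] by (simp add: abs_mult)
        then have "\<bar>H m x - T x\<bar> \<le> \<epsilon> / 4 + 2 * (\<bar>a x\<bar> * C) / q m"
          using q(2)[of m] by (simp add: field_simps)
        then show ?case using elim(2) \<epsilon> unfolding dist_real_def by linarith
      qed
    qed
  qed
  then show ?thesis unfolding T_def e_def[symmetric] by simp
qed

section \<open>Separately convex functions of rational vectors\<close>

definition coord_norm :: "nat \<Rightarrow> (nat \<Rightarrow> rat) \<Rightarrow> real" where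
  "coord_norm d c = (\<Sum>i<d. \<bar>real_of_rat (c i)\<bar>)"

text \<open>
  What convexity along the rational multiples of a spanning family of directions becomes in
  coordinates.
\<close>

definition sep_convex :: "nat \<Rightarrow> ((nat \<Rightarrow> rat) \<Rightarrow> real) \<Rightarrow> bool" where
  "sep_convex d g \<longleftrightarrow> (\<forall>i<d. \<forall>q c. 2 * g c \<le> g (c(i := c i + q)) + g (c(i := c i - q)))"

lemma sep_convexD:
  "sep_convex d g \<Longrightarrow> i < d \<Longrightarrow> 2 * g c \<le> g (c(i := c i + q)) + g (c(i := c i - q))"
  by (auto simp: sep_convex_def)

lemma convex_seq_lower:
  fixes a :: "nat \<Rightarrow> real"
  assumes "\<And>t. 2 * a (Suc t) \<le> a t + a (Suc (Suc t))"
  shows "a s + real t * (a (Suc s) - a s) \<le> a (s + t)"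
proof -
  have slope: "a (Suc s) - a s \<le> a (Suc (s + t)) - a (s + t)" for t
  proof (induction t)
    case (Suc t)
    then show ?case using assms[of "s + t"] by simp
  qed simp
  show ?thesis
  proof (induction t)
    case (Suc t)
    have "real (Suc t) * (a (Suc s) - a s) = real t * (a (Suc s) - a s) + (a (Suc s) - a s)"
      by (simp add: algebra_simps)
    then show ?case using Suc slope[of t] by simp
  qed simp
qed

lemma le_zero_if_multiples_bounded:
  fixes y z :: real
  assumes "\<And>t::nat. real t * y \<le> z"
  shows "y \<le> 0"
proof (rule ccontr)
  assume "\<not> y \<le> 0"
  then obtain t :: nat where "z < real t * y" using ex_less_of_nat_mult[of y z] by auto
  then show False using assms[of t] by simp
qed

lemma sep_convex_seq:
  assumes "sep_convex d g" "i < d"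
  shows "2 * g (c(i := c i + of_nat (Suc t) * q))
    \<le> g (c(i := c i + of_nat t * q)) + g (c(i := c i + of_nat (Suc (Suc t)) * q))"
  using sep_convexD[OF assms, of "c(i := c i + of_nat (Suc t) * q)" q]
  by (simp add: algebra_simps)

lemma coord_norm_update:
  assumes "i < d"
  shows "coord_norm d (c(i := c i + q)) \<le> coord_norm d c + \<bar>real_of_rat q\<bar>"
proof -
  have "coord_norm d (c(i := c i + q))
      \<le> (\<Sum>j<d. \<bar>real_of_rat (c j)\<bar> + (if j = i then \<bar>real_of_rat q\<bar> else 0))"
    unfolding coord_norm_def
  proof (rule sum_mono)
    fix j assume "j \<in> {..<d}"
    show "\<bar>real_of_rat ((c(i := c i + q)) j)\<bar>
        \<le> \<bar>real_of_rat (c j)\<bar> + (if j = i then \<bar>real_of_rat q\<bar> else 0)"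
    proof (cases "j = i")
      case True
      then show ?thesis
        using abs_triangle_ineq[of "real_of_rat (c i)" "real_of_rat q"]
        by (simp only: fun_upd_same of_rat_add simp_thms if_True)
    qed simp
  qed
  also have "\<dots> = coord_norm d c + \<bar>real_of_rat q\<bar>"
    using assms by (simp add: coord_norm_def sum.distrib)
  finally show ?thesis .
qed

text \<open>
  Along a line, a slope of a convex sequence is bounded by the slope at infinity, hence by the rate
  of linear growth.
\<close>

lemma sep_convex_coord_lipschitz_upper:
  assumes g: "sep_convex d g" "i < d" and C: "0 \<le> C" "\<And>c. g c \<le> C * coord_norm d c"
  shows "g (c(i := c i + q)) - g c \<le> C * \<bar>real_of_rat q\<bar>"
proof -
  define a where "a t = g (c(i := c i + of_nat t * q))" for t
  have "real t * (a 1 - a 0 - C * \<bar>real_of_rat q\<bar>) \<le> C * coord_norm d c - a 0" for t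
  proof -
    have "a 0 + real t * (a 1 - a 0) \<le> a t"
      using convex_seq_lower[of a 0 t] sep_convex_seq[OF g] unfolding a_def by fastforce
    also have "a t \<le> C * coord_norm d (c(i := c i + of_nat t * q))"
      unfolding a_def by (rule C)
    also have "\<dots> \<le> C * (coord_norm d c + real t * \<bar>real_of_rat q\<bar>)"
      using coord_norm_update[OF g(2), of c "of_nat t * q"]
      by (intro mult_left_mono C) (simp add: of_rat_mult abs_mult)
    finally show ?thesis by (simp add: algebra_simps)
  qed
  then have "a 1 - a 0 - C * \<bar>real_of_rat q\<bar> \<le> 0"
    by (rule le_zero_if_multiples_bounded)
  then show ?thesis by (simp add: a_def)
qed

lemma sep_convex_coord_lipschitz:
  assumes g: "sep_convex d g" "i < d" and C: "0 \<le> C" "\<And>c. g c \<le> C * coord_norm d c"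
  shows "\<bar>g (c(i := c i + q)) - g c\<bar> \<le> C * \<bar>real_of_rat q\<bar>"
  using sep_convex_coord_lipschitz_upper[OF assms, of c q]
    sep_convex_coord_lipschitz_upper[OF assms, of "c(i := c i + q)" "- q"]
  by (simp add: of_rat_minus)

definition depends_on_first :: "nat \<Rightarrow> ((nat \<Rightarrow> rat) \<Rightarrow> real) \<Rightarrow> bool" where
  "depends_on_first d g \<longleftrightarrow> (\<forall>c c'. (\<forall>i<d. c i = c' i) \<longrightarrow> g c = g c')"

text \<open>
  Change the coordinates one after the other.
\<close>

lemma sep_convex_lipschitz:
  assumes g: "sep_convex d g" "depends_on_first d g"
    and C: "0 \<le> C" "\<And>c. g c \<le> C * coord_norm d c"
  shows "\<bar>g c - g c'\<bar> \<le> C * coord_norm d (\<lambda>i. c i - c' i)"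
proof -
  define h where "h m = (\<lambda>i. if i < m then c i else c' i)" for m
  have "\<bar>g (h m) - g c'\<bar> \<le> C * coord_norm m (\<lambda>i. c i - c' i)" if "m \<le> d" for m
    using that
  proof (induction m)
    case (Suc m)
    have eq: "h (Suc m) = (h m)(m := h m m + (c m - c' m))"
      by (auto simp: h_def fun_eq_iff)
    have "\<bar>g (h (Suc m)) - g (h m)\<bar> \<le> C * \<bar>real_of_rat (c m - c' m)\<bar>"
      unfolding eq using Suc.prems by (intro sep_convex_coord_lipschitz[OF g(1) _ C]) auto
    with Suc show ?case by (simp add: coord_norm_def algebra_simps)
  qed (simp add: h_def coord_norm_def)
  moreover have "g (h d) = g c"
    using g(2) by (auto simp: depends_on_first_def h_def)
  ultimately show ?thesis by (metis order_refl)
qed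

text \<open>
  The invariant of the construction of an additive minorant, after \<open>i\<close> axes have been treated.
\<close>

definition peeled :: "nat \<Rightarrow> real \<Rightarrow> nat \<Rightarrow> ((nat \<Rightarrow> rat) \<Rightarrow> real) \<Rightarrow> bool" where
  "peeled d C i g \<longleftrightarrow> sep_convex d g \<and> depends_on_first d g \<and>
     (\<forall>c. g c \<le> C * coord_norm d c) \<and>
     (\<forall>m::nat. \<forall>c. g (\<lambda>j. of_nat m * c j) = real m * g c) \<and>
     (\<forall>l<i. \<exists>\<alpha>. \<forall>c. \<forall>m::nat. g (c(l := c l + of_nat m)) = g c + real m * \<alpha>)"

text \<open>
  The new function is the limit of \<open>g(c + t e\<^sub>i) - t g(e\<^sub>i)\<close> as \<open>t \<longlonglongrightarrow> \<infinity>\<close>. The sequence decreases: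
  slopes of a convex sequence are at most its slope at infinity, which is \<open>g(e\<^sub>i)\<close> by homogeneity
  and the Lipschitz bound. The Lipschitz bound also keeps it bounded below. Passing to the limit
  makes the function affine along \<open>e\<^sub>i\<close> and preserves the rest of the invariant.
\<close>

lemma peel_direction:
  assumes P: "peeled d C i g" and i: "i < d" and C: "0 \<le> C"
  shows "\<exists>g'. peeled d C (Suc i) g' \<and> (\<forall>c. g' c \<le> g c)"
proof -
  have conv: "sep_convex d g" and dep: "depends_on_first d g"
    and up: "\<And>c. g c \<le> C * coord_norm d c"
    and hom: "\<And>(m::nat) c. g (\<lambda>j. of_nat m * c j) = real m * g c"
    and aff: "\<And>l. l < i \<Longrightarrow> \<exists>\<alpha>. \<forall>c. \<forall>m::nat. g (c(l := c l + of_nat m)) = g c + real m * \<alpha>"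
    using P by (auto simp: peeled_def)
  define \<gamma> where "\<gamma> = g (\<lambda>j. if j = i then 1 else 0)"
  define a where "a c t = g (c(i := c i + of_nat t))" for c and t :: nat
  define b where "b c t = a c t - real t * \<gamma>" for c and t :: nat
  have axis: "g (\<lambda>j. if j = i then of_nat t else 0) = real t * \<gamma>" for t
    using hom[of t "\<lambda>j. if j = i then 1 else 0"]
    by (simp add: \<gamma>_def if_distrib cong: if_cong)
  have bdd: "\<bar>b c t\<bar> \<le> C * coord_norm d c" for c t
  proof -
    have "\<bar>g (c(i := c i + of_nat t)) - g (\<lambda>j. if j = i then of_nat t else 0)\<bar>
        \<le> C * coord_norm d (\<lambda>j. (c(i := c i + of_nat t)) j - (if j = i then of_nat t else 0))"
      by (rule sep_convex_lipschitz[OF conv dep C up])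
    also have "(\<lambda>j. (c(i := c i + of_nat t)) j - (if j = i then of_nat t else 0)) = c"
      by auto
    finally show ?thesis unfolding axis b_def a_def .
  qed
  have slope: "a c (Suc s) - a c s \<le> \<gamma>" for c s
  proof -
    have "real T * (a c (Suc s) - a c s - \<gamma>) \<le> C * coord_norm d c + real s * \<gamma> - a c s" for T
    proof -
      have "a c s + real T * (a c (Suc s) - a c s) \<le> a c (s + T)"
        using sep_convex_seq[OF conv i, of c _ 1]
        by (intro convex_seq_lower) (simp add: a_def)
      moreover have "a c (s + T) \<le> C * coord_norm d c + real (s + T) * \<gamma>"
        using bdd[of c "s + T"] by (simp add: b_def)
      ultimately show ?thesis by (simp add: algebra_simps)
    qed
    then show ?thesis using le_zero_if_multiples_bounded by fastforce
  qed
  have dec: "decseq (b c)" for c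
    by (rule decseq_SucI) (use slope in \<open>simp add: b_def algebra_simps\<close>)
  have "\<exists>L. b c \<longlonglongrightarrow> L \<and> (\<forall>t. L \<le> b c t)" for c
  proof -
    have "- (C * coord_norm d c) \<le> b c t" for t using bdd[of c t] by linarith
    then obtain L where "b c \<longlonglongrightarrow> L" "\<forall>t. L \<le> b c t"
      using decseq_convergent[OF dec] by blast
    then show ?thesis by blast
  qed
  then obtain g' where lim: "\<And>c. b c \<longlonglongrightarrow> g' c" and le: "\<And>c t. g' c \<le> b c t"
    by metis
  have g'_le: "g' c \<le> g c" for c
    using le[of c 0] by (simp add: b_def a_def)
  have "sep_convex d g'"
    unfolding sep_convex_def
  proof (intro allI impI)
    fix l q c assume l: "l < d"
    have "2 * b c t \<le> b (c(l := c l + q)) t + b (c(l := c l - q)) t" for t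
    proof -
      have upd: "(c(l := c l + p))(i := (c(l := c l + p)) i + of_nat t)
          = (c(i := c i + of_nat t))(l := (c(i := c i + of_nat t)) l + p)" for p
        by (auto simp: fun_eq_iff)
      have "2 * a c t \<le> a (c(l := c l + q)) t + a (c(l := c l - q)) t"
        using sep_convexD[OF conv l, of "c(i := c i + of_nat t)" q] upd[of q] upd[of "- q"]
        unfolding a_def by simp
      then show ?thesis by (simp add: b_def)
    qed
    then show "2 * g' c \<le> g' (c(l := c l + q)) + g' (c(l := c l - q))"
      by (intro LIMSEQ_le[OF tendsto_mult_left[OF lim] tendsto_add[OF lim lim]]) auto
  qed
  moreover have "depends_on_first d g'"
    unfolding depends_on_first_def
  proof (intro allI impI)
    fix c c' :: "nat \<Rightarrow> rat" assume "\<forall>i<d. c i = c' i"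
    then have "b c = b c'"
      using dep i by (auto simp: b_def a_def fun_eq_iff depends_on_first_def)
    then show "g' c = g' c'" using LIMSEQ_unique[OF lim[of c], of "g' c'"] lim[of c'] by simp
  qed
  moreover have "g' c \<le> C * coord_norm d c" for c
    using order_trans[OF g'_le up] .
  moreover have "g' (\<lambda>j. of_nat m * c j) = real m * g' c" for m :: nat and c
  proof (cases "m = 0")
    case True
    have "(\<lambda>j. 0)(i := of_nat t) = (\<lambda>j. if j = i then of_nat t else (0::rat))" for t :: nat
      by auto
    then have "b (\<lambda>j. 0) = (\<lambda>t. 0)"
      using axis unfolding b_def a_def by (simp only: add_0_left) simp
    then have "g' (\<lambda>j. 0) = 0"
      using LIMSEQ_unique[OF lim[of "\<lambda>j. 0"]] by simp
    then show ?thesis using True by simp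
  next
    case False
    have "(\<lambda>j. of_nat m * c j)(i := of_nat m * c i + of_nat (m * t))
        = (\<lambda>j. of_nat m * (c(i := c i + of_nat t)) j)" for t
      by (auto simp: fun_eq_iff algebra_simps)
    then have "a (\<lambda>j. of_nat m * c j) (m * t) = real m * a c t" for t
      unfolding a_def using hom[of m "c(i := c i + of_nat t)" for t] by simp
    then have "b (\<lambda>j. of_nat m * c j) (m * t) = real m * b c t" for t
      unfolding b_def by (simp only: of_nat_mult right_diff_distrib mult.assoc)
    moreover have "(\<lambda>t. b (\<lambda>j. of_nat m * c j) (m * t)) \<longlonglongrightarrow> g' (\<lambda>j. of_nat m * c j)"
      using LIMSEQ_subseq_LIMSEQ[OF lim, of "\<lambda>t. m * t"] False
      by (auto simp: strict_mono_def o_def)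
    ultimately show ?thesis
      using tendsto_mult_left[OF lim, of "real m" c] LIMSEQ_unique by auto
  qed
  moreover have "\<exists>\<alpha>. \<forall>c. \<forall>m::nat. g' (c(l := c l + of_nat m)) = g' c + real m * \<alpha>"
    if l: "l < Suc i" for l
  proof (cases "l = i")
    case True
    have "g' (c(i := c i + of_nat m)) = g' c + real m * \<gamma>" for c and m :: nat
    proof -
      have "b (c(i := c i + of_nat m)) t = b c (t + m) + real m * \<gamma>" for t
        by (simp add: b_def a_def algebra_simps)
      then have "b (c(i := c i + of_nat m)) = (\<lambda>t. b c (t + m) + real m * \<gamma>)" by blast
      then have "b (c(i := c i + of_nat m)) \<longlonglongrightarrow> g' c + real m * \<gamma>"
        using tendsto_add[OF LIMSEQ_ignore_initial_segment[OF lim[of c], of m]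
            tendsto_const[of "real m * \<gamma>"]] by simp
      then show ?thesis using lim LIMSEQ_unique by blast
    qed
    then show ?thesis using True by blast
  next
    case False
    then obtain \<alpha> where \<alpha>: "\<And>c (m::nat). g (c(l := c l + of_nat m)) = g c + real m * \<alpha>"
      using aff[of l] l by auto
    have "g' (c(l := c l + of_nat m)) = g' c + real m * \<alpha>" for c and m :: nat
    proof -
      have "b (c(l := c l + of_nat m)) t = b c t + real m * \<alpha>" for t
      proof -
        have "(c(l := c l + of_nat m))(i := (c(l := c l + of_nat m)) i + of_nat t)
            = (c(i := c i + of_nat t))(l := (c(i := c i + of_nat t)) l + of_nat m)"
          using False by (auto simp: fun_eq_iff)
        then have "a (c(l := c l + of_nat m)) t = a c t + real m * \<alpha>"
          using \<alpha>[of "c(i := c i + of_nat t)" m] unfolding a_def by simp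
        then show ?thesis by (simp add: b_def)
      qed
      then have "b (c(l := c l + of_nat m)) = (\<lambda>t. b c t + real m * \<alpha>)" by blast
      then have "b (c(l := c l + of_nat m)) \<longlonglongrightarrow> g' c + real m * \<alpha>"
        using tendsto_add[OF lim[of c] tendsto_const[of "real m * \<alpha>"]] by simp
      then show ?thesis using lim LIMSEQ_unique by blast
    qed
    then show ?thesis by blast
  qed
  ultimately have "peeled d C (Suc i) g'" by (auto simp: peeled_def)
  then show ?thesis using g'_le by blast
qed

lemma exists_fully_peeled:
  assumes "peeled d C 0 g" "0 \<le> C" "i \<le> d"
  shows "\<exists>g'. peeled d C i g' \<and> (\<forall>c. g' c \<le> g c)"
  using assms(3)
proof (induction i)
  case 0
  then show ?case using assms by blast
next
  case (Suc i)
  then obtain g' where "peeled d C i g'" "\<forall>c. g' c \<le> g c" by auto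
  moreover obtain g'' where "peeled d C (Suc i) g''" "\<forall>c. g'' c \<le> g' c"
    using peel_direction[OF \<open>peeled d C i g'\<close> _ assms(2)] Suc.prems by auto
  moreover have "g'' c \<le> g c" for c
    using \<open>\<forall>c. g'' c \<le> g' c\<close> \<open>\<forall>c. g' c \<le> g c\<close> order_trans[of "g'' c" "g' c" "g c"] by simp
  ultimately show ?case by blast
qed

text \<open>
  Affine along every axis and zero at the origin, the function is additive on integer vectors.
\<close>

lemma fully_peeled_odd:
  assumes P: "peeled d C d g"
  shows "g (\<lambda>i. of_int (- z i)) = - g (\<lambda>i. of_int (z i))"
proof -
  obtain \<alpha> where \<alpha>: "\<And>l c (m::nat). l < d \<Longrightarrow> g (c(l := c l + of_nat m)) = g c + real m * \<alpha> l"
  proof -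
    have "\<forall>l<d. \<exists>\<alpha>. \<forall>c. \<forall>m::nat. g (c(l := c l + of_nat m)) = g c + real m * \<alpha>"
      using P unfolding peeled_def by blast
    then obtain \<alpha> where "\<forall>l<d. \<forall>c. \<forall>m::nat. g (c(l := c l + of_nat m)) = g c + real m * \<alpha> l"
      by metis
    then show thesis using that by blast
  qed
  have int: "g (c(l := c l + of_int y)) = g c + of_int y * \<alpha> l" if "l < d" for l c y
  proof (cases "0 \<le> y")
    case True
    then show ?thesis using \<alpha>[OF that, of c "nat y"] by simp
  next
    case False
    then show ?thesis using \<alpha>[OF that, of "c(l := c l + of_int y)" "nat (- y)"] by simp
  qed
  have zero: "g (\<lambda>i. 0) = 0"
  proof -
    have "\<forall>m::nat. \<forall>c. g (\<lambda>j. of_nat m * c j) = real m * g c"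
      using P unfolding peeled_def by blast
    from this[rule_format, of 0 "\<lambda>j. 0"] show ?thesis by simp
  qed
  have "g (\<lambda>i. of_int (y i)) = (\<Sum>l<d. of_int (y l) * \<alpha> l)" for y
  proof -
    have "g (\<lambda>i. if i < m then of_int (y i) else 0) = (\<Sum>l<m. of_int (y l) * \<alpha> l)" if "m \<le> d" for m
      using that
    proof (induction m)
      case (Suc m)
      have "(\<lambda>i. if i < Suc m then of_int (y i) else (0::rat))
          = (\<lambda>i. if i < m then of_int (y i) else 0)(m := (if m
              < m then of_int (y m) else 0) + of_int (y m))"
        by (auto simp: fun_eq_iff)
      with Suc int[of m "\<lambda>i. if i < m then of_int (y i) else 0" "y m"] show ?case by simp
    qed (simp add: zero)
    moreover have "g (\<lambda>i. if i < d then of_int (y i) else 0) = g (\<lambda>i. of_int (y i))"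
      using P by (auto simp: peeled_def depends_on_first_def)
    ultimately show ?thesis by (metis order_refl)
  qed
  from this[of "\<lambda>i. - z i"] this[of z] show ?thesis by (simp add: sum_negf)
qed

lemma common_denominator:
  fixes c :: "nat \<Rightarrow> rat"
  shows "\<exists>m::nat. 0 < m \<and> (\<forall>i<d. of_nat m * c i \<in> \<int>)"
proof (induction d)
  case 0
  show ?case by (intro exI[of _ 1]) simp
next
  case (Suc d)
  then obtain m :: nat where m: "0 < m" "\<forall>i<d. of_nat m * c i \<in> \<int>" by blast
  obtain p q where "quotient_of (c d) = (p, q)" by (cases "quotient_of (c d)")
  then have pq: "c d = of_int p / of_int q" "0 < q"
    using quotient_of_div quotient_of_denom_pos by blast+
  have q: "(of_nat (nat q) :: rat) = of_int q" using pq(2) by simp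
  have "of_nat (m * nat q) * c i \<in> \<int>" if "i < Suc d" for i
  proof (cases "i = d")
    case True
    have "of_int q * c d = of_int p" using pq by simp
    then have "of_nat (m * nat q) * c d = of_int (int m * p)"
      unfolding of_nat_mult q mult.assoc by simp
    then show ?thesis unfolding True using Ints_of_int by metis
  next
    case False
    then have "of_nat m * c i \<in> \<int>" using m(2) that by simp
    then have "of_int q * (of_nat m * c i) \<in> \<int>" by (rule Ints_mult[OF Ints_of_int])
    then show ?thesis unfolding of_nat_mult q by (simp only: mult.commute mult.left_commute)
  qed
  moreover have "0 < m * nat q" using m pq by simp
  ultimately show ?case by blast
qed

text \<open>
  If \<open>\<sigma>\<close> takes every value with first component below \<open>d\<close> infinitely often, the limit, if finite, is
  the largest separately convex function below \<open>f\<close>.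
\<close>

primrec lam_hull :: "(nat \<Rightarrow> nat \<times> rat) \<Rightarrow> ((nat \<Rightarrow> rat) \<Rightarrow> real) \<Rightarrow> nat \<Rightarrow> (nat \<Rightarrow> rat) \<Rightarrow> real" where
  "lam_hull \<sigma> f 0 = f"
| "lam_hull \<sigma> f (Suc j) = (\<lambda>c. min (lam_hull \<sigma> f j c)
     ((lam_hull \<sigma> f j (c(fst (\<sigma> j) := c (fst (\<sigma> j)) + snd (\<sigma> j)))
       + lam_hull \<sigma> f j (c(fst (\<sigma> j) := c (fst (\<sigma> j)) - snd (\<sigma> j)))) / 2))"

lemma sep_convex_le_lam_hull:
  assumes "sep_convex d h" "\<And>c. h c \<le> f c" "\<And>j. fst (\<sigma> j) < d"
  shows "h c \<le> lam_hull \<sigma> f j c"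
proof (induction j arbitrary: c)
  case (Suc j)
  let ?i = "fst (\<sigma> j)" and ?q = "snd (\<sigma> j)"
  have "2 * h c \<le> h (c(?i := c ?i + ?q)) + h (c(?i := c ?i - ?q))"
    using sep_convexD[OF assms(1) assms(3)] .
  also have "\<dots> \<le> lam_hull \<sigma> f j (c(?i := c ?i + ?q)) + lam_hull \<sigma> f j (c(?i := c ?i - ?q))"
    by (intro add_mono Suc)
  finally show ?case using Suc[of c] by simp
qed (simp add: assms)

lemma lam_hull_depends_on_first:
  assumes dep: "depends_on_first d f" and \<sigma>d: "\<And>j. fst (\<sigma> j) < d"
  shows "depends_on_first d (lam_hull \<sigma> f j)"
proof (induction j)
  case 0
  then show ?case using dep by simp
next
  case (Suc j)
  show ?case
    unfolding depends_on_first_def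
  proof (intro allI impI)
    fix c c' :: "nat \<Rightarrow> rat" assume eq: "\<forall>i<d. c i = c' i"
    let ?i = "fst (\<sigma> j)" and ?q = "snd (\<sigma> j)"
    have "lam_hull \<sigma> f j c = lam_hull \<sigma> f j c'"
      and "lam_hull \<sigma> f j (c(?i := c ?i + ?q)) = lam_hull \<sigma> f j (c'(?i := c' ?i + ?q))"
      and "lam_hull \<sigma> f j (c(?i := c ?i - ?q)) = lam_hull \<sigma> f j (c'(?i := c' ?i - ?q))"
      by (rule Suc[unfolded depends_on_first_def, rule_format]; use eq \<sigma>d[of j] in simp)+
    then show "lam_hull \<sigma> f (Suc j) c = lam_hull \<sigma> f (Suc j) c'" by simp
  qed
qed

text \<open>
  Read backwards, the midpoint inequality bounds the value at one neighbour from below by twice the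
  value at the centre minus the value at the other neighbour, and the latter is at most \<open>f\<close>. Hence
  boundedness below spreads from the origin to every point, one axis at a time.
\<close>

lemma lam_hull_bounded_below:
  assumes \<sigma>: "\<And>m i q. i < d \<Longrightarrow> \<exists>j\<ge>m. \<sigma> j = (i, q)"
    and dep: "depends_on_first d f"
    and zero: "\<And>j. 0 \<le> lam_hull \<sigma> f j (\<lambda>i. 0)"
    and \<sigma>d: "\<And>j. fst (\<sigma> j) < d"
  shows "\<exists>L. \<forall>j. L \<le> lam_hull \<sigma> f j c"
proof -
  have dec: "lam_hull \<sigma> f j c \<le> lam_hull \<sigma> f m c" if "m \<le> j" for m j c
    using that by (induction rule: dec_induct) (auto simp: min_le_iff_disj)
  have step: "\<exists>L. \<forall>j. L \<le> lam_hull \<sigma> f j (c(i := c i + q))"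
    if L: "\<forall>j. L \<le> lam_hull \<sigma> f j c" and i: "i < d" for c i q L
  proof -
    have "2 * L - f (c(i := c i - q)) \<le> lam_hull \<sigma> f m (c(i := c i + q))" for m
    proof -
      obtain j where j: "m \<le> j" "\<sigma> j = (i, q)" using \<sigma>[OF i] by blast
      have "2 * L \<le> 2 * lam_hull \<sigma> f (Suc j) c" using L by (meson mult_left_mono zero_le_numeral)
      also have "\<dots> \<le> lam_hull \<sigma> f j (c(i := c i + q)) + lam_hull \<sigma> f j (c(i := c i - q))"
        using j(2) by (simp add: min_def)
      also have "\<dots> \<le> lam_hull \<sigma> f m (c(i := c i + q)) + lam_hull \<sigma> f 0 (c(i := c i - q))"
        by (intro add_mono dec j(1)) simp
      finally show ?thesis by simp
    qed
    then show ?thesis by blast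
  qed
  have "\<exists>L. \<forall>j. L \<le> lam_hull \<sigma> f j (\<lambda>i. if i < m then c i else 0)" if "m \<le> d" for m
    using that
  proof (induction m)
    case 0
    then show ?case using zero by auto
  next
    case (Suc m)
    have "(\<lambda>i. if i < Suc m then c i else 0)
        = (\<lambda>i. if i < m then c i else 0)(m := (if m < m then c m else 0) + c m)"
      by (auto simp: fun_eq_iff)
    with Suc step[of _ "\<lambda>i. if i < m then c i else 0" m "c m"] show ?case by auto
  qed
  moreover have "lam_hull \<sigma> f j (\<lambda>i. if i < d then c i else 0) = lam_hull \<sigma> f j c" for j
    using lam_hull_depends_on_first[OF dep \<sigma>d] by (simp add: depends_on_first_def)
  ultimately show ?thesis by (metis order_refl)
qed

text \<open>
  The separately convex hull \<open>g\<close> of \<open>f\<close> is finite, and being the largest separately convex minorant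
  it inherits homogeneity from \<open>f\<close>. Peeling all directions off \<open>g\<close> leaves a minorant \<open>h\<close> of \<open>f\<close> that
  is odd on integer vectors, so that evenness of \<open>f\<close> gives \<open>f(c) \<ge> \<bar>h(c)\<bar>\<close> there. Rational vectors
  follow by clearing denominators.
\<close>

lemma even_homogeneous_nonneg:
  assumes \<sigma>: "\<And>m i q. i < d \<Longrightarrow> \<exists>j\<ge>m. \<sigma> j = (i, q)" and \<sigma>d: "\<And>j. fst (\<sigma> j) < d"
    and dep: "depends_on_first d f"
    and hom: "\<And>q c. f (\<lambda>i. q * c i) = \<bar>real_of_rat q\<bar> * f c"
    and C: "0 \<le> C" "\<And>c. f c \<le> C * coord_norm d c"
    and zero: "\<And>j. 0 \<le> lam_hull \<sigma> f j (\<lambda>i. 0)"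
  shows "0 \<le> f c"
proof -
  let ?G = "lam_hull \<sigma> f"
  have dec: "?G j c \<le> ?G m c" if "m \<le> j" for m j c
    using that by (induction rule: dec_induct) (auto simp: min_le_iff_disj)
  have "\<exists>L. (\<lambda>j. ?G j c) \<longlonglongrightarrow> L \<and> (\<forall>j. L \<le> ?G j c)" for c
  proof -
    obtain L where "\<forall>j. L \<le> ?G j c"
      using lam_hull_bounded_below[OF \<sigma> dep zero \<sigma>d] by blast
    moreover have "decseq (\<lambda>j. ?G j c)" using dec by (simp add: decseq_def)
    ultimately obtain L' where "(\<lambda>j. ?G j c) \<longlonglongrightarrow> L'" "\<forall>j. L' \<le> ?G j c"
      using decseq_convergent[of "\<lambda>j. ?G j c" L] by blast
    then show ?thesis by blast
  qed
  then obtain g where lim: "\<And>c. (\<lambda>j. ?G j c) \<longlonglongrightarrow> g c" and le: "\<And>c j. g c \<le> ?G j c"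
    by metis
  have g_le: "g c \<le> f c" for c using le[of c 0] by simp
  have conv: "sep_convex d g"
    unfolding sep_convex_def
  proof (intro allI impI)
    fix i q c assume i: "i < d"
    have "2 * g c \<le> ?G m (c(i := c i + q)) + ?G m (c(i := c i - q))" for m
    proof -
      obtain j where j: "m \<le> j" "\<sigma> j = (i, q)" using \<sigma>[OF i] by blast
      have "2 * g c \<le> 2 * ?G (Suc j) c" using le by (meson mult_left_mono zero_le_numeral)
      also have "\<dots> \<le> ?G j (c(i := c i + q)) + ?G j (c(i := c i - q))"
        using j(2) by (simp add: min_def)
      also have "\<dots> \<le> ?G m (c(i := c i + q)) + ?G m (c(i := c i - q))"
        by (intro add_mono dec j(1))
      finally show ?thesis .
    qed
    then show "2 * g c \<le> g (c(i := c i + q)) + g (c(i := c i - q))"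
      by (intro LIMSEQ_le_const[OF tendsto_add[OF lim lim]]) auto
  qed
  have greatest: "h c \<le> g c" if "sep_convex d h" "\<And>c. h c \<le> f c" for h c
    using sep_convex_le_lam_hull[of d h f \<sigma>, OF that \<sigma>d] by (intro LIMSEQ_le_const[OF lim]) auto
  \<comment> \<open>rescaling maps the class of separately convex minorants of \<open>f\<close> to itself\<close>
  have scaled: "\<bar>real_of_rat q\<bar> * g (\<lambda>i. c i / q) \<le> g c" if q: "q \<noteq> 0" for q c
  proof (rule greatest[of "\<lambda>c. \<bar>real_of_rat q\<bar> * g (\<lambda>i. c i / q)" c])
    show "sep_convex d (\<lambda>c. \<bar>real_of_rat q\<bar> * g (\<lambda>i. c i / q))"
      unfolding sep_convex_def
    proof (intro allI impI)
      fix i p c assume "i < d"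
      have eq: "(\<lambda>l. (c(i := c i + y)) l / q) = (\<lambda>l. c l / q)(i := c i / q + y / q)" for y
        by (auto simp: fun_eq_iff add_divide_distrib)
      have "2 * g (\<lambda>l. c l / q) \<le> g (\<lambda>l. (c(i := c i + p)) l / q) + g (\<lambda>l. (c(i := c i + - p)) l / q)"
        using sep_convexD[OF conv \<open>i < d\<close>, of "\<lambda>l. c l / q" "p / q"] unfolding eq by simp
      from mult_left_mono[OF this abs_ge_zero[of "real_of_rat q"]]
      show "2 * (\<bar>real_of_rat q\<bar> * g (\<lambda>l. c l / q))
          \<le> \<bar>real_of_rat q\<bar> * g (\<lambda>l. (c(i := c i + p)) l / q)
            + \<bar>real_of_rat q\<bar> * g (\<lambda>l. (c(i := c i - p)) l / q)"
        unfolding distrib_left add_uminus_conv_diff by (simp only: mult.left_commute)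
    qed
    show "\<bar>real_of_rat q\<bar> * g (\<lambda>i. c i / q) \<le> f c" for c
    proof -
      have "\<bar>real_of_rat q\<bar> * g (\<lambda>i. c i / q) \<le> \<bar>real_of_rat q\<bar> * f (\<lambda>i. c i / q)"
        by (intro mult_left_mono g_le) simp
      also have "\<dots> = f c" using q hom[of q "\<lambda>i. c i / q"] by simp
      finally show ?thesis .
    qed
  qed
  have g_zero: "g (\<lambda>i. 0) = 0"
  proof (rule antisym)
    show "g (\<lambda>i. 0) \<le> 0" using g_le[of "\<lambda>i. 0"] C(2)[of "\<lambda>i. 0"] by (simp add: coord_norm_def)
    show "0 \<le> g (\<lambda>i. 0)" using zero by (intro LIMSEQ_le_const[OF lim]) auto
  qed
  have "g (\<lambda>j. of_nat m * c j) = real m * g c" for m :: nat and c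
  proof (cases "m = 0")
    case False
    then have "real m * g c \<le> g (\<lambda>j. of_nat m * c j)"
      using scaled[of "of_nat m" "\<lambda>j. of_nat m * c j"] by simp
    moreover have "g (\<lambda>j. of_nat m * c j) \<le> real m * g c"
    proof -
      have "(\<lambda>i. c i / (1 / of_nat m)) = (\<lambda>j. of_nat m * c j)"
        by (simp add: fun_eq_iff)
      then have "1 / real m * g (\<lambda>j. of_nat m * c j) \<le> g c"
        using scaled[of "1 / of_nat m" c] False by (simp add: of_rat_divide)
      then show ?thesis using False by (simp add: field_simps)
    qed
    ultimately show ?thesis by (rule antisym[rotated])
  qed (simp add: g_zero)
  moreover have "g c = g c'" if "\<forall>i<d. c i = c' i" for c c'
  proof -
    have "?G j c = ?G j c'" for j
      using lam_hull_depends_on_first[of d f \<sigma> j, OF dep \<sigma>d] that unfolding depends_on_first_def by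
          blast
    then have "(\<lambda>j. ?G j c) = (\<lambda>j. ?G j c')" by blast
    then show ?thesis using LIMSEQ_unique[OF lim[of c], of "g c'"] lim[of c'] by simp
  qed
  moreover have "g c \<le> C * coord_norm d c" for c
    using order_trans[OF g_le C(2)] .
  ultimately have "peeled d C 0 g"
    using conv unfolding peeled_def depends_on_first_def by blast
  then obtain h where h: "peeled d C d h" "\<And>c. h c \<le> g c"
    using exists_fully_peeled[OF _ C(1)] by blast
  have int: "0 \<le> f (\<lambda>i. of_int (z i))" for z
  proof -
    have "h (\<lambda>i. of_int (z i)) \<le> f (\<lambda>i. of_int (z i))"
      by (rule order_trans[OF h(2) g_le])
    moreover have "h (\<lambda>i. of_int (- z i)) \<le> f (\<lambda>i. of_int (- z i))"
      by (rule order_trans[OF h(2) g_le])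
    moreover have "f (\<lambda>i. of_int (- z i)) = f (\<lambda>i. of_int (z i))"
    proof -
      have "(\<lambda>i. of_int (- z i)) = (\<lambda>i. - 1 * of_int (z i) :: rat)" by (simp add: fun_eq_iff)
      then have "f (\<lambda>i. of_int (- z i)) = \<bar>real_of_rat (- 1)\<bar> * f (\<lambda>i. of_int (z i))"
        by (simp only: hom)
      then show ?thesis by (simp add: of_rat_minus)
    qed
    ultimately show ?thesis using fully_peeled_odd[OF h(1), of z] by linarith
  qed
  obtain m :: nat where m: "0 < m" "\<forall>i<d. of_nat m * c i \<in> \<int>"
    using common_denominator by blast
  define z where "z i = \<lfloor>of_nat m * c i\<rfloor>" for i
  have "of_nat m * c i = of_int (z i)" if "i < d" for i
  proof -
    have "of_nat m * c i \<in> \<int>" using m(2) that by blast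
    then obtain k where "of_nat m * c i = of_int k" by (rule Ints_cases)
    then show ?thesis unfolding z_def by simp
  qed
  then have eq: "f (\<lambda>i. of_nat m * c i) = f (\<lambda>i. of_int (z i))"
    using dep[unfolded depends_on_first_def, rule_format, of "\<lambda>i. of_nat m * c i" "\<lambda>i. of_int (z i)"]
    by simp
  have "0 \<le> \<bar>real_of_rat (of_nat m)\<bar> * f c"
    using int[of z] unfolding eq[symmetric] hom[of "of_nat m" c] .
  then show ?thesis using m(1) by (simp add: zero_le_mult_iff)
qed

section \<open>Laminations of the integrand\<close>

text \<open>
  The functions fixed by these steps for all rational multiples of \<open>e\<close> are those that are midpoint
  convex, with such steps, in the direction \<open>e\<close>.
\<close>

definition lam_step ::
    "('a list \<Rightarrow> 'b::real_vector) \<Rightarrow> (('a list \<Rightarrow> 'b) \<Rightarrow> real) \<Rightarrow> ('a list \<Rightarrow> 'b) \<Rightarrow> real" where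
  "lam_step e f \<xi> = min (f \<xi>) ((f (\<lambda>vs. \<xi> vs + e vs) + f (\<lambda>vs. \<xi> vs - e vs)) / 2)"

lemma abs_average_le: "\<bar>p\<bar> \<le> b \<Longrightarrow> \<bar>q\<bar> \<le> b \<Longrightarrow> \<bar>(p + q) / 2\<bar> \<le> b" for p q b :: real
  by (simp add: abs_le_iff field_simps)

lemma abs_average_diff_less:
  "\<bar>p - p'\<bar> < b \<Longrightarrow> \<bar>q - q'\<bar> < b \<Longrightarrow> \<bar>(p + q) / 2 - (p' + q') / 2\<bar> < b" for p q p' q' b :: real
  by (simp add: abs_less_iff field_simps)

lemma abs_min_le: "\<bar>p\<bar> \<le> b \<Longrightarrow> \<bar>q\<bar> \<le> b \<Longrightarrow> \<bar>min p q\<bar> \<le> b" for p q b :: real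
  by (simp add: min_def)

lemma abs_min_diff_less:
  "\<bar>p - p'\<bar> < b \<Longrightarrow> \<bar>q - q'\<bar> < b \<Longrightarrow> \<bar>min p q - min p' q'\<bar> < b" for p q p' q' b :: real
  by (auto simp: min_def abs_less_iff)

lemma sym_continuous_translate:
  fixes f :: "('a::euclidean_space list \<Rightarrow> 'b::euclidean_space) \<Rightarrow> real"
  assumes f: "sym_continuous k f" and e: "e \<in> sym_maps k"
  shows "sym_continuous k (\<lambda>\<xi>. f (\<lambda>vs. \<xi> vs + e vs))"
  unfolding sym_continuous_def
proof (intro ballI allI impI)
  fix \<xi> :: "'a list \<Rightarrow> 'b" and \<epsilon> :: real assume \<xi>: "\<xi> \<in> sym_maps k" and \<epsilon>: "0 < \<epsilon>"
  obtain \<delta> where \<delta>: "0 < \<delta>" "\<And>\<eta>. \<eta> \<in> sym_maps k \<Longrightarrow>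
      mnorm k (\<lambda>vs. \<eta> vs - (\<xi> vs + e vs)) < \<delta> \<Longrightarrow> \<bar>f \<eta> - f (\<lambda>vs. \<xi> vs + e vs)\<bar> < \<epsilon>"
    using sym_continuousD[OF f sym_maps_add[OF \<xi> e] \<epsilon>] by blast
  show "\<exists>\<delta>>0. \<forall>\<eta>\<in>sym_maps k. mnorm k (\<lambda>vs. \<eta> vs - \<xi> vs) < \<delta> \<longrightarrow>
      \<bar>f (\<lambda>vs. \<eta> vs + e vs) - f (\<lambda>vs. \<xi> vs + e vs)\<bar> < \<epsilon>"
    using \<delta>(1) by (intro exI[of _ \<delta>] conjI ballI impI \<delta>(2) sym_maps_add e) simp_all
qed

lemma sym_continuous_lam_step:
  fixes f :: "('a::euclidean_space list \<Rightarrow> 'b::euclidean_space) \<Rightarrow> real"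
  assumes f: "sym_continuous k f" and e: "e \<in> sym_maps k"
  shows "sym_continuous k (lam_step e f)"
  unfolding sym_continuous_def
proof (intro ballI allI impI)
  fix \<xi> :: "'a list \<Rightarrow> 'b" and \<epsilon> :: real assume \<xi>: "\<xi> \<in> sym_maps k" and \<epsilon>: "0 < \<epsilon>"
  have f1: "sym_continuous k (\<lambda>\<xi>. f (\<lambda>vs. \<xi> vs + e vs))"
    by (rule sym_continuous_translate[OF f e])
  have f2: "sym_continuous k (\<lambda>\<xi>. f (\<lambda>vs. \<xi> vs - e vs))"
    using sym_continuous_translate[OF f sym_maps_scale[OF e, of "- 1"]] by simp
  obtain \<delta>0 where \<delta>0: "0 < \<delta>0" "\<And>\<eta>. \<eta> \<in> sym_maps k \<Longrightarrow>
      mnorm k (\<lambda>vs. \<eta> vs - \<xi> vs) < \<delta>0 \<Longrightarrow> \<bar>f \<eta> - f \<xi>\<bar> < \<epsilon>"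
    using sym_continuousD[OF f \<xi> \<epsilon>] by blast
  obtain \<delta>1 where \<delta>1: "0 < \<delta>1" "\<And>\<eta>. \<eta> \<in> sym_maps k \<Longrightarrow> mnorm k (\<lambda>vs. \<eta> vs - \<xi> vs) < \<delta>1 \<Longrightarrow>
      \<bar>f (\<lambda>vs. \<eta> vs + e vs) - f (\<lambda>vs. \<xi> vs + e vs)\<bar> < \<epsilon>"
    using sym_continuousD[OF f1 \<xi> \<epsilon>] by blast
  obtain \<delta>2 where \<delta>2: "0 < \<delta>2" "\<And>\<eta>. \<eta> \<in> sym_maps k \<Longrightarrow> mnorm k (\<lambda>vs. \<eta> vs - \<xi> vs) < \<delta>2 \<Longrightarrow>
      \<bar>f (\<lambda>vs. \<eta> vs - e vs) - f (\<lambda>vs. \<xi> vs - e vs)\<bar> < \<epsilon>"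
    using sym_continuousD[OF f2 \<xi> \<epsilon>] by blast
  show "\<exists>\<delta>>0. \<forall>\<eta>\<in>sym_maps k. mnorm k (\<lambda>vs. \<eta> vs - \<xi> vs) < \<delta> \<longrightarrow> \<bar>lam_step e f \<eta> - lam_step e f \<xi>\<bar> < \<epsilon>"
    unfolding lam_step_def
    by (intro exI[of _ "min \<delta>0 (min \<delta>1 \<delta>2)"] conjI ballI impI abs_min_diff_less abs_average_diff_less
        \<delta>0(2) \<delta>1(2) \<delta>2(2))
       (simp_all add: \<delta>0(1) \<delta>1(1) \<delta>2(1))
qed

lemma tame_integrand_lam_step:
  fixes G :: "'a::euclidean_space \<Rightarrow> ('a list \<Rightarrow> 'b::euclidean_space) \<Rightarrow> real"
  assumes G: "tame_integrand k a G" and e: "e \<in> sym_maps k"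
  shows "tame_integrand k a (\<lambda>x. lam_step e (G x))"
proof -
  obtain K where K0: "0 \<le> K" and K: "\<And>x \<xi>. \<xi> \<in> sym_maps k \<Longrightarrow> \<bar>G x \<xi>\<bar> \<le> \<bar>a x\<bar> * (K + mnorm k \<xi>)"
    using G unfolding tame_integrand_def by blast
  have me: "0 \<le> mnorm k e" by (rule mnorm_nonneg[OF sym_maps_multilinear[OF e]])
  have G_meas: "(\<lambda>x. G x \<xi>) \<in> borel_measurable lebesgue" if "\<xi> \<in> sym_maps k" for \<xi>
    using G that unfolding tame_integrand_def by blast
  have "(\<lambda>x. lam_step e (G x) \<xi>) \<in> borel_measurable lebesgue" if "\<xi> \<in> sym_maps k" for \<xi>
    unfolding lam_step_def
    by (intro borel_measurable_min borel_measurable_divide borel_measurable_add borel_measurable_const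
        G_meas that sym_maps_add sym_maps_diff e)
  moreover have "sym_continuous k (lam_step e (G x))" for x
    using G e by (intro sym_continuous_lam_step) (auto simp: tame_integrand_def)
  moreover have "\<bar>lam_step e (G x) \<xi>\<bar> \<le> \<bar>a x\<bar> * ((K + mnorm k e) + mnorm k \<xi>)"
    if \<xi>: "\<xi> \<in> sym_maps k" for x \<xi>
  proof -
    let ?b = "\<bar>a x\<bar> * ((K + mnorm k e) + mnorm k \<xi>)"
    have "\<bar>G x \<xi>\<bar> \<le> ?b"
      by (rule order_trans[OF K[OF \<xi>]]) (intro mult_left_mono; use me in simp)
    moreover have "\<bar>G x (\<lambda>vs. \<xi> vs + e vs)\<bar> \<le> ?b"
      using mnorm_add[OF \<xi> e]
      by (intro order_trans[OF K[OF sym_maps_add[OF \<xi> e]]] mult_left_mono) auto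
    moreover have "\<bar>G x (\<lambda>vs. \<xi> vs - e vs)\<bar> \<le> ?b"
    proof -
      have "mnorm k (\<lambda>vs. \<xi> vs - e vs) \<le> mnorm k \<xi> + mnorm k e"
        using mnorm_add[OF \<xi> sym_maps_scale[OF e, of "- 1"]] mnorm_scale_le[OF e, of "- 1"] by simp
      then show ?thesis
        by (intro order_trans[OF K[OF sym_maps_diff[OF \<xi> e]]] mult_left_mono) auto
    qed
    ultimately show ?thesis unfolding lam_step_def by (intro abs_min_le abs_average_le)
  qed
  moreover have "0 \<le> K + mnorm k e" using K0 me by simp
  ultimately show ?thesis unfolding tame_integrand_def by blast
qed

text \<open>
  Let \<open>U\<close> be the set where the two-point average along \<open>D\<^sup>k\<phi>\<close> is smaller than the integrand itself.
  The two-point average with amplitude \<open>\<rho> = indicator U\<close> is the integrand of the claim, and smooth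
  amplitudes approximate this one.
\<close>

lemma nonneg_on_tests_lam_step:
  fixes G :: "'a::euclidean_space \<Rightarrow> ('a list \<Rightarrow> 'b::euclidean_space) \<Rightarrow> real"
  assumes G: "tame_integrand k a G" and a: "locally_integrable a" and R: "0 < R"
    and test: "nonneg_on_tests k R G"
  shows "nonneg_on_tests k R (\<lambda>x. lam_step (rank1 k v w) (G x))"
  unfolding nonneg_on_tests_def
proof (intro allI impI)
  fix \<phi> :: "'a \<Rightarrow> 'b" assume \<phi>: "smooth \<phi>" "vanishes_beyond R \<phi>"
  define e where "e = rank1 k v w"
  have e: "e \<in> sym_maps k" unfolding e_def by (rule rank1_sym_maps)
  note D\<phi> = Dk_sym_maps[OF \<phi>(1)]
  define A where "A y x = (G x (\<lambda>vs. Dk k \<phi> x vs + y *\<^sub>R e vs)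
      + G x (\<lambda>vs. Dk k \<phi> x vs - y *\<^sub>R e vs)) / 2" for y x
  have target: "(\<lambda>vs. Dk k \<phi> x vs + y *\<^sub>R e vs) \<in> sym_maps k" "(\<lambda>vs. Dk k \<phi> x vs - y *\<^sub>R e vs)
      \<in> sym_maps k" for x y
    by (intro sym_maps_add sym_maps_diff sym_maps_scale D\<phi> e)+
  have A_meas: "(\<lambda>x. A (\<rho> x) x) \<in> borel_measurable lebesgue" if "\<rho> \<in> borel_measurable lebesgue" for \<rho>
    unfolding A_def
    by (intro borel_measurable_divide borel_measurable_add borel_measurable_const
        tame_integrand_measurable_along[OF G target(1)] tame_integrand_measurable_along[OF G target(2)]
        borel_measurable_diff borel_measurable_scaleR Dk_measurable \<phi> that)
  define U where "U = {x \<in> space lebesgue. A 1 x < G x (Dk k \<phi> x)} \<inter> cball 0 R"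
  have "{x \<in> space lebesgue. A 1 x < G x (Dk k \<phi> x)} \<in> sets lebesgue"
    by (rule borel_measurable_less[OF A_meas[of "\<lambda>x. 1"] tame_integrand_measurable_along[OF G D\<phi>
        Dk_measurable[OF \<phi>(1)]]]) simp
  then have U: "U \<in> sets lebesgue" "U \<subseteq> cball 0 R"
    unfolding U_def using fmeasurableD[OF lmeasurable_cball[of 0 R]] by (auto intro!: sets.Int)
  obtain \<rho> where \<rho>: "\<And>m. smooth_alg R (\<rho> m)" "\<And>m. vanishes_beyond R (\<rho> m)" "\<And>m x. \<bar>\<rho> m x\<bar> \<le> 2"
    and \<rho>_lim: "AE x in lebesgue. (\<lambda>m::nat. \<rho> m x) \<longlonglongrightarrow> indicator U x"
    using smooth_approximation_of_indicator[OF U R] by blast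
  obtain K where K0: "0 \<le> K" and K: "\<And>x \<xi>. \<xi> \<in> sym_maps k \<Longrightarrow> \<bar>G x \<xi>\<bar> \<le> \<bar>a x\<bar> * (K + mnorm k \<xi>)"
    using G unfolding tame_integrand_def by blast
  obtain B where B0: "0 \<le> B" and B: "\<And>x. mnorm k (Dk k \<phi> x) \<le> B" using Dk_bounded[OF \<phi>] by blast
  define C where "C = K + (B + 2 * mnorm k e)"
  have G_bound: "\<bar>G x (\<lambda>vs. Dk k \<phi> x vs + y *\<^sub>R e vs)\<bar> \<le> \<bar>a x\<bar> * C" if "\<bar>y\<bar> \<le> 2" for x y
  proof -
    have "mnorm k (\<lambda>vs. Dk k \<phi> x vs + y *\<^sub>R e vs) \<le> mnorm k (Dk k \<phi> x) + \<bar>y\<bar> * mnorm k e"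
      by (intro order_trans[OF mnorm_add add_mono] sym_maps_scale D\<phi> e order_refl mnorm_scale_le)
    also have "\<dots> \<le> B + 2 * mnorm k e"
      by (intro add_mono B mult_right_mono that mnorm_nonneg[OF sym_maps_multilinear[OF e]])
    finally show ?thesis
      unfolding C_def by (intro order_trans[OF K[OF target(1)]] mult_left_mono add_left_mono) auto
  qed
  show "0 \<le> (LINT x|lebesgue. indicator (cball 0 R) x * lam_step (rank1 k v w) (G x) (Dk k \<phi> x))"
    unfolding e_def[symmetric]
  proof (rule dominated_limit_nonneg[OF a, where s = "\<lambda>m x. A (\<rho> m x) x" and C = C])
    have "\<rho> m \<in> borel_measurable lebesgue" for m
      using borel_measurable_continuous_onI[OF smooth_alg_continuous[OF \<rho>(1)]]
      by (simp add: measurable_completion)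
    then show "(\<lambda>x. A (\<rho> m x) x) \<in> borel_measurable lebesgue" for m by (rule A_meas)
    show "(\<lambda>x. lam_step e (G x) (Dk k \<phi> x)) \<in> borel_measurable lebesgue"
      by (rule tame_integrand_measurable_along[OF tame_integrand_lam_step[OF G e] D\<phi> Dk_measurable[OF
          \<phi>(1)]])
    show "\<bar>A (\<rho> m x) x\<bar> \<le> \<bar>a x\<bar> * C" for m x
      unfolding A_def
      using G_bound[of "\<rho> m x" x] G_bound[of "- \<rho> m x" x] \<rho>(3)[of m x]
      by (intro abs_average_le) auto
    show "0 \<le> (LINT x|lebesgue. indicator (cball 0 R) x * A (\<rho> m x) x)" for m
      unfolding A_def e_def by (rule two_point_average_nonneg[OF G a test \<rho>(1,2) \<phi>])
    show "AE x in lebesgue. x \<in> cball 0 R \<longrightarrow> (\<lambda>m. A (\<rho> m x) x) \<longlonglongrightarrow> lam_step e (G x) (Dk k \<phi> x)"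
      using \<rho>_lim
    proof (eventually_elim, intro impI)
      fix x assume lim: "(\<lambda>m. \<rho> m x) \<longlonglongrightarrow> indicator U x" and x: "x \<in> cball 0 R"
      have cont: "sym_continuous k (G x)" using G by (simp add: tame_integrand_def)
      have G_lim: "(\<lambda>m. G x (\<lambda>vs. Dk k \<phi> x vs + y m *\<^sub>R e vs)) \<longlonglongrightarrow> G x (\<lambda>vs. Dk k \<phi> x vs + z *\<^sub>R e vs)"
        if "y \<longlonglongrightarrow> z" for y z
      proof (rule sym_continuous_sequentially[OF cont target(1) target(1)])
        show "(\<lambda>m. mnorm k (\<lambda>vs. (Dk k \<phi> x vs + y m *\<^sub>R e vs) - (Dk k \<phi> x vs + z *\<^sub>R e vs))) \<longlonglongrightarrow> 0"
        proof (rule Lim_null_comparison)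
          have "(\<lambda>m. \<bar>y m - z\<bar>) \<longlonglongrightarrow> \<bar>z - z\<bar>" by (intro tendsto_intros that)
          then show "(\<lambda>m. \<bar>y m - z\<bar> * mnorm k e) \<longlonglongrightarrow> 0" by (intro tendsto_mult_left_zero) simp
          have "(\<lambda>vs. (Dk k \<phi> x vs + y m *\<^sub>R e vs) - (Dk k \<phi> x vs + z *\<^sub>R e vs))
              = (\<lambda>vs. (y m - z) *\<^sub>R e vs)" for m
            by (simp add: scaleR_diff_left)
          then show "\<forall>\<^sub>F m in sequentially. norm (mnorm k (\<lambda>vs. (Dk k \<phi> x vs
              + y m *\<^sub>R e vs) - (Dk k \<phi> x vs + z *\<^sub>R e vs)))
              \<le> \<bar>y m - z\<bar> * mnorm k e"
            using mnorm_scale_le[OF e] mnorm_nonneg[OF sym_maps_multilinear[OF sym_maps_scale[OF e]]]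
            by simp
        qed
      qed
      have A_eq: "A y x = (G x (\<lambda>vs. Dk k \<phi> x vs + y *\<^sub>R e vs) + G x (\<lambda>vs. Dk k \<phi> x vs
          + (- y) *\<^sub>R e vs)) / 2" for y
        unfolding A_def by simp
      have "(\<lambda>m. A (\<rho> m x) x) \<longlonglongrightarrow> A (indicator U x) x"
        unfolding A_eq by (intro tendsto_divide tendsto_add G_lim tendsto_minus lim tendsto_const) simp
      moreover have "A (indicator U x) x = lam_step e (G x) (Dk k \<phi> x)"
        using x by (auto simp: U_def A_def lam_step_def min_def indicator_def)
      ultimately show "(\<lambda>m. A (\<rho> m x) x) \<longlonglongrightarrow> lam_step e (G x) (Dk k \<phi> x)" by simp
    qed
  qed
qed

primrec lam_iter ::
    "(nat \<Rightarrow> 'a list \<Rightarrow> 'b::real_vector) \<Rightarrow> (('a list \<Rightarrow> 'b) \<Rightarrow> real) \<Rightarrow> nat \<Rightarrow> ('a list \<Rightarrow> 'b) \<Rightarrow> real" where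
  "lam_iter es f 0 = f"
| "lam_iter es f (Suc j) = lam_step (es j) (lam_iter es f j)"

lemma lam_iter_eq_lam_hull:
  fixes E :: "nat \<Rightarrow> 'a list \<Rightarrow> 'b::real_vector" and \<sigma> :: "nat \<Rightarrow> nat \<times> rat"
  assumes \<sigma>d: "\<And>j. fst (\<sigma> j) < d"
    and es: "\<And>j. es j = (\<lambda>us. real_of_rat (snd (\<sigma> j)) *\<^sub>R E (fst (\<sigma> j)) us)"
  shows "lam_hull \<sigma> (\<lambda>c. f (\<lambda>us. \<Sum>i<d. real_of_rat (c i) *\<^sub>R E i us)) j c
    = lam_iter es f j (\<lambda>us. \<Sum>i<d. real_of_rat (c i) *\<^sub>R E i us)"
proof (induction j arbitrary: c)
  case (Suc j)
  let ?i = "fst (\<sigma> j)" and ?q = "snd (\<sigma> j)"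
  have upd: "(\<lambda>us. \<Sum>i<d. real_of_rat ((c(?i := c ?i + q)) i) *\<^sub>R E i us)
      = (\<lambda>us. (\<Sum>i<d. real_of_rat (c i) *\<^sub>R E i us) + real_of_rat q *\<^sub>R E ?i us)" for q
  proof
    fix us
    have "(\<Sum>i<d. real_of_rat ((c(?i := c ?i + q)) i) *\<^sub>R E i us)
        = (\<Sum>i<d. real_of_rat (c i) *\<^sub>R E i us + (if i = ?i then real_of_rat q *\<^sub>R E i us else 0))"
      by (intro sum.cong) (auto simp: of_rat_add scaleR_add_left)
    also have "\<dots> = (\<Sum>i<d. real_of_rat (c i) *\<^sub>R E i us) + real_of_rat q *\<^sub>R E ?i us"
      using \<sigma>d[of j] by (simp add: sum.distrib)
    finally show "(\<Sum>i<d. real_of_rat ((c(?i := c ?i + q)) i) *\<^sub>R E i us)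
        = (\<Sum>i<d. real_of_rat (c i) *\<^sub>R E i us) + real_of_rat q *\<^sub>R E ?i us" .
  qed
  have minus: "c(?i := c ?i - ?q) = c(?i := c ?i + - ?q)" by simp
  show ?case
    unfolding lam_hull.simps lam_iter.simps lam_step_def Suc minus upd es
    by (simp add: of_rat_minus)
qed simp

text \<open>
  Coordinates with respect to the family \<open>E\<close> turn laminations in its directions into averages along
  coordinate axes. Rational coordinates are dense, and \<open>f\<close> is continuous.
\<close>

lemma nonneg_of_lam_iter_nonneg:
  fixes f :: "('a::euclidean_space list \<Rightarrow> 'b::euclidean_space) \<Rightarrow> real"
    and \<sigma> :: "nat \<Rightarrow> nat \<times> rat" and E :: "nat \<Rightarrow> 'a list \<Rightarrow> 'b"
  assumes cont: "sym_continuous k f"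
    and hom: "\<And>t \<xi>. \<xi> \<in> sym_maps k \<Longrightarrow> f (\<lambda>vs. t *\<^sub>R \<xi> vs) = \<bar>t\<bar> * f \<xi>"
    and bound: "\<And>\<xi>. \<xi> \<in> sym_maps k \<Longrightarrow> f \<xi> \<le> A * mnorm k \<xi>" and A: "0 \<le> A"
    and \<sigma>: "\<And>m i q. i < d \<Longrightarrow> \<exists>j\<ge>m. \<sigma> j = (i, q)" and \<sigma>d: "\<And>j. fst (\<sigma> j) < d"
    and E: "\<And>i. E i \<in> sym_maps k"
    and es: "\<And>j. es j = (\<lambda>us. real_of_rat (snd (\<sigma> j)) *\<^sub>R E (fst (\<sigma> j)) us)"
    and zero: "\<And>j. 0 \<le> lam_iter es f j (\<lambda>vs. 0)"
    and \<xi>: "\<xi> = (\<lambda>us. \<Sum>i<d. c i *\<^sub>R E i us)"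
  shows "0 \<le> f \<xi>"
proof -
  define h where "h = (\<lambda>c. f (\<lambda>us. \<Sum>i<d. real_of_rat (c i) *\<^sub>R E i us))"
  have S: "(\<lambda>us. \<Sum>i<d. y i *\<^sub>R E i us) \<in> sym_maps k" for y by (intro sym_maps_sum E)
  have mE: "0 \<le> mnorm k (E i)" for i by (rule mnorm_nonneg[OF sym_maps_multilinear[OF E]])
  define B where "B = A * (\<Sum>i<d. mnorm k (E i))"
  have rational: "0 \<le> h c" for c
  proof (rule even_homogeneous_nonneg[OF \<sigma> \<sigma>d, where C = B])
    show "depends_on_first d h"
      unfolding depends_on_first_def h_def by (intro allI impI arg_cong[where f = f] ext sum.cong) auto
    show "h (\<lambda>i. q * c i) = \<bar>real_of_rat q\<bar> * h c" for q c
    proof -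
      have "(\<lambda>us. \<Sum>i<d. real_of_rat (q * c i) *\<^sub>R E i us)
          = (\<lambda>us. real_of_rat q *\<^sub>R (\<Sum>i<d. real_of_rat (c i) *\<^sub>R E i us))"
        by (simp add: of_rat_mult scaleR_sum_right)
      then show ?thesis unfolding h_def using hom[OF S] by simp
    qed
    show "0 \<le> B" unfolding B_def by (intro mult_nonneg_nonneg A sum_nonneg mE)
    show "h c \<le> B * coord_norm d c" for c
    proof -
      have "h c \<le> A * mnorm k (\<lambda>us. \<Sum>i<d. real_of_rat (c i) *\<^sub>R E i us)"
        unfolding h_def by (rule bound[OF S])
      also have "\<dots> \<le> A * (\<Sum>i<d. \<bar>real_of_rat (c i)\<bar> * mnorm k (E i))"
        by (intro mult_left_mono mnorm_sum E A)
      also have "\<dots> \<le> A * (\<Sum>i<d. \<bar>real_of_rat (c i)\<bar> * (\<Sum>i<d. mnorm k (E i)))"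
        by (intro mult_left_mono sum_mono A member_le_sum mE) auto
      also have "\<dots> = B * coord_norm d c"
        unfolding B_def coord_norm_def sum_distrib_right[symmetric] by (simp only: mult_ac)
      finally show ?thesis .
    qed
    show "0 \<le> lam_hull \<sigma> h j (\<lambda>i. 0)" for j
      unfolding h_def lam_iter_eq_lam_hull[where E = E and \<sigma> = \<sigma> and es = es and d = d, OF \<sigma>d es]
        using zero[of j] by simp
  qed
  define c' where "c' m i = (of_int \<lfloor>real (Suc m) * c i\<rfloor> / of_nat (Suc m) :: rat)" for m i
  have c': "real_of_rat (c' m i) = real_of_int \<lfloor>real (Suc m) * c i\<rfloor> / real (Suc m)" for m i
    by (simp only: c'_def of_rat_divide of_rat_of_int_eq of_rat_of_nat_eq)
  have "(\<lambda>m. f (\<lambda>us. \<Sum>i<d. real_of_rat (c' m i) *\<^sub>R E i us)) \<longlonglongrightarrow> f (\<lambda>us. \<Sum>i<d. c i *\<^sub>R E i us)"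
    unfolding c'
    by (intro sym_continuous_sequentially[OF cont S S] coordinate_approximation E floor_approximation)
  then have "0 \<le> f (\<lambda>us. \<Sum>i<d. c i *\<^sub>R E i us)"
    by (rule LIMSEQ_le_const) (use rational in \<open>simp add: h_def\<close>)
  then show ?thesis unfolding \<xi> .
qed

section \<open>Nonnegativity from countably many laminations\<close>

text \<open>
  Enumerate triples and forget the first component.
\<close>

lemma exists_recurrent_enumeration:
  assumes "0 < d"
  shows "\<exists>\<sigma> :: nat \<Rightarrow> nat \<times> rat. (\<forall>j. fst (\<sigma> j) < d) \<and> (\<forall>m i q. i < d \<longrightarrow> (\<exists>j\<ge>m. \<sigma> j = (i, q)))"
proof -
  \<comment> \<open>the remainder only serves to keep the first component below \<open>d\<close>\<close>
  define \<sigma> where "\<sigma> j = (case snd (from_nat j :: nat \<times> nat \<times> rat) of (i, q) \<Rightarrow> (i mod d, q))" for j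
  have "fst (\<sigma> j) < d" for j using assms by (simp add: \<sigma>_def case_prod_unfold)
  moreover have "\<exists>j\<ge>m. \<sigma> j = (i, q)" if "i < d" for m i q
  proof -
    have "inj (\<lambda>p::nat. to_nat (p, i, q))" by (simp add: inj_def)
    then have "infinite (range (\<lambda>p::nat. to_nat (p, i, q)))" by (rule range_inj_infinite)
    then obtain p where "m \<le> to_nat (p :: nat, i, q)"
      unfolding infinite_nat_iff_unbounded_le by blast
    moreover have "\<sigma> (to_nat (p, i, q)) = (i, q)" using that by (simp add: \<sigma>_def)
    ultimately show ?thesis by blast
  qed
  ultimately show ?thesis by blast
qed

lemma lam_iter_le: "lam_iter es f j \<xi> \<le> f \<xi>"
  by (induction j) (auto simp: lam_step_def min_le_iff_disj)

text \<open>
  The test map \<open>0\<close> shows that the integral over every ball of a nonpositive function is nonnegative.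
\<close>

lemma zero_if_nonneg_on_tests:
  fixes G :: "'a::euclidean_space \<Rightarrow> ('a list \<Rightarrow> 'b::euclidean_space) \<Rightarrow> real"
  assumes G: "tame_integrand k a G" and a: "locally_integrable a"
    and test: "\<And>R. 0 < R \<Longrightarrow> nonneg_on_tests k R G" and le: "\<And>x. G x (\<lambda>vs. 0) \<le> 0"
  shows "AE x in lebesgue. G x (\<lambda>vs. 0) = 0"
proof -
  have zero: "smooth (\<lambda>x::'a. 0 :: 'b)" "iter_deriv (\<lambda>x::'a. 0 :: 'b) vs = (\<lambda>x. 0)" for vs
    by (rule smooth_iter_derivI[where g = "\<lambda>vs x. 0"]; simp)+
  have Dk0: "Dk k (\<lambda>x::'a. 0 :: 'b) x = (\<lambda>vs. 0)" for x
    by (auto simp: Dk_def zero(2))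
  have "AE x in lebesgue. x \<in> cball 0 (real (Suc n)) \<longrightarrow> G x (\<lambda>vs. 0) = 0" for n
  proof -
    let ?f = "\<lambda>x. indicator (cball 0 (real (Suc n))) x * G x (\<lambda>vs. 0)"
    have int: "integrable lebesgue ?f"
      by (rule tame_integrand_integrable[OF G a sym_maps_zero, where B = 0]) (simp_all add: mnorm_zero)
    have "vanishes_beyond (real (Suc n)) (\<lambda>x::'a. 0 :: 'b)" by (simp add: vanishes_beyond_def)
    then have "0 \<le> integral\<^sup>L lebesgue ?f"
      using test[of "real (Suc n)"] zero(1) unfolding nonneg_on_tests_def by (fastforce simp: Dk0)
    moreover have nn: "AE x in lebesgue. 0 \<le> - ?f x"
      using le by (intro AE_I2) (simp add: indicator_def)
    moreover have "0 \<le> integral\<^sup>L lebesgue (\<lambda>x. - ?f x)" using nn by (rule integral_nonneg_AE)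
    ultimately have "integral\<^sup>L lebesgue (\<lambda>x. - ?f x) = 0" by (simp only: integral_minus)
    then have "AE x in lebesgue. - ?f x = 0"
      using integral_nonneg_eq_0_iff_AE[OF integrable_minus[OF int] nn] by blast
    then show ?thesis by eventually_elim (simp add: indicator_def split: if_splits)
  qed
  then have "AE x in lebesgue. \<forall>n. x \<in> cball 0 (real (Suc n)) \<longrightarrow> G x (\<lambda>vs. 0) = 0"
    unfolding AE_all_countable by (rule allI)
  then show ?thesis
  proof eventually_elim
    case (elim x)
    obtain n where "norm x \<le> real n" using real_arch_simple by blast
    then have "x \<in> cball 0 (real (Suc n))" by simp
    then show ?case using elim by blast
  qed
qed

text \<open>
  Laminate in all rational multiples of the directions of a finite spanning family. Each iterate
  still has nonnegative integrals and is at most \<open>F x 0 = 0\<close> at the zero map, hence vanishes there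
  for almost every \<open>x\<close>. There are countably many iterates, so one null set serves them all, and
  outside it the pointwise argument applies.
\<close>

lemma nonneg_AE_of_nonneg_on_tests:
  fixes F :: "'a::euclidean_space \<Rightarrow> ('a list \<Rightarrow> 'b::euclidean_space) \<Rightarrow> real"
  assumes F: "tame_integrand k a F" and a: "locally_integrable a"
    and test: "\<And>R. 0 < R \<Longrightarrow> nonneg_on_tests k R F"
    and hom: "\<And>x t \<xi>. \<xi> \<in> sym_maps k \<Longrightarrow> F x (\<lambda>vs. t *\<^sub>R \<xi> vs) = \<bar>t\<bar> * F x \<xi>"
    and bound: "\<And>x \<xi>. \<xi> \<in> sym_maps k \<Longrightarrow> F x \<xi> \<le> \<bar>a x\<bar> * mnorm k \<xi>"
  shows "AE x in lebesgue. \<forall>\<xi>\<in>sym_maps k. 0 \<le> F x \<xi>"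
proof -
  have F0: "F x (\<lambda>vs. 0) = 0" for x using hom[OF sym_maps_zero, of x 0] by simp
  obtain d :: nat and t and bs :: "nat \<Rightarrow> 'a list" and v and w :: "nat \<Rightarrow> 'b"
    where *: "(\<forall>i<d. length (bs i) = k) \<and> (\<forall>\<xi>\<in>sym_maps k. \<forall>us.
        \<xi> us = (\<Sum>i<d. (t i * (\<xi> (bs i) \<bullet> w i)) *\<^sub>R rank1 k (v i) (w i) us))"
    using sym_maps_sum_rank1[of k, where 'a = 'a and 'b = 'b] by (elim exE)
  define E where "E i = rank1 k (v i) (w i)" for i
  have E: "E i \<in> sym_maps k" for i unfolding E_def by (rule rank1_sym_maps)
  have rep: "\<xi> = (\<lambda>us. \<Sum>i<d. (t i * (\<xi> (bs i) \<bullet> w i)) *\<^sub>R E i us)" if "\<xi> \<in> sym_maps k" for \<xi>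
    using conjunct2[OF *, rule_format, OF that] unfolding E_def by (rule ext)
  show ?thesis
  proof (cases "d = 0")
    case True
    have "F x \<xi> = 0" if "\<xi> \<in> sym_maps k" for x \<xi>
    proof -
      have "\<xi> = (\<lambda>us. 0)" using rep[OF that] unfolding True by simp
      then show ?thesis by (simp only: F0)
    qed
    then show ?thesis by simp
  next
    case False
    then obtain \<sigma> :: "nat \<Rightarrow> nat \<times> rat"
      where enum: "(\<forall>j. fst (\<sigma> j) < d) \<and> (\<forall>m i q. i < d \<longrightarrow> (\<exists>j\<ge>m. \<sigma> j = (i, q)))"
      using exists_recurrent_enumeration[of d] by blast
    have \<sigma>d: "fst (\<sigma> j) < d" for j using enum by blast
    have \<sigma>: "\<exists>j\<ge>m. \<sigma> j = (i, q)" if "i < d" for m i q using enum that by blast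
    define es where "es j = rank1 k (v (fst (\<sigma> j))) (real_of_rat (snd (\<sigma> j)) *\<^sub>R w (fst (\<sigma> j)))" for j
    have es: "es j = (\<lambda>us. real_of_rat (snd (\<sigma> j)) *\<^sub>R E (fst (\<sigma> j)) us)" for j
      unfolding es_def E_def by (rule rank1_scale)
    have tame: "tame_integrand k a (\<lambda>x. lam_iter es (F x) j)" for j
    proof (induction j)
      case (Suc j)
      from tame_integrand_lam_step[OF this, of "es j"] show ?case
        by (simp add: es_def rank1_sym_maps)
    qed (simp add: F)
    have tests: "nonneg_on_tests k R (\<lambda>x. lam_iter es (F x) j)" if R: "0 < R" for R j
    proof (induction j)
      case (Suc j)
      from nonneg_on_tests_lam_step[OF tame a R this] show ?case by (simp add: es_def)
    qed (simp add: test[OF R])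
    have "AE x in lebesgue. lam_iter es (F x) j (\<lambda>vs. 0) = 0" for j
      by (rule zero_if_nonneg_on_tests[OF tame a tests])
          (use lam_iter_le[of es "F _" j "\<lambda>vs. 0"] F0 in \<open>simp_all\<close>)
    then have "AE x in lebesgue. \<forall>j. lam_iter es (F x) j (\<lambda>vs. 0) = 0"
      unfolding AE_all_countable by (rule allI)
    then show ?thesis
    proof eventually_elim
      case (elim x)
      show ?case
      proof
        fix \<xi> :: "'a list \<Rightarrow> 'b" assume \<xi>: "\<xi> \<in> sym_maps k"
        have "sym_continuous k (F x)" using F by (simp add: tame_integrand_def)
        then show "0 \<le> F x \<xi>"
          by (rule nonneg_of_lam_iter_nonneg[OF _ hom bound abs_ge_zero \<sigma> \<sigma>d E es _ rep[OF \<xi>]])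
             (use elim in \<open>simp_all\<close>)
      qed
    qed
  qed
qed

theorem theorem5p1:
  fixes k :: nat
    and F :: "real ^ 'n \<Rightarrow> ((real ^ 'n) list \<Rightarrow> real ^ 'm) \<Rightarrow> real"
    and a :: "real ^ 'n \<Rightarrow> real"
  assumes "k \<ge> 1"
    and "caratheodory k F"
    and "locally_integrable a"
    and "AE x in lebesgue. \<forall>t. \<forall>\<xi> \<in> sym_maps k.
           F x (\<lambda>vs. t *\<^sub>R \<xi> vs) = \<bar>t\<bar> * F x \<xi> \<and> \<bar>F x \<xi>\<bar> \<le> a x * mnorm k \<xi>"
  shows "(\<forall>\<phi> \<in> test_maps. 0 \<le> (LINT x|lebesgue. F x (Dk k \<phi> x))) \<longleftrightarrow>
         (AE x in lebesgue. \<forall>\<xi> \<in> sym_maps k. 0 \<le> F x \<xi>)"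
proof
  assume nn: "AE x in lebesgue. \<forall>\<xi> \<in> sym_maps k. 0 \<le> F x \<xi>"
  show "\<forall>\<phi> \<in> test_maps. 0 \<le> (LINT x|lebesgue. F x (Dk k \<phi> x))"
  proof
    fix \<phi> :: "real ^ 'n \<Rightarrow> real ^ 'm" assume "\<phi> \<in> test_maps"
    then have "smooth \<phi>" by (simp add: test_maps_def)
    then show "0 \<le> (LINT x|lebesgue. F x (Dk k \<phi> x))"
      using nn by (intro integral_nonneg_AE) (auto elim!: eventually_mono intro: Dk_sym_maps)
  qed
next
  assume test: "\<forall>\<phi> \<in> test_maps. 0 \<le> (LINT x|lebesgue. F x (Dk k \<phi> x))"
  have "AE x in lebesgue. continuous_map (sym_topology k) euclidean (F x)"
    using assms(2) unfolding caratheodory_def by blast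
  then have "AE x in lebesgue. sym_continuous k (F x) \<and> (\<forall>t. \<forall>\<xi> \<in> sym_maps k.
      F x (\<lambda>vs. t *\<^sub>R \<xi> vs) = \<bar>t\<bar> * F x \<xi> \<and> \<bar>F x \<xi>\<bar> \<le> a x * mnorm k \<xi>)"
    using assms(4) by eventually_elim (blast intro: continuous_map_imp_sym_continuous)
  then obtain N where N: "N \<in> null_sets lebesgue"
    and cont: "\<And>x. x \<notin> N \<Longrightarrow> sym_continuous k (F x)"
    and hom: "\<And>x t \<xi>. x \<notin> N \<Longrightarrow> \<xi> \<in> sym_maps k \<Longrightarrow> F x (\<lambda>vs. t *\<^sub>R \<xi> vs) = \<bar>t\<bar> * F x \<xi>"
    and bound: "\<And>x \<xi>. x \<notin> N \<Longrightarrow> \<xi> \<in> sym_maps k \<Longrightarrow> \<bar>F x \<xi>\<bar> \<le> a x * mnorm k \<xi>"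
    unfolding eventually_ae_filter by auto
  have notN: "AE x in lebesgue. x \<notin> N" using N by (rule AE_not_in)
  \<comment> \<open>from here on every hypothesis holds at every point\<close>
  define F' where "F' x \<xi> = (if x \<in> N then 0 else F x \<xi>)" for x \<xi>
  have mnn: "0 \<le> mnorm k \<xi>" if "\<xi> \<in> sym_maps k" for \<xi> :: "(real ^ 'n) list \<Rightarrow> real ^ 'm"
    by (rule mnorm_nonneg[OF sym_maps_multilinear[OF that]])
  have bound': "\<bar>F' x \<xi>\<bar> \<le> \<bar>a x\<bar> * mnorm k \<xi>" if \<xi>: "\<xi> \<in> sym_maps k" for x \<xi>
  proof (cases "x \<in> N")
    case False
    have "a x * mnorm k \<xi> \<le> \<bar>a x\<bar> * mnorm k \<xi>" by (intro mult_right_mono mnn \<xi>) simp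
    then show ?thesis using bound[OF False \<xi>] False by (simp add: F'_def)
  qed (simp add: F'_def mnn \<xi>)
  have hom': "F' x (\<lambda>vs. t *\<^sub>R \<xi> vs) = \<bar>t\<bar> * F' x \<xi>" if "\<xi> \<in> sym_maps k" for x t \<xi>
    using hom[OF _ that] by (simp add: F'_def)
  have tame: "tame_integrand k a F'"
    unfolding tame_integrand_def
  proof (intro conjI ballI allI exI[of _ 0] order_refl)
    fix \<xi> :: "(real ^ 'n) list \<Rightarrow> real ^ 'm" assume \<xi>: "\<xi> \<in> sym_maps k"
    have "(\<lambda>x. F x \<xi>) \<in> borel_measurable lebesgue" using assms(2) \<xi> by (simp add: caratheodory_def)
    moreover have "AE x in lebesgue. F x \<xi> = F' x \<xi>" using notN by eventually_elim (simp add: F'_def)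
    ultimately show "(\<lambda>x. F' x \<xi>) \<in> borel_measurable lebesgue" by (rule borel_measurable_AE)
    show "\<bar>F' x \<xi>\<bar> \<le> \<bar>a x\<bar> * (0 + mnorm k \<xi>)" for x using bound'[OF \<xi>] by simp
  next
    fix x show "sym_continuous k (F' x)"
      using cont[of x] unfolding F'_def sym_continuous_def by (cases "x \<in> N") (auto intro: exI[of _ 1])
  qed
  have "nonneg_on_tests k R F'" for R
    unfolding nonneg_on_tests_def
  proof (intro allI impI)
    fix \<phi> :: "real ^ 'n \<Rightarrow> real ^ 'm" assume \<phi>: "smooth \<phi>" "vanishes_beyond R \<phi>"
    have "closure {x. \<phi> x \<noteq> 0} \<subseteq> cball 0 R"
      using \<phi>(2) by (intro closure_minimal closed_cball)
          (auto simp: vanishes_beyond_def not_le[symmetric])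
    then have "compact (closure {x. \<phi> x \<noteq> 0})"
      using compact_cball closed_closure by (metis bounded_cball bounded_subset
          compact_eq_bounded_closed)
    then have "\<phi> \<in> test_maps" using \<phi>(1) by (simp add: test_maps_def)
    then have "0 \<le> (LINT x|lebesgue. F x (Dk k \<phi> x))" using test by blast
    also have "\<dots> = (LINT x|lebesgue. indicator (cball 0 R) x * F' x (Dk k \<phi> x))"
    proof (rule integral_cong_AE)
      have meas: "(\<lambda>x. F' x (Dk k \<phi> x)) \<in> borel_measurable lebesgue"
        by (rule tame_integrand_measurable_along[OF tame Dk_sym_maps[OF \<phi>(1)] Dk_measurable[OF \<phi>(1)]])
      moreover have "AE x in lebesgue. F' x (Dk k \<phi> x) = F x (Dk k \<phi> x)"
        using notN by eventually_elim (simp add: F'_def)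
      ultimately show "(\<lambda>x. F x (Dk k \<phi> x)) \<in> borel_measurable lebesgue" by (rule borel_measurable_AE)
      show "(\<lambda>x. indicator (cball 0 R) x * F' x (Dk k \<phi> x)) \<in> borel_measurable lebesgue"
        by (intro borel_measurable_times indicator_cball_measurable meas)
      show "AE x in lebesgue. F x (Dk k \<phi> x) = indicator (cball 0 R) x * F' x (Dk k \<phi> x)"
        using notN
      proof eventually_elim
        case (elim x)
        show ?case
        proof (cases "x \<in> cball 0 R")
          case True
          then show ?thesis using elim by (simp add: F'_def)
        next
          case False
          then have "Dk k \<phi> x = (\<lambda>vs. 0)"
            using vanishes_beyond_iter_deriv[OF \<phi>] by (auto simp: Dk_def vanishes_beyond_def)
          then show ?thesis using False hom[OF elim sym_maps_zero, of 0] by simp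
        qed
      qed
    qed
    finally show "0 \<le> (LINT x|lebesgue. indicator (cball 0 R) x * F' x (Dk k \<phi> x))" .
  qed
  moreover have "F' x \<xi> \<le> \<bar>a x\<bar> * mnorm k \<xi>" if "\<xi> \<in> sym_maps k" for x \<xi>
    using bound'[OF that, of x] by linarith
  ultimately have "AE x in lebesgue. \<forall>\<xi>\<in>sym_maps k. 0 \<le> F' x \<xi>"
    by (intro nonneg_AE_of_nonneg_on_tests[OF tame assms(3) _ hom'])
  with notN show "AE x in lebesgue. \<forall>\<xi> \<in> sym_maps k. 0 \<le> F x \<xi>"
    by eventually_elim (simp add: F'_def)
qed

end
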